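(* Let $n,N$ be positive integers, $\lambda\in\mathcal{O}(n,N)$, $\Lambda,\Lambda'\in\mathcal{L}(\lambda,n)$ and $k\in\{1,\dots,n-1\}$. Suppose that $\Lambda(k-1)=\Lambda(k+1)$ and $v(\Lambda')\in V(\Lambda,k)$. Then $$\bar s_k(\Lambda,\Lambda')\,\bar s_k(\Lambda',\Lambda)=\bar s_k(\Lambda,\Lambda)\,\bar s_k(\Lambda',\Lambda').$$
   Context: Brauer algebra. For $n\ge1$ let $\mathcal{G}(n)$ be the set of partitions of $\{1,\dots,n,\bar1,\dots,\bar n\}$ into pairs (graphs with $n$ edges). $B(n,N)$ is the complex associative algebra with basis $b(\gamma)$, $\gamma\in\mathcal{G}(n)$, and product $b(\gamma)b(\gamma')=N^{q}b(\gamma\circ\gamma')$: identify the vertices $\bar1,\dots,\bar n$ of $\gamma$ with $1,\dots,n$ of $\gamma'$, let $q$ be the number of loops, remove the loops and replace the other components by single edges joining their terminal vertices to get $\gamma\circ\gamma'$. A permutation $s\in S(n)$ is identified with $b(\gamma)$, $\gamma$ having edges $\{s(m),\bar m\}$. For $k\neq l$, $(k,l)$ is the transposition and $\overline{(k,l)}=b(\gamma)$ with $\gamma$ having edges $\{k,l\},\{\bar k,\bar l\}$ and $\{m,\bar m\}$, $m\ne k,l$. Put $\bar s_k=\overline{(k,k+1)}$. $B(n-1,N)\subset B(n,N)$ is spanned by the $b(\gamma)$ with $\{n,\bar n\}\in\gamma$. Representations. $N$ is a positive integer, $U=\mathbb{C}^N$ with standard orthonormal basis $u(1),\dots,u(N)$,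 $G=O(N,\mathbb{C})$, $C(n,N)=\operatorname{End}_G(U^{\otimes n})$. $B(n,N)$ maps onto $C(n,N)$: $(k,l)$ permutes the $k$-th and $l$-th tensor factors, and $\overline{(k,l)}$ sends $u(i_1)\otimes\cdots\otimes u(i_n)$ to $\delta_{i_k i_l}\sum_{i=1}^N$ of the same tensor with both the $k$-th and $l$-th factors replaced by $u(i)$. $\mathcal{O}(n,N)$ is the set of Young diagrams with at most $N$ boxes in the first two columns together and with $n-2r$ boxes in total, $r=0,1,\dots,[n/2]$. For such a diagram $\lambda$ with $m$ boxes, $U(\lambda,N)$ is Weyl's irreducible representation of $G$: the space of traceless tensors in $U^{\otimes m}$ (those killed by all $\overline{(k,l)}$) decomposes under $G\times S(m)$ as $\bigoplus_\lambda U(\lambda,N)\otimes S^\lambda$, over diagrams $\lambda$ with $m$ boxes and at most $N$ boxes in the first two columns, $S^\lambda$ being the irreducible $S(m)$-module of $\lambda$ (trivial for a one-row diagram). One has $U^{\otimes n}=\bigoplus_{\lambda\in\mathcal{O}(n,N)}U(\lambda,N)\otimes V(\lambda,n)$ with $V(\lambda,n)$ the irreducible $C(n,N)$-modules, also regarded as $B(n,N)$-modules. The restriction of $V(\lambda,n)$ to $C(n-1,N)$ is the multiplicity-free direct sum of $V(\mu,n-1)$ over $\mu\in\mathcal{O}(n-1,N)$ obtained from $\lambda$ by removing or adding one box. Canonical basis. $\mathcal{L}(\lambda,n)$ is the set of sequences $\Lambda=(\Lambda(1),\dots,\Lambda(n))\in\mathcal{O}(1,N)\times\cdots\times\mathcal{O}(n,N)$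 with $\Lambda(n)=\lambda$ and neighbouring terms differing by exactly one box; $\Lambda(0)$ is the empty diagram. The canonical basis of $V(\lambda,n)$ consists of vectors $v(\Lambda)$, $\Lambda\in\mathcal{L}(\lambda,n)$, determined up to nonzero scalars by: $v(\Lambda)$ lies in the component $V(\Lambda(k),k)$ of the restriction of $V(\lambda,n)$ to $C(k,N)$ for every $k=1,\dots,n-1$. $V(\Lambda,k)$ is the subspace of $V(\lambda,n)$ spanned by the vectors $v(\Lambda')$ with $\Lambda'(l)=\Lambda(l)$ for all $l\ne k$. Matrix elements are defined by $\bar s_k\cdot v(\Lambda)=\sum_{\Lambda'\in\mathcal{L}(\lambda,n)}\bar s_k(\Lambda,\Lambda')\,v(\Lambda')$. *)

theory Defs
  imports
    "HOL-Analysis.Analysis"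
    "HOL-Combinatorics.Permutations"
    "HOL-Library.Function_Algebras"
    "HOL-Library.Disjoint_Sets"
begin

section \<open>Complex vector spaces and modules\<close>

class complex_vector = ab_group_add +
  fixes scaleC :: "complex \<Rightarrow> 'a \<Rightarrow> 'a" (infixr "*\<^sub>C" 75)
  assumes scaleC_add_right: "a *\<^sub>C (x + y) = a *\<^sub>C x + a *\<^sub>C y"
    and scaleC_add_left: "(a + b) *\<^sub>C x = a *\<^sub>C x + b *\<^sub>C x"
    and scaleC_scaleC: "a *\<^sub>C b *\<^sub>C x = (a * b) *\<^sub>C x"
    and scaleC_one: "1 *\<^sub>C x = x"

global_interpretation cvec: vector_space "scaleC :: complex \<Rightarrow> 'a \<Rightarrow> 'a :: complex_vector"
  by unfold_locales (simp_all add: scaleC_add_right scaleC_add_left scaleC_scaleC scaleC_one)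

instantiation complex :: complex_vector
begin
definition "a *\<^sub>C (x :: complex) = a * x"
instance by standard (simp_all add: scaleC_complex_def algebra_simps)
end

instantiation "fun" :: (type, complex_vector) complex_vector
begin
definition "a *\<^sub>C f = (\<lambda>x. a *\<^sub>C f x)"
instance
  by standard (simp_all add: scaleC_fun_def fun_eq_iff scaleC_add_right scaleC_add_left
      scaleC_scaleC scaleC_one)
end

text \<open>
  Modules are given by a subspace \<open>V\<close> of an ambient complex vector space together with operators
  \<open>\<rho> a\<close> on it, where \<open>a\<close> ranges over a set \<open>A\<close> (a group or an algebra). A map defined on \<open>V\<close> is
  represented by the function that vanishes outside \<open>V\<close>; hence \<^term>\<open>hom_space\<close> below is again a
  subspace of a function space, and composition and pointwise addition of endomorphisms are the
  ordinary ones.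
\<close>

definition linear_on :: "'v::complex_vector set \<Rightarrow> 'w::complex_vector set \<Rightarrow> ('v \<Rightarrow> 'w) \<Rightarrow> bool" where
  "linear_on V W f \<longleftrightarrow>
     f ` V \<subseteq> W \<and> (\<forall>x\<in>V. \<forall>y\<in>V. f (x + y) = f x + f y) \<and> (\<forall>c. \<forall>x\<in>V. f (c *\<^sub>C x) = c *\<^sub>C f x)"

definition hom_space ::
  "'a set \<Rightarrow> 'v::complex_vector set \<Rightarrow> ('a \<Rightarrow> 'v \<Rightarrow> 'v) \<Rightarrow>
     'w::complex_vector set \<Rightarrow> ('a \<Rightarrow> 'w \<Rightarrow> 'w) \<Rightarrow> ('v \<Rightarrow> 'w) set" where
  "hom_space A V \<rho> W \<sigma> =
     {f. linear_on V W f \<and> (\<forall>x. x \<notin> V \<longrightarrow> f x = 0) \<and> (\<forall>a\<in>A. \<forall>x\<in>V. f (\<rho> a x) = \<sigma> a (f x))}"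

definition isomorphic_modules ::
  "'a set \<Rightarrow> 'v::complex_vector set \<Rightarrow> ('a \<Rightarrow> 'v \<Rightarrow> 'v) \<Rightarrow>
     'w::complex_vector set \<Rightarrow> ('a \<Rightarrow> 'w \<Rightarrow> 'w) \<Rightarrow> bool" where
  "isomorphic_modules A V \<rho> W \<sigma> \<longleftrightarrow> (\<exists>f\<in>hom_space A V \<rho> W \<sigma>. bij_betw f V W)"

definition irreducible_module :: "'a set \<Rightarrow> 'v::complex_vector set \<Rightarrow> ('a \<Rightarrow> 'v \<Rightarrow> 'v) \<Rightarrow> bool" where
  "irreducible_module A V \<rho> \<longleftrightarrow>
     V \<noteq> {0} \<and>
     (\<forall>W. cvec.subspace W \<and> W \<subseteq> V \<and> (\<forall>a\<in>A. \<rho> a ` W \<subseteq> W) \<longrightarrow> W = {0} \<or> W = V)"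

section \<open>Tensors and the orthogonal group\<close>

text \<open>
  \<open>N\<close> is \<open>CARD('N)\<close> and \<open>U\<close> is the space with basis \<open>u(i)\<close>, \<open>i :: 'N\<close>. A tensor in the \<open>n\<close>-th tensor
  power of \<open>U\<close> is the function giving its coordinates with respect to the basis
  \<open>u(i\<^sub>1) \<otimes> \<dots> \<otimes> u(i\<^sub>n)\<close>; it vanishes outside \<^term>\<open>indices n\<close>.
\<close>

type_synonym 'N tensor = "(nat \<Rightarrow> 'N) \<Rightarrow> complex"
type_synonym 'N tensor_op = "'N tensor \<Rightarrow> 'N tensor"

definition indices :: "nat \<Rightarrow> (nat \<Rightarrow> 'N) set" where
  "indices n = {1..n} \<rightarrow>\<^sub>E UNIV"

definition tensors :: "nat \<Rightarrow> 'N tensor set" where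
  "tensors n = {t. \<forall>i. i \<notin> indices n \<longrightarrow> t i = 0}"

definition basis_tensor :: "(nat \<Rightarrow> 'N) \<Rightarrow> 'N tensor" where
  "basis_tensor i = (\<lambda>j. if j = i then 1 else 0)"

definition orthogonal_group :: "(complex ^ 'N ^ 'N::finite) set" where
  "orthogonal_group = {g. orthogonal_matrix g}"

definition group_op :: "nat \<Rightarrow> complex ^ 'N ^ 'N::finite \<Rightarrow> 'N tensor_op" where
  "group_op n g t =
     (\<lambda>i. if i \<in> indices n then \<Sum>j\<in>indices n. (\<Prod>l\<in>{1..n}. g $ i l $ j l) * t j else 0)"

definition centralizer :: "nat \<Rightarrow> 'N::finite tensor_op set" where
  "centralizer n = hom_space orthogonal_group (tensors n) (group_op n) (tensors n) (group_op n)"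

definition centralizer_one :: "nat \<Rightarrow> 'N tensor_op" where
  "centralizer_one n = (\<lambda>t. if t \<in> tensors n then t else 0)"

text \<open>
  For \<open>k \<le> n\<close>, the inclusion of \<open>C(k,N)\<close> in \<open>C(n,N)\<close>: the operator acts on the first \<open>k\<close> tensor
  factors.
\<close>

definition embed_op :: "nat \<Rightarrow> nat \<Rightarrow> 'N tensor_op \<Rightarrow> 'N tensor_op" where
  "embed_op k n F = (\<lambda>t. if t \<in> tensors n then
       (\<lambda>i. if i \<in> indices n then
              F (\<lambda>j. if j \<in> indices k then t (\<lambda>l. if l \<in> {1..k} then j l else i l) else 0)
                (restrict i {1..k})
            else 0)
     else 0)"

definition centralizer_module ::
  "nat \<Rightarrow> 'v::complex_vector set \<Rightarrow> ('N::finite tensor_op \<Rightarrow> 'v \<Rightarrow> 'v) \<Rightarrow> bool" where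
  "centralizer_module n V act \<longleftrightarrow>
     cvec.subspace V \<and>
     (\<forall>F\<in>centralizer n. linear_on V V (act F)) \<and>
     (\<forall>F\<in>centralizer n. \<forall>H\<in>centralizer n. \<forall>x\<in>V.
        act (F + H) x = act F x + act H x \<and> act (F \<circ> H) x = act F (act H x)) \<and>
     (\<forall>F\<in>centralizer n. \<forall>c. \<forall>x\<in>V. act (c *\<^sub>C F) x = c *\<^sub>C act F x) \<and>
     (\<forall>x\<in>V. act (centralizer_one n) x = x)"

section \<open>The Brauer algebra\<close>

text \<open>\<open>Pt m\<close> is the vertex \<open>m\<close>, and \<open>Bar m\<close> is the vertex \<open>m\<close> with a bar.\<close>

datatype vertex = Pt nat | Bar nat

type_synonym diagram = "vertex set set"

definition vertices :: "nat \<Rightarrow> vertex set" where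
  "vertices n = Pt ` {1..n} \<union> Bar ` {1..n}"

definition diagrams :: "nat \<Rightarrow> diagram set" where
  "diagrams n = {\<gamma>. partition_on (vertices n) \<gamma> \<and> (\<forall>e\<in>\<gamma>. card e = 2)}"

text \<open>
  To compose two diagrams, they are drawn on three layers of vertices, the bottom layer of the
  first one being the top layer of the second one.
\<close>

definition upper :: "vertex \<Rightarrow> nat \<times> nat" where
  "upper x = (case x of Pt m \<Rightarrow> (0, m) | Bar m \<Rightarrow> (1, m))"

definition lower :: "vertex \<Rightarrow> nat \<times> nat" where
  "lower x = (case x of Pt m \<Rightarrow> (1, m) | Bar m \<Rightarrow> (2, m))"

definition outer :: "vertex \<Rightarrow> nat \<times> nat" where
  "outer x = (case x of Pt m \<Rightarrow> (0, m) | Bar m \<Rightarrow> (2, m))"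

definition stacked_adj :: "diagram \<Rightarrow> diagram \<Rightarrow> ((nat \<times> nat) \<times> (nat \<times> nat)) set" where
  "stacked_adj \<gamma> \<gamma>' = {(x, y). \<exists>e \<in> (`) upper ` \<gamma> \<union> (`) lower ` \<gamma>'. x \<in> e \<and> y \<in> e}"

definition components :: "nat \<Rightarrow> diagram \<Rightarrow> diagram \<Rightarrow> (nat \<times> nat) set set" where
  "components n \<gamma> \<gamma>' = ({0, 1, 2} \<times> {1..n}) // (stacked_adj \<gamma> \<gamma>')\<^sup>*"

definition loops :: "nat \<Rightarrow> diagram \<Rightarrow> diagram \<Rightarrow> (nat \<times> nat) set set" where
  "loops n \<gamma> \<gamma>' = {C \<in> components n \<gamma> \<gamma>'. C \<subseteq> {1} \<times> {1..n}}"

definition diagram_comp :: "nat \<Rightarrow> diagram \<Rightarrow> diagram \<Rightarrow> diagram" where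
  "diagram_comp n \<gamma> \<gamma>' =
     (\<lambda>C. {x \<in> vertices n. outer x \<in> C}) ` (components n \<gamma> \<gamma>' - loops n \<gamma> \<gamma>')"

text \<open>An element of \<open>B(n,N)\<close> is the family of its coefficients in the basis \<open>b(\<gamma>)\<close>.\<close>

type_synonym brauer = "diagram \<Rightarrow> complex"

definition brauer_algebra :: "nat \<Rightarrow> brauer set" where
  "brauer_algebra n = {x. \<forall>\<gamma>. \<gamma> \<notin> diagrams n \<longrightarrow> x \<gamma> = 0}"

definition brauer_basis :: "diagram \<Rightarrow> brauer" where
  "brauer_basis \<gamma> = (\<lambda>\<delta>. if \<delta> = \<gamma> then 1 else 0)"

definition brauer_mult :: "nat \<Rightarrow> nat \<Rightarrow> brauer \<Rightarrow> brauer \<Rightarrow> brauer" where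
  "brauer_mult n N x y = (\<Sum>\<gamma>\<in>diagrams n. \<Sum>\<gamma>'\<in>diagrams n.
     (x \<gamma> * y \<gamma>' * of_nat N ^ card (loops n \<gamma> \<gamma>')) *\<^sub>C brauer_basis (diagram_comp n \<gamma> \<gamma>'))"

definition perm_diagram :: "nat \<Rightarrow> (nat \<Rightarrow> nat) \<Rightarrow> diagram" where
  "perm_diagram n s = (\<lambda>m. {Pt (s m), Bar m}) ` {1..n}"

definition bar_diagram :: "nat \<Rightarrow> nat \<Rightarrow> nat \<Rightarrow> diagram" where
  "bar_diagram n k l =
     {{Pt k, Pt l}, {Bar k, Bar l}} \<union> (\<lambda>m. {Pt m, Bar m}) ` ({1..n} - {k, l})"

definition sbar :: "nat \<Rightarrow> nat \<Rightarrow> brauer" where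
  "sbar n k = brauer_basis (bar_diagram n k (k + 1))"

text \<open>
  The representation of \<open>B(n,N)\<close> on tensors: the matrix entry of \<open>b(\<gamma>)\<close> at the output index \<open>i\<close> and
  the input index \<open>j\<close> is 1 if labelling the vertices \<open>m\<close> by \<open>i m\<close> and the barred ones by \<open>j m\<close> makes
  every edge of \<open>\<gamma>\<close> monochromatic, and 0 otherwise. The lemmas \<open>brauer_op_perm\<close> and
  \<open>brauer_op_bar\<close> give the values on the generators, and \<open>diagram_op_comp\<close> shows the compatibility
  with the product.
\<close>

definition label :: "(nat \<Rightarrow> 'N) \<Rightarrow> (nat \<Rightarrow> 'N) \<Rightarrow> vertex \<Rightarrow> 'N" where
  "label i j x = (case x of Pt m \<Rightarrow> i m | Bar m \<Rightarrow> j m)"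

definition compatible :: "diagram \<Rightarrow> (nat \<Rightarrow> 'N) \<Rightarrow> (nat \<Rightarrow> 'N) \<Rightarrow> bool" where
  "compatible \<gamma> i j \<longleftrightarrow> (\<forall>e\<in>\<gamma>. \<forall>x\<in>e. \<forall>y\<in>e. label i j x = label i j y)"

definition diagram_op :: "nat \<Rightarrow> diagram \<Rightarrow> 'N::finite tensor_op" where
  "diagram_op n \<gamma> = (\<lambda>t. if t \<in> tensors n then
       (\<lambda>i. if i \<in> indices n then \<Sum>j\<in>indices n. if compatible \<gamma> i j then t j else 0 else 0)
     else 0)"

definition brauer_op :: "nat \<Rightarrow> brauer \<Rightarrow> 'N::finite tensor_op" where
  "brauer_op n x = (\<Sum>\<gamma>\<in>diagrams n. x \<gamma> *\<^sub>C diagram_op n \<gamma>)"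

lemma finite_indices [simp]: "finite (indices n :: (nat \<Rightarrow> 'N::finite) set)"
  unfolding indices_def by (rule finite_PiE) auto

lemma finite_diagrams [simp]: "finite (diagrams n)"
proof (rule finite_subset)
  show "diagrams n \<subseteq> Pow (Pow (vertices n))"
    by (auto simp: diagrams_def partition_on_def)
  show "finite (Pow (Pow (vertices n)))"
    by (simp add: vertices_def)
qed

lemma brauer_op_basis:
  assumes "\<gamma> \<in> diagrams n"
  shows "brauer_op n (brauer_basis \<gamma>) = diagram_op n \<gamma>"
proof -
  have "brauer_op n (brauer_basis \<gamma>) = (\<Sum>\<delta>\<in>diagrams n. if \<gamma> = \<delta> then diagram_op n \<delta> else 0)"
    unfolding brauer_op_def brauer_basis_def
    by (rule sum.cong) (auto simp: cvec.scale_one cvec.scale_zero_left)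
  then show ?thesis using assms by simp
qed

lemma perm_diagram_in_diagrams:
  assumes "s permutes {1..n}"
  shows "perm_diagram n s \<in> diagrams n"
proof -
  have "disjoint (perm_diagram n s)"
    using permutes_inj[OF assms] by (auto simp: disjoint_def perm_diagram_def inj_def)
  moreover have "\<Union> (perm_diagram n s) = Pt ` (s ` {1..n}) \<union> Bar ` {1..n}"
    by (auto simp: perm_diagram_def)
  ultimately show ?thesis
    unfolding permutes_image[OF assms]
    by (auto simp: diagrams_def partition_on_def vertices_def perm_diagram_def)
qed

lemma bar_diagram_in_diagrams:
  assumes "k \<in> {1..n}" "l \<in> {1..n}" "k \<noteq> l"
  shows "bar_diagram n k l \<in> diagrams n"
  using assms
  by (auto simp: diagrams_def partition_on_def vertices_def bar_diagram_def disjoint_def)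

lemma brauer_op_perm:
  assumes s: "s permutes {1..n}" and t: "t \<in> tensors n" and i: "i \<in> indices n"
  shows "brauer_op n (brauer_basis (perm_diagram n s)) t i = t (i \<circ> s)"
proof -
  have ind: "i \<circ> s \<in> indices n"
    using i permutes_not_in[OF s] permutes_in_image[OF s]
    by (auto simp: indices_def PiE_iff extensional_def)
  have eq: "compatible (perm_diagram n s) i j \<longleftrightarrow> i \<circ> s = j" if j: "j \<in> indices n" for j
  proof -
    have "compatible (perm_diagram n s) i j \<longleftrightarrow> (\<forall>m\<in>{1..n}. (i \<circ> s) m = j m)"
      by (auto simp: compatible_def perm_diagram_def label_def)
    also have "\<dots> \<longleftrightarrow> i \<circ> s = j"
      using ind j unfolding indices_def by (metis PiE_ext)
    finally show ?thesis .
  qed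
  have "brauer_op n (brauer_basis (perm_diagram n s)) t i
      = (\<Sum>j\<in>indices n. if compatible (perm_diagram n s) i j then t j else 0)"
    using t i by (simp add: brauer_op_basis[OF perm_diagram_in_diagrams[OF s]] diagram_op_def)
  also have "\<dots> = (\<Sum>j\<in>indices n. if i \<circ> s = j then t j else 0)"
    by (intro sum.cong) (simp_all add: eq)
  finally show ?thesis using ind by simp
qed

lemma brauer_op_bar:
  fixes j :: "nat \<Rightarrow> 'N::finite"
  assumes kl: "k \<in> {1..n}" "l \<in> {1..n}" "k \<noteq> l" and j: "j \<in> indices n"
  shows "brauer_op n (brauer_basis (bar_diagram n k l)) (basis_tensor j)
       = (if j k = j l then \<Sum>a\<in>UNIV. basis_tensor (j(k := a, l := a)) else 0)"
proof -
  have t: "basis_tensor j \<in> tensors n"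
    using j by (auto simp: basis_tensor_def tensors_def)
  have upd: "j(k := a, l := a) \<in> indices n" for a
    using j kl by (auto simp: indices_def PiE_iff extensional_def)
  have comp: "compatible (bar_diagram n k l) i j \<longleftrightarrow> j k = j l \<and> i = j(k := i k, l := i k)"
    if i: "i \<in> indices n" for i
  proof -
    have "compatible (bar_diagram n k l) i j \<longleftrightarrow>
        i k = i l \<and> j k = j l \<and> (\<forall>m\<in>{1..n}-{k,l}. i m = j m)"
      by (auto simp: compatible_def bar_diagram_def label_def)
    also have "\<dots> \<longleftrightarrow> j k = j l \<and> (\<forall>m\<in>{1..n}. i m = (j(k := i k, l := i k)) m)"
      using kl by auto
    also have "(\<forall>m\<in>{1..n}. i m = (j(k := i k, l := i k)) m) \<longleftrightarrow> i = j(k := i k, l := i k)"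
      (is "?l \<longleftrightarrow> ?r")
    proof
      assume ?l
      then show ?r
        using i upd[of "i k"] unfolding indices_def by (intro PiE_ext[of i "{1..n}" "\<lambda>_. UNIV"]) auto
    next
      assume r: ?r
      show ?l by (intro ballI fun_cong[OF r])
    qed
    finally show ?thesis .
  qed
  have lhs: "brauer_op n (brauer_basis (bar_diagram n k l)) (basis_tensor j) i
      = (if i \<in> indices n \<and> compatible (bar_diagram n k l) i j then 1 else 0)" for i
  proof (cases "i \<in> indices n")
    case True
    have "brauer_op n (brauer_basis (bar_diagram n k l)) (basis_tensor j) i
        = (\<Sum>h\<in>indices n. if compatible (bar_diagram n k l) i h then basis_tensor j h else 0)"
      using t True by (simp add: brauer_op_basis[OF bar_diagram_in_diagrams[OF kl]] diagram_op_def)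
    also have "\<dots> = (\<Sum>h\<in>indices n. if h = j then if compatible (bar_diagram n k l) i j then 1 else 0 else 0)"
      by (intro sum.cong) (auto simp: basis_tensor_def)
    finally show ?thesis using True j by simp
  qed (use t in \<open>simp add: brauer_op_basis[OF bar_diagram_in_diagrams[OF kl]] diagram_op_def\<close>)
  have rhs: "(\<Sum>a\<in>UNIV. basis_tensor (j(k := a, l := a))) i
      = (if i = j(k := i k, l := i k) then 1 else 0)" for i
  proof -
    have sum_app: "(\<Sum>a\<in>A. f a) i = (\<Sum>a\<in>A. f a i)" for A :: "'N set" and f :: "'N \<Rightarrow> 'N tensor"
      by (induction A rule: infinite_finite_induct) auto
    have "(\<Sum>a\<in>UNIV. basis_tensor (j(k := a, l := a))) i
        = (\<Sum>a\<in>UNIV. if a = i k then if i = j(k := i k, l := i k) then 1 else 0 else 0)"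
      unfolding sum_app
      by (rule sum.cong) (auto simp: basis_tensor_def fun_upd_def)
    then show ?thesis by simp
  qed
  show ?thesis
  proof
    fix i
    show "brauer_op n (brauer_basis (bar_diagram n k l)) (basis_tensor j) i
       = (if j k = j l then \<Sum>a\<in>UNIV. basis_tensor (j(k := a, l := a)) else 0) i"
    proof (cases "j k = j l")
      case True
      have "i \<in> indices n" if "i = j(k := i k, l := i k)" using upd[of "i k"] that by simp
      then show ?thesis using True comp[of i] unfolding lhs by (auto simp: rhs)
    next
      case False
      then show ?thesis using comp[of i] unfolding lhs by auto
    qed
  qed
qed

lemma card_compatible:
  fixes i h :: "nat \<Rightarrow> 'N::finite"
  assumes g: "\<gamma> \<in> diagrams n" and g': "\<gamma>' \<in> diagrams n"
  shows "card {j \<in> indices n. compatible \<gamma> i j \<and> compatible \<gamma>' j h}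
       = (if compatible (diagram_comp n \<gamma> \<gamma>') i h then CARD('N) ^ card (loops n \<gamma> \<gamma>') else 0)"
    (is "card ?J = _")
proof -
  define R where "R = (stacked_adj \<gamma> \<gamma>')\<^sup>*"
  define A where "A = {0, 1, 2::nat} \<times> {1..n}"
  define L where "L j x = (if fst x = 0 then i (snd x) else if fst x = 1 then j (snd x) else h (snd x))"
    for j :: "nat \<Rightarrow> 'N" and x :: "nat \<times> nat"
  have up: "label i j x = L j (upper x)" and lo: "label j h x = L j (lower x)"
    and ou: "label i h x = L j (outer x)" for j x
    by (auto simp: label_def L_def upper_def lower_def outer_def split: vertex.splits)
  have compat: "compatible \<gamma> i j \<and> compatible \<gamma>' j h \<longleftrightarrow> (\<forall>(x, y) \<in> R. L j x = L j y)" for j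
  proof -
    have "compatible \<gamma> i j \<and> compatible \<gamma>' j h \<longleftrightarrow> (\<forall>(x, y) \<in> stacked_adj \<gamma> \<gamma>'. L j x = L j y)"
      unfolding compatible_def up[of j] lo[of j] stacked_adj_def by blast
    also have "\<dots> \<longleftrightarrow> (\<forall>(x, y) \<in> R. L j x = L j y)"
    proof
      assume a: "\<forall>(x, y) \<in> stacked_adj \<gamma> \<gamma>'. L j x = L j y"
      have "L j x = L j y" if "(x, y) \<in> R" for x y
        using that unfolding R_def by (induction rule: rtrancl_induct) (use a in auto)
      then show "\<forall>(x, y) \<in> R. L j x = L j y" by auto
    qed (auto simp: R_def)
    finally show ?thesis .
  qed
  have sym: "sym R"
    unfolding R_def
  proof (rule sym_rtrancl, rule symI)
    fix x y assume "(x, y) \<in> stacked_adj \<gamma> \<gamma>'"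
    then show "(y, x) \<in> stacked_adj \<gamma> \<gamma>'"
      unfolding stacked_adj_def mem_Collect_eq prod.case by (elim bexE conjE) (intro bexI conjI)
  qed
  have symD: "(y, x) \<in> R" if "(x, y) \<in> R" for x y using sym that by (auto dest: symD)
  have refl: "(x, x) \<in> R" for x by (simp add: R_def)
  have trans: "(x, z) \<in> R" if "(x, y) \<in> R" "(y, z) \<in> R" for x y z
    using that unfolding R_def by (rule rtrancl_trans)
  have cls: "R `` {x} = R `` {y}" if "(x, y) \<in> R" for x y
    using that symD trans by blast
  have sub: "upper ` e \<subseteq> A" if "e \<in> \<gamma>" for e
  proof -
    have "e \<subseteq> vertices n"
      using g that unfolding diagrams_def partition_on_def by auto
    then have "upper ` e \<subseteq> upper ` vertices n" by (rule image_mono)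
    also have "\<dots> \<subseteq> A" by (auto simp: upper_def vertices_def A_def)
    finally show ?thesis .
  qed
  have sub': "lower ` e \<subseteq> A" if "e \<in> \<gamma>'" for e
  proof -
    have "e \<subseteq> vertices n"
      using g' that unfolding diagrams_def partition_on_def by auto
    then have "lower ` e \<subseteq> lower ` vertices n" by (rule image_mono)
    also have "\<dots> \<subseteq> A" by (auto simp: lower_def vertices_def A_def)
    finally show ?thesis .
  qed
  have adj_A: "x \<in> A" "y \<in> A" if "(x, y) \<in> stacked_adj \<gamma> \<gamma>'" for x y
  proof -
    from that obtain e where e: "e \<in> (`) upper ` \<gamma> \<union> (`) lower ` \<gamma>'" and xy: "x \<in> e" "y \<in> e"
      unfolding stacked_adj_def by auto
    from e have "e \<subseteq> A"
    proof (elim UnE imageE)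
      show "e \<subseteq> A" if "e = upper ` d" "d \<in> \<gamma>" for d using sub[OF that(2)] that(1) by simp
      show "e \<subseteq> A" if "e = lower ` d" "d \<in> \<gamma>'" for d using sub'[OF that(2)] that(1) by simp
    qed
    then show "x \<in> A" "y \<in> A" using xy by auto
  qed
  have RA: "y \<in> A" if "(x, y) \<in> R" "x \<in> A" for x y
    using that unfolding R_def by (induction rule: rtrancl_induct) (auto intro: adj_A)
  have comps: "components n \<gamma> \<gamma>' = (\<lambda>x. R `` {x}) ` A"
    by (auto simp: components_def R_def A_def quotient_def)
  have loops: "loops n \<gamma> \<gamma>' = {C \<in> components n \<gamma> \<gamma>'. \<forall>x\<in>C. fst x = 1}"
  proof -
    have "C \<subseteq> {1} \<times> {1..n} \<longleftrightarrow> (\<forall>x\<in>C. fst x = 1)" if "C \<in> components n \<gamma> \<gamma>'" for C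
    proof -
      have "C \<subseteq> A" using that RA by (auto simp: comps)
      then show ?thesis by (auto simp: A_def)
    qed
    then show ?thesis by (auto simp: loops_def)
  qed
  have fin: "finite (loops n \<gamma> \<gamma>')"
    by (simp add: loops comps A_def)
  have outer_A: "outer x \<in> A \<and> fst (outer x) \<noteq> 1" if "x \<in> vertices n" for x
    using that by (auto simp: vertices_def outer_def A_def)
  have A_outer: "\<exists>y\<in>vertices n. x = outer y" if "x \<in> A" "fst x \<noteq> 1" for x
  proof -
    from that consider m where "x = (0, m)" "m \<in> {1..n}" | m where "x = (2, m)" "m \<in> {1..n}"
      by (auto simp: A_def)
    then show ?thesis
    proof cases
      case 1
      then show ?thesis by (intro bexI[of _ "Pt m"]) (auto simp: outer_def vertices_def)
    next
      case 2
      then show ?thesis by (intro bexI[of _ "Bar m"]) (auto simp: outer_def vertices_def)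
    qed
  qed
  have comp_outer: "compatible (diagram_comp n \<gamma> \<gamma>') i h \<longleftrightarrow>
      (\<forall>x\<in>A. \<forall>y\<in>A. fst x \<noteq> 1 \<and> fst y \<noteq> 1 \<and> (x, y) \<in> R \<longrightarrow> L j x = L j y)" (is "?l = ?r") for j
  proof
    assume c: ?l
    show ?r
    proof (intro ballI impI)
      fix x y assume xy: "x \<in> A" "y \<in> A" "fst x \<noteq> 1 \<and> fst y \<noteq> 1 \<and> (x, y) \<in> R"
      obtain x' y' where x': "x' \<in> vertices n" "x = outer x'" and y': "y' \<in> vertices n" "y = outer y'"
        using A_outer xy by metis
      have "R `` {x} \<in> components n \<gamma> \<gamma>' - loops n \<gamma> \<gamma>'"
        using xy refl[of x] by (auto simp: comps loops)
      then have d: "{z \<in> vertices n. outer z \<in> R `` {x}} \<in> diagram_comp n \<gamma> \<gamma>'"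
        unfolding diagram_comp_def by (rule imageI)
      have d': "x' \<in> {z \<in> vertices n. outer z \<in> R `` {x}}" "y' \<in> {z \<in> vertices n. outer z \<in> R `` {x}}"
        using x' y' xy refl[of x] by auto
      have "label i h x' = label i h y'"
        by (rule c[unfolded compatible_def, rule_format, OF d d'])
      then show "L j x = L j y" unfolding x'(2) y'(2) by (simp only: ou[of _ j])
    qed
  next
    assume r: ?r
    show ?l
      unfolding compatible_def
    proof (intro ballI)
      fix e x y assume e: "e \<in> diagram_comp n \<gamma> \<gamma>'" and xy: "x \<in> e" "y \<in> e"
      then obtain z where z: "x \<in> vertices n" "y \<in> vertices n" "(z, outer x) \<in> R" "(z, outer y) \<in> R"
        by (auto simp: diagram_comp_def comps)
      have "(outer x, outer y) \<in> R" by (rule trans[OF symD[OF z(3)] z(4)])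
      then show "label i h x = label i h y"
        using r outer_A[OF z(1)] outer_A[OF z(2)] unfolding ou[of _ j] by simp
    qed
  qed
  show ?thesis
  proof (cases "compatible (diagram_comp n \<gamma> \<gamma>') i h")
    case False
    have "?J = {}"
    proof (rule equals0I)
      fix j assume "j \<in> ?J"
      then have "\<forall>(x, y) \<in> R. L j x = L j y" using compat[of j] by simp
      then show False using False comp_outer[of j] by auto
    qed
    then show ?thesis using False by (simp only: card.empty if_False)
  next
    case True
    let ?K = "loops n \<gamma> \<gamma>' \<rightarrow>\<^sub>E (UNIV :: 'N set)"
    define \<Phi> where "\<Phi> j = restrict (\<lambda>C. L j (SOME z. z \<in> C)) (loops n \<gamma> \<gamma>')" for j
    have ne: "(SOME z. z \<in> C) \<in> C" if "C \<in> components n \<gamma> \<gamma>'" for C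
    proof -
      have "\<exists>z. z \<in> C" using that refl by (auto simp: comps)
      then show ?thesis by (rule someI_ex)
    qed
    have "bij_betw \<Phi> ?J ?K"
      unfolding bij_betw_def
    proof
      show "inj_on \<Phi> ?J"
      proof
        fix j j' assume j: "j \<in> ?J" and j': "j' \<in> ?J" and eq: "\<Phi> j = \<Phi> j'"
        have cj: "L j x = L j y" "L j' x = L j' y" if "(x, y) \<in> R" for x y
          using j j' compat that by auto
        have "j m = j' m" if m: "m \<in> {1..n}" for m
        proof -
          let ?C = "R `` {(1, m)}"
          have C: "?C \<in> components n \<gamma> \<gamma>'" using m by (auto simp: comps A_def)
          have "\<exists>z\<in>?C. L j z = L j' z"
          proof (cases "?C \<in> loops n \<gamma> \<gamma>'")
            case True
            then show ?thesis using ne[OF C] fun_cong[OF eq, of ?C] by (auto simp: \<Phi>_def)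
          next
            case False
            then obtain z where "z \<in> ?C" "fst z \<noteq> 1" using C by (auto simp: loops)
            then show ?thesis by (intro bexI[of _ z]) (auto simp: L_def)
          qed
          then have "L j (1, m) = L j' (1, m)" using cj by force
          then show ?thesis by (simp add: L_def)
        qed
        moreover have "j \<in> {1..n} \<rightarrow>\<^sub>E UNIV" "j' \<in> {1..n} \<rightarrow>\<^sub>E UNIV"
          using j j' by (simp_all add: indices_def)
        ultimately show "j = j'" by (metis PiE_ext)
      qed
      show "\<Phi> ` ?J = ?K"
      proof
        show "\<Phi> ` ?J \<subseteq> ?K" by (auto simp: \<Phi>_def)
        show "?K \<subseteq> \<Phi> ` ?J"
        proof
          fix c assume c: "c \<in> ?K"
          define rep where "rep C = (SOME z. z \<in> C \<and> fst z \<noteq> 1)" for C :: "(nat \<times> nat) set"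
          define F where "F x = (let C = R `` {x} in
              if C \<in> loops n \<gamma> \<gamma>' then c C else L undefined (rep C))" for x
          define j where "j = restrict (\<lambda>m. F (1, m)) {1..n}"
          have rep: "rep C \<in> C \<and> fst (rep C) \<noteq> 1" if "C \<in> components n \<gamma> \<gamma>' - loops n \<gamma> \<gamma>'" for C
          proof -
            have "\<exists>z. z \<in> C \<and> fst z \<noteq> 1" using that by (auto simp: loops)
            then show ?thesis unfolding rep_def by (rule someI_ex)
          qed
          have LF: "L j x = F x" if x: "x \<in> A" for x
          proof (cases "fst x = 1")
            case True
            then show ?thesis using x by (cases x) (auto simp: L_def j_def A_def)
          next
            case False
            have C: "R `` {x} \<in> components n \<gamma> \<gamma>' - loops n \<gamma> \<gamma>'"
              using x False refl[of x] by (auto simp: comps loops)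
            have "L undefined x = L undefined (rep (R `` {x}))"
            proof -
              have "(x, rep (R `` {x})) \<in> R" "fst (rep (R `` {x})) \<noteq> 1" using rep[OF C] by auto
              with comp_outer[of undefined] True False x RA show ?thesis by simp
            qed
            moreover have "F x = L undefined (rep (R `` {x}))"
              using C by (simp add: F_def Let_def)
            moreover have "L j x = L undefined x" using False by (simp add: L_def)
            ultimately show ?thesis by simp
          qed
          have Fconst: "F x = F y" if "(x, y) \<in> R" for x y
            unfolding F_def cls[OF that] ..
          have "L j x = L j y" if xy: "(x, y) \<in> R" for x y
          proof (cases "x \<in> A")
            case True
            then show ?thesis using LF RA[OF xy] Fconst[OF xy] by simp
          next
            case False
            have "x = y"
              using xy unfolding R_def
            proof (cases rule: converse_rtranclE)
              case (step z)
              then show ?thesis using False adj_A by blast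
            qed
            then show ?thesis by simp
          qed
          then have jJ: "j \<in> ?J" using compat by (auto simp: j_def indices_def)
          have "\<Phi> j C = c C" for C
          proof (cases "C \<in> loops n \<gamma> \<gamma>'")
            case True
            then have C: "C \<in> components n \<gamma> \<gamma>'" by (auto simp: loops)
            then obtain x where x: "x \<in> A" "C = R `` {x}" by (auto simp: comps)
            let ?z = "SOME z. z \<in> C"
            have z: "?z \<in> C" by (rule ne[OF C])
            then have zx: "(x, ?z) \<in> R" using x by simp
            have "L j ?z = F ?z" using LF[OF RA[OF zx x(1)]] .
            also have "\<dots> = c C"
            proof -
              have Rz: "R `` {?z} = C" by (rule HOL.sym[OF HOL.trans[OF x(2) cls[OF zx]]])
              show ?thesis unfolding F_def Rz Let_def using True by (rule if_P)
            qed
            finally show ?thesis using True by (simp add: \<Phi>_def)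
          next
            case False
            then show ?thesis using c by (simp add: \<Phi>_def PiE_iff extensional_def)
          qed
          then have "c = \<Phi> j" by auto
          then show "c \<in> \<Phi> ` ?J" using jJ by blast
        qed
      qed
    qed
    then have "card ?J = card ?K" by (rule bij_betw_same_card)
    also have "\<dots> = CARD('N) ^ card (loops n \<gamma> \<gamma>')" using fin by (simp add: card_PiE)
    finally show ?thesis using True by simp
  qed
qed

lemma diagram_op_comp:
  assumes g: "\<gamma> \<in> diagrams n" and g': "\<gamma>' \<in> diagrams n"
  shows "diagram_op n \<gamma> \<circ> (diagram_op n \<gamma>' :: 'N::finite tensor_op)
       = of_nat CARD('N) ^ card (loops n \<gamma> \<gamma>') *\<^sub>C diagram_op n (diagram_comp n \<gamma> \<gamma>')"
proof (intro ext)
  fix t :: "'N tensor" and i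
  let ?q = "of_nat CARD('N) ^ card (loops n \<gamma> \<gamma>') :: complex"
  have T: "diagram_op n \<delta> s \<in> tensors n" for \<delta> and s :: "'N tensor"
    by (auto simp: diagram_op_def tensors_def)
  show "(diagram_op n \<gamma> \<circ> diagram_op n \<gamma>') t i
      = (?q *\<^sub>C diagram_op n (diagram_comp n \<gamma> \<gamma>')) t i"
  proof (cases "t \<in> tensors n \<and> i \<in> indices n")
    case False
    have "(\<Sum>j\<in>indices n. if compatible \<delta> i j then (0 :: 'N tensor) j else 0) = 0" for \<delta>
      by (intro sum.neutral) simp
    with False show ?thesis
      by (cases "i \<in> indices n") (auto simp add: scaleC_fun_def scaleC_complex_def diagram_op_def)
  next
    case True
    have "(diagram_op n \<gamma> \<circ> diagram_op n \<gamma>') t i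
        = (\<Sum>j\<in>indices n. if compatible \<gamma> i j then diagram_op n \<gamma>' t j else 0)"
      using True T[of \<gamma>' t] by (simp add: diagram_op_def[of n \<gamma>])
    also have "\<dots> = (\<Sum>j\<in>indices n. \<Sum>h\<in>indices n. if compatible \<gamma> i j \<and> compatible \<gamma>' j h then t h else 0)"
      using True by (intro sum.cong) (auto simp: diagram_op_def)
    also have "\<dots> = (\<Sum>h\<in>indices n. \<Sum>j\<in>indices n. if compatible \<gamma> i j \<and> compatible \<gamma>' j h then t h else 0)"
      by (rule sum.swap)
    also have "\<dots> = (\<Sum>h\<in>indices n. of_nat (card {j \<in> indices n. compatible \<gamma> i j \<and> compatible \<gamma>' j h}) * t h)"
      by (simp add: sum.If_cases Int_def)
    also have "\<dots> = ?q * (\<Sum>h\<in>indices n. if compatible (diagram_comp n \<gamma> \<gamma>') i h then t h else 0)"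
      unfolding card_compatible[OF g g'] sum_distrib_left by (intro sum.cong) auto
    finally show ?thesis
      using True by (simp add: scaleC_fun_def scaleC_complex_def diagram_op_def)
  qed
qed

section \<open>Young diagrams and the modules \<open>U(\<lambda>,N)\<close>, \<open>V(\<lambda>,n)\<close>\<close>

text \<open>A box is a pair of its row and its column, both counted from 0.\<close>

type_synonym young = "(nat \<times> nat) set"

definition young_diagram :: "young \<Rightarrow> bool" where
  "young_diagram \<mu> \<longleftrightarrow>
     finite \<mu> \<and> (\<forall>r c. (r, c) \<in> \<mu> \<longrightarrow> (\<forall>r'\<le>r. \<forall>c'\<le>c. (r', c') \<in> \<mu>))"

definition young_set :: "nat \<Rightarrow> nat \<Rightarrow> young set" where
  "young_set n N =
     {\<mu>. young_diagram \<mu> \<and> card {b \<in> \<mu>. snd b < 2} \<le> N \<and> (\<exists>r \<le> n div 2. card \<mu> = n - 2 * r)}"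

definition differ_by_box :: "young \<Rightarrow> young \<Rightarrow> bool" where
  "differ_by_box \<mu> \<nu> \<longleftrightarrow> (\<exists>b. b \<notin> \<mu> \<and> \<nu> = insert b \<mu>) \<or> (\<exists>b. b \<notin> \<nu> \<and> \<mu> = insert b \<nu>)"

text \<open>
  The Specht module. With \<open>m\<close> boxes, a tableau is given by the bijection \<open>T\<close> sending each entry in
  \<open>{1..m}\<close> to its box, and its tabloid by the map sending each entry to its row (and 0 outside
  \<open>{1..m}\<close>). The permutation \<open>p\<close> maps the tabloid \<open>r\<close> to \<open>r \<circ> p\<^sup>-\<^sup>1\<close>; on linear combinations of tabloids,
  regarded as functions of the tabloid, this is precomposition with \<open>r \<mapsto> r \<circ> p\<close>.
  As the column group is closed under inverses, inverses are omitted in \<^term>\<open>polytabloid\<close>.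
\<close>

definition column_group :: "nat \<Rightarrow> (nat \<Rightarrow> nat \<times> nat) \<Rightarrow> (nat \<Rightarrow> nat) set" where
  "column_group m T = {q. q permutes {1..m} \<and> (\<forall>x\<in>{1..m}. snd (T (q x)) = snd (T x))}"

definition tabloid :: "nat \<Rightarrow> (nat \<Rightarrow> nat \<times> nat) \<Rightarrow> nat \<Rightarrow> nat" where
  "tabloid m T = (\<lambda>x. if x \<in> {1..m} then fst (T x) else 0)"

definition polytabloid :: "nat \<Rightarrow> (nat \<Rightarrow> nat \<times> nat) \<Rightarrow> (nat \<Rightarrow> nat) \<Rightarrow> complex" where
  "polytabloid m T =
     (\<lambda>r. \<Sum>q\<in>column_group m T. if r = tabloid m (T \<circ> q) then of_int (sign q) else 0)"

definition specht :: "young \<Rightarrow> ((nat \<Rightarrow> nat) \<Rightarrow> complex) set" where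
  "specht \<mu> = cvec.span (polytabloid (card \<mu>) ` {T. bij_betw T {1..card \<mu>} \<mu>})"

definition tabloid_op ::
  "(nat \<Rightarrow> nat) \<Rightarrow> ((nat \<Rightarrow> nat) \<Rightarrow> complex) \<Rightarrow> (nat \<Rightarrow> nat) \<Rightarrow> complex" where
  "tabloid_op p f = (\<lambda>r. f (r \<circ> p))"

definition traceless :: "nat \<Rightarrow> 'N::finite tensor set" where
  "traceless m = {t \<in> tensors m. \<forall>k\<in>{1..m}. \<forall>l\<in>{1..m}. k \<noteq> l \<longrightarrow>
     brauer_op m (brauer_basis (bar_diagram m k l)) t = 0}"

text \<open>
  \<open>U(\<mu>,N)\<close> is the multiplicity space of \<open>S\<^sup>\<mu>\<close> in the traceless tensors, and \<^term>\<open>tensor_mult_space\<close>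
  is the multiplicity space of \<open>U(\<mu>,N)\<close> in the \<open>n\<close>-th tensor power of \<open>U\<close>, both with the action by
  composition on the left.
\<close>

definition weyl_module ::
  "young \<Rightarrow> (((nat \<Rightarrow> nat) \<Rightarrow> complex) \<Rightarrow> 'N::finite tensor) set" where
  "weyl_module \<mu> = hom_space {p. p permutes {1..card \<mu>}} (specht \<mu>) tabloid_op
     (traceless (card \<mu>)) (\<lambda>p. brauer_op (card \<mu>) (brauer_basis (perm_diagram (card \<mu>) p)))"

definition weyl_op ::
  "nat \<Rightarrow> complex ^ 'N ^ 'N::finite \<Rightarrow>
     (((nat \<Rightarrow> nat) \<Rightarrow> complex) \<Rightarrow> 'N tensor) \<Rightarrow> ((nat \<Rightarrow> nat) \<Rightarrow> complex) \<Rightarrow> 'N tensor" where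
  "weyl_op m g \<phi> = group_op m g \<circ> \<phi>"

definition tensor_mult_space ::
  "nat \<Rightarrow> young \<Rightarrow> ((((nat \<Rightarrow> nat) \<Rightarrow> complex) \<Rightarrow> 'N::finite tensor) \<Rightarrow> 'N tensor) set" where
  "tensor_mult_space n \<mu> = hom_space orthogonal_group (weyl_module \<mu>) (weyl_op (card \<mu>))
     (tensors n) (group_op n)"

text \<open>The \<open>C(n,N)\<close>-module \<open>V\<close> is (a copy of) \<open>V(\<mu>,n)\<close>.\<close>

definition brauer_simple ::
  "nat \<Rightarrow> young \<Rightarrow> 'v::complex_vector set \<Rightarrow> ('N::finite tensor_op \<Rightarrow> 'v \<Rightarrow> 'v) \<Rightarrow> bool" where
  "brauer_simple n \<mu> V act \<longleftrightarrow>
     centralizer_module n V act \<and> irreducible_module (centralizer n) V act \<and>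
     isomorphic_modules (centralizer n) V act (tensor_mult_space n \<mu>) (\<lambda>F \<phi>. F \<circ> \<phi>)"

section \<open>The canonical basis\<close>

text \<open>
  \<open>\<Lambda>\<close> is the list of \<open>\<Lambda>(0), \<dots>, \<Lambda>(n)\<close> where \<open>\<Lambda>(0)\<close> is empty, so that \<open>\<Lambda>(k)\<close> is \<open>\<Lambda> ! k\<close>.
\<close>

definition paths :: "nat \<Rightarrow> young \<Rightarrow> nat \<Rightarrow> young list set" where
  "paths N \<mu> n = {\<Lambda>. length \<Lambda> = n + 1 \<and> \<Lambda> ! 0 = {} \<and> \<Lambda> ! n = \<mu> \<and>
     (\<forall>k\<in>{1..n}. \<Lambda> ! k \<in> young_set k N) \<and> (\<forall>k<n. differ_by_box (\<Lambda> ! k) (\<Lambda> ! (k + 1)))}"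

text \<open>
  The component \<open>V(\<mu>,k)\<close> of the restriction of the \<open>C(n,N)\<close>-module \<open>V\<close> to \<open>C(k,N)\<close> is the sum of all
  submodules isomorphic to \<open>V(\<mu>,k)\<close>; for \<open>k < n - 1\<close> there may be more than one of these.
\<close>

definition component ::
  "nat \<Rightarrow> nat \<Rightarrow> young \<Rightarrow> 'v::complex_vector set \<Rightarrow> ('N::finite tensor_op \<Rightarrow> 'v \<Rightarrow> 'v) \<Rightarrow> 'v set"
  where
  "component n k \<mu> V act =
     cvec.span (\<Union>{W. W \<subseteq> V \<and> brauer_simple k \<mu> W (\<lambda>F. act (embed_op k n F))})"

definition canonical_basis ::
  "nat \<Rightarrow> young \<Rightarrow> 'v::complex_vector set \<Rightarrow> ('N::finite tensor_op \<Rightarrow> 'v \<Rightarrow> 'v) \<Rightarrow>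
     (young list \<Rightarrow> 'v) \<Rightarrow> bool" where
  "canonical_basis n \<mu> V act v \<longleftrightarrow>
     inj_on v (paths CARD('N) \<mu> n) \<and>
     \<not> cvec.dependent (v ` paths CARD('N) \<mu> n) \<and>
     cvec.span (v ` paths CARD('N) \<mu> n) = V \<and>
     (\<forall>\<Lambda>\<in>paths CARD('N) \<mu> n. \<forall>k\<in>{1..n - 1}. v \<Lambda> \<in> component n k (\<Lambda> ! k) V act)"

definition path_subspace ::
  "nat \<Rightarrow> nat \<Rightarrow> young \<Rightarrow> (young list \<Rightarrow> 'v::complex_vector) \<Rightarrow> young list \<Rightarrow> nat \<Rightarrow> 'v set" where
  "path_subspace N n \<mu> v \<Lambda> k =
     cvec.span (v ` {\<Lambda>' \<in> paths N \<mu> n. \<forall>l\<le>n. l \<noteq> k \<longrightarrow> \<Lambda>' ! l = \<Lambda> ! l})"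

text \<open>
  The coefficient \<open>x(\<Lambda>,\<Lambda>')\<close> of \<open>v(\<Lambda>')\<close> in \<open>x \<cdot> v(\<Lambda>)\<close> for \<open>x\<close> in the Brauer algebra, which acts on \<open>V\<close>
  through \<open>C(n,N)\<close>.
\<close>

definition matrix_element ::
  "nat \<Rightarrow> young \<Rightarrow> ('N::finite tensor_op \<Rightarrow> 'v::complex_vector \<Rightarrow> 'v) \<Rightarrow> (young list \<Rightarrow> 'v) \<Rightarrow>
     brauer \<Rightarrow> young list \<Rightarrow> young list \<Rightarrow> complex" where
  "matrix_element n \<mu> act v x \<Lambda> \<Lambda>' =
     cvec.representation (v ` paths CARD('N) \<mu> n) (act (brauer_op n x) (v \<Lambda>)) (v \<Lambda>')"

end

theory Submission
  imports Defs "HOL-Computational_Algebra.Fundamental_Theorem_Algebra"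
begin

text \<open>
  Let \<open>e\<close> be the action of \<open>sbar n k\<close>. The orthogonal projection of the \<open>l\<close>-th tensor power onto
  the sum of the images of all equivariant maps from \<open>U(\<mu>,N)\<close> is central in \<open>C(l,N)\<close>; it acts as
  1 on \<open>V(\<mu>,l)\<close> and as 0 on \<open>V(\<nu>,l)\<close> for \<open>\<nu> \<noteq> \<mu>\<close>. For \<open>l \<noteq> k\<close> it commutes with \<open>e\<close>, so that
  \<open>e v(\<Lambda>)\<close> involves only paths that agree with \<open>\<Lambda>\<close> off \<open>k\<close>. For \<open>F\<close> in \<open>C(k,N)\<close> one has
  \<open>e F e = Z e\<close>, where \<open>Z\<close> in \<open>C(k-1,N)\<close> is the partial trace of \<open>F\<close> over the \<open>k\<close>-th factor. If
  \<open>F\<close> is the central projection belonging to \<open>\<Lambda>'(k)\<close>, then \<open>Z\<close> is central as well, hence a scalar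
  \<open>c\<close> on \<open>V(\<Lambda>(k-1),k-1)\<close>, and \<open>e F e v(M) = c e v(M)\<close> says that the coefficient of \<open>v(\<Lambda>')\<close> in
  \<open>e v(M)\<close> times \<open>e v(\<Lambda>')\<close> equals \<open>c e v(M)\<close>, both for \<open>M = \<Lambda>\<close> and for \<open>M = \<Lambda>'\<close>.

  That the projections separate the \<open>V(\<mu>,l)\<close> means that there is no nonzero invariant sesquilinear
  form on \<open>U(\<mu>,N) \<times> U(\<nu>,N)\<close>. This follows from a version of the first fundamental theorem for
  the orthogonal group, namely that an invariant tensor with vanishing full contractions is zero,
  and from the fact that Specht modules of different shapes admit no nonzero invariant pairing.
\<close>

section \<open>Invariant tensors of the orthogonal group\<close>

text \<open>The identity says that a 2 x 2 minor of the matrix of \<open>e\<close> vanishes.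
  Off-diagonal entries change with the scaling of \<open>v\<close>, and \<open>component\<close> is
  given only through isomorphism classes; what can be controlled are elements whose action depends
  on the isomorphism class of a simple module alone, the central elements of the subalgebras. They
  are built as Hermitian projections because the centralizer is closed under adjoints
  (\<open>centralizer_adjoint\<close>), so that the projection onto a subspace stable under it
  commutes with it. The price is that the images of two equivariant maps are paired sesquilinearly:
  such a pairing is invariant under real orthogonal matrices, which are unitary, but in general not
  under complex ones. Hence the invariant theory is that of the compact real group, where rotations
  can be differentiated along a real parameter and positivity of a norm closes the argument. This is
  also the origin of the mixed linear and conjugate-linear hypotheses on the forms on Specht
  modules.\<close>

lemma orthogonal_matrix_iff:
  fixes g :: "complex ^ 'N ^ 'N::finite"
  shows "orthogonal_matrix g \<longleftrightarrow>
    (\<forall>a b. (\<Sum>c\<in>UNIV. g $ c $ a * g $ c $ b) = (if a = b then 1 else 0)) \<and>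
    (\<forall>a b. (\<Sum>c\<in>UNIV. g $ a $ c * g $ b $ c) = (if a = b then 1 else 0))"
  by (simp add: orthogonal_matrix_def vec_eq_iff matrix_matrix_mult_def mat_def transpose_def)

text \<open>Only real matrices are tested, because the arrays to come are coordinates of Hermitian
  pairings. The slot set \<open>I\<close> is arbitrary, so that contracting two slots and joining
  the slots of two tensors stay within the notion.\<close>

definition invariant_array :: "'x set \<Rightarrow> (('x \<Rightarrow> 'N::finite) \<Rightarrow> complex) \<Rightarrow> bool" where
  "invariant_array I f \<longleftrightarrow>
     (\<forall>g :: complex ^ 'N ^ 'N. orthogonal_matrix g \<and> (\<forall>a b. g $ a $ b \<in> \<real>) \<longrightarrow>
       (\<forall>i \<in> I \<rightarrow>\<^sub>E UNIV. (\<Sum>j \<in> I \<rightarrow>\<^sub>E UNIV. (\<Prod>l\<in>I. g $ i l $ j l) * f j) = f i))"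

lemma prod_delta_eq:
  fixes i j :: "'x \<Rightarrow> 'N"
  assumes "finite I" "i \<in> I \<rightarrow>\<^sub>E UNIV" "j \<in> I \<rightarrow>\<^sub>E UNIV"
  shows "(\<Prod>l\<in>I. if i l = j l then 1 else 0) = (if j = i then 1 else (0 :: complex))"
proof (cases "j = i")
  case False
  then obtain l where "l \<in> I" "i l \<noteq> j l" using assms(2,3) by (metis PiE_ext)
  then show ?thesis using assms(1) False by (auto intro!: prod_zero)
qed simp

lemma finite_arrays [simp]: "finite I \<Longrightarrow> finite (I \<rightarrow>\<^sub>E (UNIV :: 'N::finite set))"
  by (rule finite_PiE) auto

lemma upd_PiE: "i \<in> I \<rightarrow>\<^sub>E UNIV \<Longrightarrow> l \<in> I \<Longrightarrow> i(l := b) \<in> I \<rightarrow>\<^sub>E UNIV"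
  by (auto simp: PiE_iff extensional_def)

text \<open>A matrix acts in slot \<open>l\<close> and the identity in all other slots; this is one
  summand of the product rule for a tensor power.\<close>

lemma sum_upd_delta:
  fixes X :: "'N::finite \<Rightarrow> 'N \<Rightarrow> complex"
  assumes fin: "finite I" and i: "i \<in> I \<rightarrow>\<^sub>E UNIV" and l: "l \<in> I"
  shows "(\<Sum>j \<in> I \<rightarrow>\<^sub>E UNIV. (X (i l) (j l) * (\<Prod>m\<in>I - {l}. if i m = j m then 1 else 0)) * f j)
       = (\<Sum>b\<in>UNIV. X (i l) b * f (i(l := b)))"
proof -
  have "(\<Sum>j \<in> I \<rightarrow>\<^sub>E UNIV. (X (i l) (j l) * (\<Prod>m\<in>I - {l}. if i m = j m then 1 else 0)) * f j)
      = (\<Sum>j \<in> (\<lambda>b. i(l := b)) ` UNIV. (X (i l) (j l) * (\<Prod>m\<in>I - {l}.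
          if i m = j m then 1 else 0)) * f j)"
  proof (rule sum.mono_neutral_right)
    show "finite (I \<rightarrow>\<^sub>E (UNIV :: 'N set))" using fin by simp
    show "(\<lambda>b. i(l := b)) ` UNIV \<subseteq> I \<rightarrow>\<^sub>E UNIV" using upd_PiE[OF i l] by auto
    show "\<forall>j\<in>(I \<rightarrow>\<^sub>E UNIV) - (\<lambda>b. i(l := b)) ` UNIV.
       (X (i l) (j l) * (\<Prod>m\<in>I - {l}. if i m = j m then 1 else 0)) * f j = 0"
    proof
      fix j assume j: "j \<in> (I \<rightarrow>\<^sub>E UNIV) - (\<lambda>b. i(l := b)) ` UNIV"
      have "\<exists>m\<in>I - {l}. i m \<noteq> j m"
      proof (rule ccontr)
        assume "\<not> ?thesis"
        then have "\<forall>m\<in>I. j m = (i(l := j l)) m" by auto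
        then have "j = i(l := j l)" using j upd_PiE[OF i l, of "j l"]
          by (metis DiffD1 PiE_ext)
        then show False using j by blast
      qed
      then show "(X (i l) (j l) * (\<Prod>m\<in>I - {l}. if i m = j m then 1 else 0)) * f j = 0"
        using fin by (auto intro!: prod_zero)
    qed
  qed
  also have "\<dots> = (\<Sum>b\<in>UNIV. X (i l) b * f (i(l := b)))"
    by (subst sum.reindex) (auto simp: inj_on_def fun_eq_iff split: if_splits intro!: sum.cong
        prod.neutral)
  finally show ?thesis .
qed

text \<open>The action on tensors, as a derivation, of the matrix unit with its entry 1 in row
  \<open>a\<close> and column \<open>b\<close>.\<close>

definition raise :: "'x set \<Rightarrow> 'N \<Rightarrow> 'N \<Rightarrow> (('x \<Rightarrow> 'N) \<Rightarrow> complex) \<Rightarrow> ('x \<Rightarrow> 'N) \<Rightarrow> complex" where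
  "raise I a b f i = (\<Sum>l\<in>I. if i l = a then f (i(l := b)) else 0)"

text \<open>The rotations in the coordinate plane of \<open>a\<close> and \<open>b\<close> form a
  curve through the identity. Invariance makes the action on \<open>f\<close> constant along it, so
  its derivative at 0 vanishes; this derivative is the action of the difference of the two opposite
  matrix units.\<close>

lemma invariant_array_raise:
  fixes f :: "('x \<Rightarrow> 'N::finite) \<Rightarrow> complex"
  assumes fin: "finite I" and inv: "invariant_array I f" and i: "i \<in> I \<rightarrow>\<^sub>E UNIV"
  shows "raise I a b f i = raise I b a f i"
proof (cases "a = b")
  case False
  define R :: "real \<Rightarrow> 'N \<Rightarrow> 'N \<Rightarrow> real" where
    "R t x y = (if x = a \<and> y = a \<or> x = b \<and> y = b then cos t
       else if x = a \<and> y = b then sin t else if x = b \<and> y = a then - sin t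
       else if x = y then 1 else 0)" for t x y
  define X :: "'N \<Rightarrow> 'N \<Rightarrow> complex" where
    "X x y = (if x = a \<and> y = b then 1 else if x = b \<and> y = a then - 1 else 0)" for x y
  define g :: "real \<Rightarrow> complex ^ 'N ^ 'N" where "g t = (\<chi> x y. of_real (R t x y))" for t
  \<comment> \<open>Orthogonality of \<open>R t\<close> is checked by splitting off the two rotated
    coordinates, where the sine and cosine identity enters; on the other coordinates at most one
    diagonal term survives.\<close>
  have two: "(\<Sum>c\<in>UNIV. F c) = F a + F b + (\<Sum>c\<in>UNIV - {a, b}. F c)" for F :: "'N \<Rightarrow> real"
    using False by (subst sum.subset_diff[of "{a, b}"]) auto
  have rest: "(\<Sum>c\<in>UNIV - {a, b}. F c) = (if x \<in> {a, b} then 0 else F x)"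
    if "\<And>c. c \<notin> {a, b} \<Longrightarrow> c \<noteq> x \<Longrightarrow> F c = 0" for F :: "'N \<Rightarrow> real" and x
  proof (cases "x \<in> {a, b}")
    case True
    then show ?thesis using that by (auto intro!: sum.neutral)
  next
    case nx: False
    then show ?thesis
      by (subst sum.mono_neutral_right[of _ "{x}"]) (use that in auto)
  qed
  have sc: "sin t * sin t + cos t * cos t = 1" "cos t * cos t + sin t * sin t = 1" for t :: real
    using sin_cos_squared_add3[of t] by (auto simp: add.commute)
  have Ra: "R t a x = (if x = a then cos t else if x = b then sin t else 0)"
    and Rb: "R t b x = (if x = a then - sin t else if x = b then cos t else 0)"
    and Ra': "R t x a = (if x = a then cos t else if x = b then - sin t else 0)"
    and Rb': "R t x b = (if x = a then sin t else if x = b then cos t else 0)" for t x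
    using False by (auto simp: R_def)
  have Rc: "R t x y = (if x = y then 1 else 0)" if "x \<notin> {a, b} \<or> y \<notin> {a, b}" for t x y
    using that by (elim disjE) (simp_all add: R_def)
  have o1: "(\<Sum>c\<in>UNIV. R t c x * R t c y) = (if x = y then 1 else 0)" for t x y
  proof -
    have "(\<Sum>c\<in>UNIV - {a, b}. R t c x * R t c y) = (if x \<in> {a, b} then 0 else R t x x * R t x y)"
      by (rule rest) (simp add: Rc)
    then have s: "?thesis
        \<longleftrightarrow> R t a x * R t a y + R t b x * R t b y + (if x \<in> {a, b} then 0 else R t x x * R t x y)
        = (if x = y then 1 else 0)"
      unfolding two by simp
    consider "x = a" | "x = b" | "x \<notin> {a, b}" by blast
    then show ?thesis
      unfolding s using False by cases (auto simp: Ra Rb Rc sc)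
  qed
  have o2: "(\<Sum>c\<in>UNIV. R t x c * R t y c) = (if x = y then 1 else 0)" for t x y
  proof -
    have "(\<Sum>c\<in>UNIV - {a, b}. R t x c * R t y c) = (if x \<in> {a, b} then 0 else R t x x * R t y x)"
      by (rule rest) (simp add: Rc)
    then have s: "?thesis
        \<longleftrightarrow> R t x a * R t y a + R t x b * R t y b + (if x \<in> {a, b} then 0 else R t x x * R t y x)
        = (if x = y then 1 else 0)"
      unfolding two by simp
    consider "x = a" | "x = b" | "x \<notin> {a, b}" by blast
    then show ?thesis
      unfolding s using False by cases (auto simp: Ra' Rb' Rc sc)
  qed
  have orth: "orthogonal_matrix (g t)" for t
    unfolding orthogonal_matrix_iff
    by (auto simp: g_def o1 o2 simp flip: of_real_mult of_real_sum)
  have const: "(\<Sum>j \<in> I \<rightarrow>\<^sub>E UNIV. (\<Prod>l\<in>I. of_real (R t (i l) (j l))) * f j) = f i" for t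
    using inv orth[of t] i unfolding invariant_array_def by (auto simp: g_def)
  have R0: "R 0 x y = (if x = y then 1 else 0)" for x y
  proof -
    consider "x = a" | "x = b" | "x \<notin> {a, b}" by blast
    then show ?thesis using False by cases (simp_all add: Ra Rb Rc)
  qed
  have dR: "((\<lambda>t. of_real (R t x y) :: complex) has_derivative (\<lambda>h. of_real h * X x y)) (at 0)"
      for x y
  proof -
    have "((\<lambda>t. R t x y) has_real_derivative Re (X x y)) (at 0)"
    proof -
      consider "x = a" "y = a" | "x = b" "y = b" | "x = a" "y = b" | "x = b" "y = a"
        | "x \<notin> {a, b} \<or> y \<notin> {a, b}" by blast
      then show ?thesis
      proof cases
        case 1
        then have "(\<lambda>t. R t x y) = cos" "Re (X x y) = - sin 0" using False by (auto simp: Ra X_def)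
        then show ?thesis using DERIV_cos[of "0::real"] by metis
      next
        case 2
        then have "(\<lambda>t. R t x y) = cos" "Re (X x y) = - sin 0" using False by (auto simp: Rb X_def)
        then show ?thesis using DERIV_cos[of "0::real"] by metis
      next
        case 3
        then have "(\<lambda>t. R t x y) = sin" "Re (X x y) = cos 0" using False by (auto simp: Ra X_def)
        then show ?thesis using DERIV_sin[of "0::real"] by metis
      next
        case 4
        then have "(\<lambda>t. R t x y) = (\<lambda>t. - sin t)" "Re (X x y) = - cos 0"
          using False by (auto simp: Rb X_def)
        then show ?thesis using DERIV_minus[OF DERIV_sin[of "0::real"]] by metis
      next
        case 5
        then have "(\<lambda>t. R t x y) = (\<lambda>t. if x = y then 1 else 0)" "Re (X x y) = 0"
          by (auto simp: Rc X_def)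
        then show ?thesis using DERIV_const by metis
      qed
    qed
    then have
        "((\<lambda>t. of_real (R t x y) :: complex) has_vector_derivative of_real (Re (X x y))) (at 0)"
      by (rule has_vector_derivative_of_real)
    moreover have "of_real (Re (X x y)) = X x y" by (simp add: X_def)
    ultimately show ?thesis by (simp add: has_vector_derivative_def scaleR_conv_of_real)
  qed
  have "((\<lambda>t. \<Sum>j \<in> I \<rightarrow>\<^sub>E UNIV. (\<Prod>l\<in>I. of_real (R t (i l) (j l))) * f j) has_derivative
      (\<lambda>h. \<Sum>j \<in> I \<rightarrow>\<^sub>E UNIV. (\<Sum>l\<in>I. of_real h * X (i l) (j l) *
          (\<Prod>m\<in>I - {l}. of_real (R 0 (i m) (j m)))) * f j)) (at 0)"
    by (intro has_derivative_sum has_derivative_mult_left has_derivative_prod dR)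
  moreover have "((\<lambda>t. \<Sum>j \<in> I \<rightarrow>\<^sub>E UNIV. (\<Prod>l\<in>I. of_real (R t (i l) (j l))) * f j)
      has_derivative (\<lambda>h. 0)) (at 0)"
    unfolding const by simp
  ultimately have "(\<lambda>h. \<Sum>j \<in> I \<rightarrow>\<^sub>E UNIV. (\<Sum>l\<in>I. of_real h * X (i l) (j l) *
          (\<Prod>m\<in>I - {l}. of_real (R 0 (i m) (j m)))) * f j) = (\<lambda>h::real. 0)"
    by (rule has_derivative_unique)
  \<comment> \<open>A derivative is a linear map of the increment \<open>h\<close>, and its value at
    1 is the tangent vector. At parameter 0 the factors that are not differentiated are Kronecker
    deltas.\<close>
  from fun_cong[OF this, of 1]
  have "0 = (\<Sum>j \<in> I \<rightarrow>\<^sub>E UNIV. \<Sum>l\<in>I. (X (i l) (j l) *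
          (\<Prod>m\<in>I - {l}. if i m = j m then 1 else 0)) * f j)"
    by (simp add: R0 sum_distrib_right if_distrib[of of_real] cong: if_cong)
  also have "\<dots> = (\<Sum>l\<in>I. \<Sum>j \<in> I \<rightarrow>\<^sub>E UNIV. (X (i l) (j l) *
          (\<Prod>m\<in>I - {l}. if i m = j m then 1 else 0)) * f j)"
    by (rule sum.swap)
  also have "\<dots> = (\<Sum>l\<in>I. \<Sum>c\<in>UNIV. X (i l) c * f (i(l := c)))"
    by (intro sum.cong refl sum_upd_delta fin i)
  also have "\<dots>
      = (\<Sum>l\<in>I. (if i l = a then f (i(l := b)) else 0) - (if i l = b then f (i(l := a)) else 0))"
  proof (intro sum.cong refl)
    fix l
    have "(\<Sum>c\<in>UNIV. X (i l) c * f (i(l := c)))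
        = (\<Sum>c\<in>UNIV. (if c = b then if i l = a then f (i(l := b)) else 0 else 0)
            - (if c = a then if i l = b then f (i(l := a)) else 0 else 0))"
      by (intro sum.cong refl) (use False in \<open>auto simp: X_def\<close>)
    then show "(\<Sum>c\<in>UNIV. X (i l) c * f (i(l := c)))
      = (if i l = a then f (i(l := b)) else 0) - (if i l = b then f (i(l := a)) else 0)"
      by (simp add: sum_subtractf)
  qed
  finally show ?thesis by (simp add: raise_def sum_subtractf)
qed simp

text \<open>The reflection in the coordinate \<open>a\<close> multiplies \<open>f i\<close> by -1
  once for each slot with value \<open>a\<close>. Rotations alone would not give this: the
  determinant tensor is invariant under them and has no nonzero full contraction.\<close>

lemma invariant_array_even:
  fixes f :: "('x \<Rightarrow> 'N::finite) \<Rightarrow> complex"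
  assumes fin: "finite I" and inv: "invariant_array I f" and i: "i \<in> I \<rightarrow>\<^sub>E UNIV" and "f i \<noteq> 0"
  shows "even (card {l \<in> I. i l = a})"
proof -
  define g :: "complex ^ 'N ^ 'N" where "g = (\<chi> x y. if x = y then if x = a then - 1 else 1 else 0)"
  have "orthogonal_matrix g"
    unfolding orthogonal_matrix_iff
  proof (intro conjI allI)
    fix x y
    have "(\<Sum>c\<in>UNIV. g $ c $ x * g $ c $ y) = (\<Sum>c\<in>UNIV. if c = x then if x = y then 1 else 0 else 0)"
      by (intro sum.cong) (auto simp: g_def)
    then show "(\<Sum>c\<in>UNIV. g $ c $ x * g $ c $ y) = (if x = y then 1 else 0)" by simp
    have "(\<Sum>c\<in>UNIV. g $ x $ c * g $ y $ c) = (\<Sum>c\<in>UNIV. if c = x then if x = y then 1 else 0 else 0)"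
      by (intro sum.cong) (auto simp: g_def)
    then show "(\<Sum>c\<in>UNIV. g $ x $ c * g $ y $ c) = (if x = y then 1 else 0)" by simp
  qed
  moreover have "\<forall>x y. g $ x $ y \<in> \<real>" by (simp add: g_def)
  ultimately have "f i = (\<Sum>j \<in> I \<rightarrow>\<^sub>E UNIV. (\<Prod>l\<in>I. g $ i l $ j l) * f j)"
    using inv i unfolding invariant_array_def by simp
  also have "\<dots> = (\<Sum>j \<in> I \<rightarrow>\<^sub>E UNIV. if j = i then (\<Prod>l\<in>I. if i l = a then - 1 else 1) * f i else 0)"
  proof (intro sum.cong refl)
    fix j assume j: "j \<in> I \<rightarrow>\<^sub>E (UNIV :: 'N set)"
    have "(\<Prod>l\<in>I. g $ i l $ j l)
        = (\<Prod>l\<in>I. (if i l = a then - 1 else 1) * (if i l = j l then 1 else 0))"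
      by (intro prod.cong) (auto simp: g_def)
    then show "(\<Prod>l\<in>I. g $ i l $ j l) * f j
        = (if j = i then (\<Prod>l\<in>I. if i l = a then - 1 else 1) * f i else 0)"
      using prod_delta_eq[OF fin i j] by (simp add: prod.distrib)
  qed
  also have "\<dots> = (- 1) ^ card {l \<in> I. i l = a} * f i"
    using i fin by (simp add: prod.If_cases Int_def)
  finally have "(- 1 :: complex) ^ card {l \<in> I. i l = a} = 1" using assms(4) by simp
  then show ?thesis by (metis neg_one_odd_power one_neq_neg_one)
qed

text \<open>Opposite matrix units are transposes of each other for the bilinear pairing. Overwriting
  slot \<open>l\<close> is a bijection between the indices with value \<open>a\<close> there and
  those with value \<open>b\<close>.\<close>

lemma raise_adjoint:
  fixes f h :: "('x \<Rightarrow> 'N::finite) \<Rightarrow> complex"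
  assumes "finite I"
  shows "(\<Sum>i\<in>I \<rightarrow>\<^sub>E UNIV. f i * raise I a b h i) = (\<Sum>i\<in>I \<rightarrow>\<^sub>E UNIV. raise I b a f i * h i)"
proof -
  have "(\<Sum>i\<in>I \<rightarrow>\<^sub>E UNIV. if i l = a then f i * h (i(l := b)) else 0)
      = (\<Sum>i\<in>I \<rightarrow>\<^sub>E UNIV. if i l = b then f (i(l := a)) * h i else 0)" if l: "l \<in> I" for l
  proof -
    have fin: "finite (I \<rightarrow>\<^sub>E (UNIV :: 'N set))" using assms by simp
    have "(\<Sum>i\<in>{i \<in> I \<rightarrow>\<^sub>E UNIV. i l = a}. f i * h (i(l := b)))
      = (\<Sum>i\<in>{i \<in> I \<rightarrow>\<^sub>E UNIV. i l = b}. f (i(l := a)) * h i)"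
      by (rule sum.reindex_bij_witness[where i = "\<lambda>i. i(l := a)" and j = "\<lambda>i. i(l := b)"])
        (auto simp: upd_PiE l)
    then show ?thesis by (simp only: sum.inter_filter[OF fin])
  qed
  then have "(\<Sum>l\<in>I. \<Sum>i\<in>I \<rightarrow>\<^sub>E UNIV. if i l = a then f i * h (i(l := b)) else 0)
      = (\<Sum>l\<in>I. \<Sum>i\<in>I \<rightarrow>\<^sub>E UNIV. if i l = b then f (i(l := a)) * h i else 0)"
    by (rule sum.cong[OF refl])
  then have "(\<Sum>i\<in>I \<rightarrow>\<^sub>E UNIV. \<Sum>l\<in>I. if i l = a then f i * h (i(l := b)) else 0)
      = (\<Sum>i\<in>I \<rightarrow>\<^sub>E UNIV. \<Sum>l\<in>I. if i l = b then f (i(l := a)) * h i else 0)"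
    by (simp only: sum.swap[of _ I "I \<rightarrow>\<^sub>E UNIV"])
  moreover have "f i * raise I a b h i = (\<Sum>l\<in>I. if i l = a then f i * h (i(l := b)) else 0)"
    and "raise I b a f i * h i = (\<Sum>l\<in>I. if i l = b then f (i(l := a)) * h i else 0)" for i
    unfolding raise_def sum_distrib_left sum_distrib_right by (auto intro!: sum.cong)
  ultimately show ?thesis by simp
qed


text \<open>An index with equal values at \<open>x\<close> and \<open>y\<close> amounts to this
  common value and an index on the other slots; resetting both slots to \<open>undefined\<close>
  keeps the latter extensional on the smaller set.\<close>

lemma sum_PiE_pair:
  fixes F :: "('x \<Rightarrow> 'N::finite) \<Rightarrow> complex"
  assumes xy: "x \<in> I" "y \<in> I" "x \<noteq> y"
  shows "(\<Sum>j\<in>{j \<in> I \<rightarrow>\<^sub>E UNIV. j x = j y}. F j)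
       = (\<Sum>j\<in>(I - {x, y}) \<rightarrow>\<^sub>E UNIV. \<Sum>c\<in>UNIV. F (j(x := c, y := c)))"
proof -
  have "(\<Sum>j\<in>{j \<in> I \<rightarrow>\<^sub>E UNIV. j x = j y}. F j)
      = (\<Sum>(j, c)\<in>((I - {x, y}) \<rightarrow>\<^sub>E UNIV) \<times> UNIV. F (j(x := c, y := c)))"
  proof (rule sum.reindex_bij_witness[where i = "\<lambda>(j, c). j(x := c, y := c)"
          and j = "\<lambda>j. (j(x := undefined, y := undefined), j x)"])
    fix j assume "j \<in> {j \<in> I \<rightarrow>\<^sub>E (UNIV :: 'N set). j x = j y}"
    then have j: "j \<in> I \<rightarrow>\<^sub>E UNIV" and e: "j x = j y" by auto
    show *: "(case (j(x := undefined, y := undefined), j x) of (j, c) \<Rightarrow> j(x := c, y := c)) = j"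
      using e by (auto simp: fun_eq_iff)
    show "(j(x := undefined, y := undefined), j x) \<in> ((I - {x, y}) \<rightarrow>\<^sub>E UNIV) \<times> UNIV"
      using j by (auto simp: PiE_iff extensional_def)
    show "(case (j(x := undefined, y := undefined), j x) of (j, c) \<Rightarrow> F (j(x := c, y := c))) = F j"
      using arg_cong[OF *, of F] by simp
  next
    fix p assume "p \<in> ((I - {x, y}) \<rightarrow>\<^sub>E (UNIV :: 'N set)) \<times> (UNIV :: 'N set)"
    then obtain j c where p: "p = (j, c)" and j: "j \<in> (I - {x, y}) \<rightarrow>\<^sub>E (UNIV :: 'N set)" by auto
    have u: "j x = undefined" "j y = undefined" using j by (auto simp: PiE_iff extensional_def)
    have "j(x := c, y := c) \<in> I \<rightarrow>\<^sub>E UNIV"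
      using j xy by (auto simp: PiE_iff extensional_def)
    then show "(case p of (j, c) \<Rightarrow> j(x := c, y := c)) \<in> {j \<in> I \<rightarrow>\<^sub>E UNIV. j x = j y}"
      using xy by (simp add: p)
    show "((case p of (j, c) \<Rightarrow> j(x := c, y := c))(x := undefined, y := undefined),
        (case p of (j, c) \<Rightarrow> j(x := c, y := c)) x) = p"
      using u xy by (auto simp: p fun_eq_iff)
  qed
  then show ?thesis by (simp add: sum.cartesian_product)
qed

text \<open>Exhibits the contraction over one matched pair as an inner sum of the full contraction.
  It serves the induction on the number of slots and, later, shows that a matching with a pair
  inside one of two traceless tensors contributes nothing.\<close>

lemma sum_matching_pair:
  fixes f :: "('x \<Rightarrow> 'N::finite) \<Rightarrow> complex"
  assumes fin: "finite I" and inv: "\<forall>l\<in>I. \<sigma> l \<in> I \<and> \<sigma> l \<noteq> l \<and> \<sigma> (\<sigma> l) = l"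
    and x: "x \<in> I"
  shows "(\<Sum>i\<in>{i \<in> I \<rightarrow>\<^sub>E UNIV. \<forall>l\<in>I. i (\<sigma> l) = i l}. f i)
    = (\<Sum>i\<in>{i \<in> (I - {x, \<sigma> x}) \<rightarrow>\<^sub>E UNIV. \<forall>l\<in>I - {x, \<sigma> x}. i (\<sigma> l) = i l}.
        \<Sum>c\<in>UNIV. f (i(x := c, \<sigma> x := c)))"
proof -
  note \<sigma> = inv[rule_format]
  let ?S = "I \<rightarrow>\<^sub>E (UNIV :: 'N set)" and ?y = "\<sigma> x"
  let ?I = "I - {x, ?y}" and ?C = "\<lambda>i. \<forall>l\<in>I. i (\<sigma> l) = (i l :: 'N)"
  have xy: "x \<in> I" "?y \<in> I" "x \<noteq> ?y" using \<sigma>[OF x] x by auto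
  have C: "?C (i(x := c, ?y := c)) \<longleftrightarrow> (\<forall>l\<in>?I. i (\<sigma> l) = i l)" for i c
  proof -
    have "(\<forall>l\<in>I. Q l) \<longleftrightarrow> Q x \<and> Q ?y \<and> (\<forall>l\<in>?I. Q l)" for Q using xy by blast
    moreover have "(i(x := c, ?y := c)) (\<sigma> x) = (i(x := c, ?y := c)) x"
      "(i(x := c, ?y := c)) (\<sigma> ?y) = (i(x := c, ?y := c)) ?y"
      using \<sigma>[OF x] by simp_all
    ultimately have "?C (i(x := c, ?y := c)) \<longleftrightarrow>
        (\<forall>l\<in>?I. (i(x := c, ?y := c)) (\<sigma> l) = (i(x := c, ?y := c)) l)"
      by (simp only: simp_thms)
    also have "\<dots> \<longleftrightarrow> (\<forall>l\<in>?I. i (\<sigma> l) = i l)"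
    proof (intro ball_cong refl)
      fix l assume l: "l \<in> ?I"
      then have "\<sigma> l \<noteq> x" "\<sigma> l \<noteq> ?y" using \<sigma>[of l] \<sigma>[OF x] by auto
      then show "(i(x := c, ?y := c)) (\<sigma> l) = (i(x := c, ?y := c)) l \<longleftrightarrow> i (\<sigma> l) = i l"
        using l by auto
    qed
    finally show ?thesis .
  qed
  have fin': "finite {i \<in> ?S. i x = i ?y}" using fin by simp
  have "{i \<in> ?S. ?C i} = {i \<in> {i \<in> ?S. i x = i ?y}. ?C i}"
    using \<sigma>[OF x] x by (auto dest: bspec[of _ _ x])
  then have "(\<Sum>i\<in>{i \<in> ?S. ?C i}. f i) = (\<Sum>i\<in>{i \<in> ?S. i x = i ?y}. if ?C i then f i else 0)"
    by (simp only: sum.inter_filter[OF fin'])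
  also have "\<dots> = (\<Sum>i\<in>?I \<rightarrow>\<^sub>E UNIV. \<Sum>c\<in>UNIV. if \<forall>l\<in>?I. i (\<sigma> l) = i l
      then f (i(x := c, ?y := c)) else 0)"
    by (simp only: sum_PiE_pair[OF xy] C)
  also have "\<dots> = (\<Sum>i\<in>?I \<rightarrow>\<^sub>E UNIV. if \<forall>l\<in>?I. i (\<sigma> l) = i l
      then \<Sum>c\<in>UNIV. f (i(x := c, ?y := c)) else 0)"
  proof -
    have "(\<Sum>c\<in>UNIV. if P then F c else 0) = (if P then \<Sum>c\<in>UNIV. F c else 0)"
      for P and F :: "'N \<Rightarrow> complex" by simp
    then show ?thesis by (simp only:)
  qed
  also have "\<dots> = (\<Sum>i\<in>{i \<in> ?I \<rightarrow>\<^sub>E UNIV. \<forall>l\<in>?I. i (\<sigma> l) = i l}.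
      \<Sum>c\<in>UNIV. f (i(x := c, ?y := c)))"
    by (rule sum.inter_filter[symmetric]) (use fin in simp)
  finally show ?thesis .
qed

text \<open>Orthonormality of the columns of \<open>g\<close> turns the condition that slots
  \<open>x\<close> and \<open>y\<close> carry equal values into a sum over \<open>b\<close> of
  products of two matrix entries. These two factors complete the product over the remaining slots to
  one over all of \<open>I\<close>, where invariance of \<open>f\<close> applies.\<close>

lemma invariant_array_contract:
  fixes f :: "('x \<Rightarrow> 'N::finite) \<Rightarrow> complex"
  assumes fin: "finite I" and inv: "invariant_array I f" and xy: "x \<in> I" "y \<in> I" "x \<noteq> y"
  shows "invariant_array (I - {x, y}) (\<lambda>i. \<Sum>b\<in>UNIV. f (i(x := b, y := b)))"
  unfolding invariant_array_def
proof (intro allI impI ballI)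
  fix g :: "complex ^ 'N ^ 'N" and i :: "'x \<Rightarrow> 'N"
  assume g: "orthogonal_matrix g \<and> (\<forall>a b. g $ a $ b \<in> \<real>)" and i: "i \<in> (I - {x, y}) \<rightarrow>\<^sub>E UNIV"
  let ?S = "I \<rightarrow>\<^sub>E (UNIV :: 'N set)" and ?P = "\<lambda>j. \<Prod>l\<in>I - {x, y}. g $ i l $ j l"
  have up: "i(x := b, y := b) \<in> ?S" for b
    using i xy by (auto simp: PiE_iff extensional_def)
  have "(\<Sum>j\<in>(I - {x, y}) \<rightarrow>\<^sub>E UNIV. ?P j * (\<Sum>b\<in>UNIV. f (j(x := b, y := b))))
      = (\<Sum>j\<in>(I - {x, y}) \<rightarrow>\<^sub>E UNIV. \<Sum>b\<in>UNIV. ?P (j(x := b, y := b)) * f (j(x := b, y := b)))"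
    by (auto simp: sum_distrib_left intro!: sum.cong prod.cong)
  also have "\<dots> = (\<Sum>j\<in>{j \<in> ?S. j x = j y}. ?P j * f j)"
    by (rule sum_PiE_pair[OF xy, symmetric])
  also have "\<dots> = (\<Sum>j\<in>?S. (if j x = j y then 1 else 0) * (?P j * f j))"
    using fin by (simp add: sum.inter_filter if_distrib[of "\<lambda>z. z * _"] cong: if_cong)
  also have "\<dots> = (\<Sum>j\<in>?S. (\<Sum>b\<in>UNIV. g $ b $ j x * g $ b $ j y) * (?P j * f j))"
    using g by (simp add: orthogonal_matrix_iff)
  also have "\<dots> = (\<Sum>b\<in>UNIV. \<Sum>j\<in>?S. g $ b $ j x * g $ b $ j y * (?P j * f j))"
    by (subst sum.swap) (simp add: sum_distrib_right)
  also have "\<dots> = (\<Sum>b\<in>UNIV. \<Sum>j\<in>?S. (\<Prod>l\<in>I. g $ (i(x := b, y := b)) l $ j l) * f j)"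
  proof (intro sum.cong refl)
    fix b j
    have "I = insert x (insert y (I - {x, y}))" using xy by auto
    then have "(\<Prod>l\<in>I. g $ (i(x := b, y := b)) l $ j l)
        = (\<Prod>l\<in>insert x (insert y (I - {x, y})). g $ (i(x := b, y := b)) l $ j l)" by simp
    also have "\<dots> = g $ b $ j x * (g $ b $ j y * (\<Prod>l\<in>I - {x, y}. g $ (i(x := b, y := b)) l $ j l))"
      using xy fin by simp
    also have "(\<Prod>l\<in>I - {x, y}. g $ (i(x := b, y := b)) l $ j l) = ?P j"
      by (intro prod.cong) auto
    finally show "g $ b $ j x * g $ b $ j y * (?P j * f j)
        = (\<Prod>l\<in>I. g $ (i(x := b, y := b)) l $ j l) * f j"
      by (simp only: mult.assoc)
  qed
  also have "\<dots> = (\<Sum>b\<in>UNIV. f (i(x := b, y := b)))"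
    using inv g up unfolding invariant_array_def by (intro sum.cong refl) blast
  finally show "(\<Sum>j\<in>(I - {x, y}) \<rightarrow>\<^sub>E UNIV. ?P j * (\<Sum>b\<in>UNIV. f (j(x := b, y := b))))
      = (\<Sum>b\<in>UNIV. f (i(x := b, y := b)))" .
qed

text \<open>Applying the derivation twice hits a pair of slots. Two different slots yield either 0
  or a contraction of \<open>f\<close> over this pair, which is assumed to vanish; hitting the same
  slot twice forces \<open>b = a\<close> and returns \<open>f i\<close>, once for each slot.\<close>

lemma raise_twice_sum:
  fixes f :: "('x \<Rightarrow> 'N::finite) \<Rightarrow> complex"
  assumes fin: "finite I"
    and contr: "\<And>x y. x \<in> I \<Longrightarrow> y \<in> I \<Longrightarrow> x \<noteq> y \<Longrightarrow> (\<Sum>b\<in>UNIV. f (i(x := b, y := b))) = 0"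
  shows "(\<Sum>a\<in>UNIV. \<Sum>b\<in>UNIV. raise I a b (raise I a b f) i) = of_nat (card I) * f i"
proof -
  let ?t = "\<lambda>a b l l'. if i l = a \<and> (i(l := b)) l' = a then f (i(l := b, l' := b)) else 0"
  have "(\<Sum>a\<in>UNIV. \<Sum>b\<in>UNIV. raise I a b (raise I a b f) i)
      = (\<Sum>a\<in>UNIV. \<Sum>b\<in>UNIV. \<Sum>l\<in>I. \<Sum>l'\<in>I. ?t a b l l')"
    unfolding raise_def by (intro sum.cong refl) (auto intro!: sum.cong)
  also have "\<dots> = (\<Sum>l\<in>I. \<Sum>a\<in>UNIV. \<Sum>b\<in>UNIV. \<Sum>l'\<in>I. ?t a b l l')"
    by (subst sum.swap[of _ I], subst sum.swap[of _ I]) (rule refl)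
  also have "\<dots> = (\<Sum>l\<in>I. \<Sum>l'\<in>I. \<Sum>a\<in>UNIV. \<Sum>b\<in>UNIV. ?t a b l l')"
    by (intro sum.cong refl) (subst sum.swap[of _ I], subst sum.swap[of _ I], rule refl)
  also have "\<dots> = (\<Sum>l\<in>I. \<Sum>l'\<in>I. if l' = l then f i else 0)"
  proof (intro sum.cong refl)
    fix l l' assume l: "l \<in> I" "l' \<in> I"
    have "(\<Sum>a\<in>UNIV. \<Sum>b\<in>UNIV. ?t a b l l') = (\<Sum>b\<in>UNIV. \<Sum>a\<in>UNIV. ?t a b l l')"
      by (rule sum.swap)
    also have "\<dots> = (\<Sum>b\<in>UNIV. \<Sum>a\<in>UNIV. if a = i l then
        (if (i(l := b)) l' = i l then f (i(l := b, l' := b)) else 0) else 0)"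
      by (intro sum.cong refl) auto
    also have "\<dots> = (\<Sum>b\<in>UNIV. if (i(l := b)) l' = i l then f (i(l := b, l' := b)) else 0)"
      by simp
    also have "\<dots> = (if l' = l then f i else 0)"
    proof (cases "l' = l")
      case True
      have "(\<Sum>b\<in>UNIV. if (i(l := b)) l' = i l then f (i(l := b, l' := b)) else 0)
          = (\<Sum>b\<in>UNIV. if b = i l then f i else 0)"
        by (intro sum.cong refl) (auto simp: True)
      then show ?thesis using True by simp
    next
      case False
      then show ?thesis using contr[of l l'] l by (cases "i l' = i l") auto
    qed
    finally show "(\<Sum>a\<in>UNIV. \<Sum>b\<in>UNIV. ?t a b l l') = (if l' = l then f i else 0)" .
  qed
  also have "\<dots> = of_nat (card I) * f i" using fin by simp
  finally show ?thesis .
qed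

text \<open>
  A full contraction is given
      by a fixed-point free involution \<open>\<sigma>\<close> of the index set. By induction all
  contractions of \<open>f\<close> over a pair of indices vanish. The rotations give \<open>D a b f = D b a f\<close> for
  \<open>D = raise I\<close>, and the sum of the squared norms of all \<open>D b a f\<close> is then
  \<open>\<langle>f, \<Sum> D a b (D a b f)\<rangle> = |I| \<parallel>f\<parallel>\<^sup>2\<close>. But the terms with \<open>a = b\<close> alone contribute at least
  twice this value, since the multiplicities of the values of an index
      in the support of \<open>f\<close> are even,
  as the reflections show.
\<close>

theorem invariant_array_eq_0:
  fixes f :: "('x \<Rightarrow> 'N::finite) \<Rightarrow> complex"
  assumes "finite I" "invariant_array I f"
    and "\<And>\<sigma>. (\<And>l. l \<in> I \<Longrightarrow> \<sigma> l \<in> I \<and> \<sigma> l \<noteq> l \<and> \<sigma> (\<sigma> l) = l) \<Longrightarrow>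
          (\<Sum>i\<in>{i \<in> I \<rightarrow>\<^sub>E UNIV. \<forall>l\<in>I. i (\<sigma> l) = i l}. f i) = 0"
    and "i \<in> I \<rightarrow>\<^sub>E UNIV"
  shows "f i = 0"
  using assms
proof (induction "card I" arbitrary: I f i rule: less_induct)
  case less
  note fin = less.prems(1) and inv = less.prems(2) and match = less.prems(3)
  let ?S = "I \<rightarrow>\<^sub>E (UNIV :: 'N set)"
  show ?case
  proof (cases "I = {}")
    case True
    \<comment> \<open>Without slots there is a single index, and the empty matching makes the full
      contraction equal to the value of \<open>f\<close> there.\<close>
    then show ?thesis using match[of id] less.prems(4) by simp
  next
    case False
    have contr: "(\<Sum>b\<in>UNIV. f (i(x := b, y := b))) = 0"
      if i: "i \<in> ?S" and xy: "x \<in> I" "y \<in> I" "x \<noteq> y" for i x y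
    proof -
      let ?I = "I - {x, y}"
      \<comment> \<open>The induction hypothesis speaks of indices that are extensional on the
        smaller slot set.\<close>
      let ?i = "i(x := undefined, y := undefined)"
      have "(\<Sum>b\<in>UNIV. f (?i(x := b, y := b))) = 0"
      proof (rule less.hyps)
        show "card ?I < card I" using xy fin by (intro psubset_card_mono) auto
        show "finite ?I" using fin by simp
        show "invariant_array ?I (\<lambda>i. \<Sum>b\<in>UNIV. f (i(x := b, y := b)))"
          by (rule invariant_array_contract[OF fin inv xy])
        show "?i \<in> ?I \<rightarrow>\<^sub>E UNIV" using i by (auto simp: PiE_iff extensional_def)
        fix \<sigma> assume \<sigma>: "\<And>l. l \<in> ?I \<Longrightarrow> \<sigma> l \<in> ?I \<and> \<sigma> l \<noteq> l \<and> \<sigma> (\<sigma> l) = l"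
        \<comment> \<open>A matching of the remaining slots extends by the pair \<open>x\<close>,
          \<open>y\<close>, so every full contraction of the contracted array is a full contraction
          of \<open>f\<close>.\<close>
        let ?\<tau> = "\<sigma>(x := y, y := x)"
        have \<tau>: "?\<tau> l \<in> I \<and> ?\<tau> l \<noteq> l \<and> ?\<tau> (?\<tau> l) = l" if "l \<in> I" for l
          using that xy \<sigma>[of l] by auto
        have \<tau>x: "?\<tau> x = y" using xy by simp
        have rest: "(\<forall>l\<in>?I. i (?\<tau> l) = i l) \<longleftrightarrow> (\<forall>l\<in>?I. i (\<sigma> l) = i l)" for i :: "'x \<Rightarrow> 'N"
          by (intro ball_cong refl) simp
        show "(\<Sum>i\<in>{i \<in> ?I \<rightarrow>\<^sub>E UNIV. \<forall>l\<in>?I. i (\<sigma> l) = i l}.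
            \<Sum>b\<in>UNIV. f (i(x := b, y := b))) = 0"
        proof -
          have "(\<Sum>i\<in>{i \<in> ?S. \<forall>l\<in>I. i (?\<tau> l) = i l}. f i) = 0"
            by (rule match) (rule \<tau>)
          moreover have "\<forall>l\<in>I. ?\<tau> l \<in> I \<and> ?\<tau> l \<noteq> l \<and> ?\<tau> (?\<tau> l) = l" using \<tau> by blast
          note sum_matching_pair[where f = f, OF fin this xy(1), unfolded \<tau>x rest]
          ultimately show ?thesis by (simp only:)
        qed
      qed
      then show ?thesis using xy by (simp add: fun_upd_twist)
    qed
    define w where "w i a = card {l \<in> I. i l = a}" for i and a :: 'N
    have cn: "raise I a b (\<lambda>i. cnj (f i)) i = cnj (raise I a b f i)" for a b i
      unfolding raise_def by (simp add: if_distrib[of cnj] cong: if_cong)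
    have norms: "(\<Sum>i\<in>?S. cnj (f i) * raise I a b (raise I a b f) i)
        = of_real (\<Sum>i\<in>?S. (cmod (raise I b a f i))\<^sup>2)" for a b
    proof -
      have "(\<Sum>i\<in>?S. cnj (f i) * raise I a b (raise I a b f) i)
          = (\<Sum>i\<in>?S. raise I b a (\<lambda>i. cnj (f i)) i * raise I a b f i)"
        by (rule raise_adjoint[OF fin])
      also have "\<dots> = (\<Sum>i\<in>?S. cnj (raise I b a f i) * raise I b a f i)"
        by (intro sum.cong refl) (simp add: cn invariant_array_raise[OF fin inv, of _ a b])
      finally show ?thesis
        by (simp only: of_real_sum complex_norm_square mult.commute)
    qed
    have "of_real (\<Sum>a\<in>UNIV. \<Sum>b\<in>UNIV. \<Sum>i\<in>?S. (cmod (raise I b a f i))\<^sup>2)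
        = (\<Sum>a\<in>UNIV. \<Sum>b\<in>UNIV. \<Sum>i\<in>?S. cnj (f i) * raise I a b (raise I a b f) i)"
      by (simp add: norms)
    also have "\<dots> = (\<Sum>i\<in>?S. \<Sum>a\<in>UNIV. \<Sum>b\<in>UNIV. cnj (f i) * raise I a b (raise I a b f) i)"
      by (subst sum.swap[of _ ?S], subst sum.swap[of _ ?S]) (rule refl)
    also have "\<dots> = (\<Sum>i\<in>?S. cnj (f i) * (of_nat (card I) * f i))"
      using raise_twice_sum[OF fin contr] by (simp add: sum_distrib_left[symmetric] cong: sum.cong)
    also have "\<dots> = of_real (\<Sum>i\<in>?S. real (card I) * (cmod (f i))\<^sup>2)"
      unfolding of_real_sum of_real_mult complex_norm_square
      by (intro sum.cong refl) simp
    finally have eq: "(\<Sum>a\<in>UNIV. \<Sum>b\<in>UNIV. \<Sum>i\<in>?S. (cmod (raise I b a f i))\<^sup>2)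
        = (\<Sum>i\<in>?S. real (card I) * (cmod (f i))\<^sup>2)"
      using of_real_eq_iff by blast
    have diag: "raise I a a f i = of_nat (w i a) * f i" for a i
    proof -
      have "raise I a a f i = (\<Sum>l\<in>I. if i l = a then f i else 0)"
        unfolding raise_def by (intro sum.cong refl) (auto simp: fun_upd_idem)
      then show ?thesis using fin by (simp add: w_def sum.inter_filter[symmetric])
    qed
    have card_I: "card I = (\<Sum>a\<in>UNIV. w i a)" for i
    proof -
      have "card I = (\<Sum>l\<in>I. \<Sum>a\<in>UNIV. if a = i l then 1 else 0)" by simp
      also have "\<dots> = (\<Sum>a\<in>UNIV. \<Sum>l\<in>I. if i l = a then 1 else 0)"
        by (subst sum.swap) (auto intro!: sum.cong)
      also have "\<dots> = (\<Sum>a\<in>UNIV. w i a)"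
        using fin by (simp add: w_def sum.inter_filter[symmetric])
      finally show ?thesis .
    qed
    have key: "2 * real (card I) * (cmod (f i))\<^sup>2 \<le> (\<Sum>a\<in>UNIV. (cmod (raise I a a f i))\<^sup>2)"
        if i: "i \<in> ?S" for i
    proof (cases "f i = 0")
      case False
      \<comment> \<open>An even natural number is 0 or at least 2, hence at most half its square.
        This gives the factor 2 that contradicts \<open>eq\<close> unless \<open>f\<close>
        vanishes.\<close>
      have "2 * real (w i a) \<le> (real (w i a))\<^sup>2" for a
      proof -
        have "even (w i a)" unfolding w_def by (rule invariant_array_even[OF fin inv i False])
        then have "w i a = 0 \<or> 2 \<le> w i a" by (metis dvd_imp_le neq0_conv)
        then show ?thesis by (auto simp: power2_eq_square)
      qed
      then have "2 * real (card I) \<le> (\<Sum>a\<in>UNIV. (real (w i a))\<^sup>2)"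
        unfolding card_I[of i] of_nat_sum sum_distrib_left by (rule sum_mono)
      then show ?thesis
        by (simp add: diag norm_mult power_mult_distrib sum_distrib_right[symmetric]
            mult_right_mono)
    qed (simp add: sum_nonneg)
    have "(\<Sum>i\<in>?S. 2 * real (card I) * (cmod (f i))\<^sup>2)
        \<le> (\<Sum>i\<in>?S. \<Sum>a\<in>UNIV. (cmod (raise I a a f i))\<^sup>2)"
      by (intro sum_mono key)
    also have "\<dots> = (\<Sum>a\<in>UNIV. \<Sum>i\<in>?S. (cmod (raise I a a f i))\<^sup>2)" by (rule sum.swap)
    also have "\<dots> \<le> (\<Sum>a\<in>UNIV. \<Sum>b\<in>UNIV. \<Sum>i\<in>?S. (cmod (raise I b a f i))\<^sup>2)"
      by (intro sum_mono member_le_sum[of _ _ "\<lambda>b. \<Sum>i\<in>?S. (cmod (raise I b _ f i))\<^sup>2"])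
        (auto intro: sum_nonneg)
    also have "\<dots> = (\<Sum>i\<in>?S. real (card I) * (cmod (f i))\<^sup>2)" by (rule eq)
    finally have "real (card I) * (\<Sum>i\<in>?S. (cmod (f i))\<^sup>2) \<le> 0"
      by (simp add: sum_distrib_left[symmetric] mult.assoc)
    moreover have "card I > 0" using False fin by (simp add: card_gt_0_iff)
    ultimately have "(\<Sum>i\<in>?S. (cmod (f i))\<^sup>2) \<le> 0"
      by (simp add: mult_le_0_iff)
    then have "(\<Sum>i\<in>?S. (cmod (f i))\<^sup>2) = 0" by (intro antisym sum_nonneg) auto
    then show ?thesis using less.prems(4) fin by (simp add: sum_nonneg_eq_0_iff)
  qed
qed

section \<open>Orthogonal projections\<close>

lemma scaleC_apply: "(a *\<^sub>C f) x = a * (f x :: complex)"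
  by (simp add: scaleC_fun_def scaleC_complex_def)

lemma sum_apply: "(\<Sum>a\<in>A. f a) x = (\<Sum>a\<in>A. f a x :: 'b :: comm_monoid_add)"
  by (induction A rule: infinite_finite_induct) auto

text \<open>One finite-dimensional model for both uses of the Hermitian form: tensors, with
  \<open>A\<close> the set of indices, and Specht modules, with \<open>A\<close> the set of
  tabloids.\<close>

definition funs :: "'a set \<Rightarrow> ('a \<Rightarrow> complex) set" where
  "funs A = {t. \<forall>i. i \<notin> A \<longrightarrow> t i = 0}"

definition delta :: "'a \<Rightarrow> 'a \<Rightarrow> complex" where
  "delta i = (\<lambda>j. if j = i then 1 else 0)"

definition herm :: "'a set \<Rightarrow> ('a \<Rightarrow> complex) \<Rightarrow> ('a \<Rightarrow> complex) \<Rightarrow> complex" where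
  "herm A s t = (\<Sum>i\<in>A. s i * cnj (t i))"

lemma herm_add_left: "herm A (s + s') t = herm A s t + herm A s' t"
  and herm_add_right: "herm A s (t + t') = herm A s t + herm A s t'"
  and herm_diff_left: "herm A (s - s') t = herm A s t - herm A s' t"
  and herm_scale_left: "herm A (c *\<^sub>C s) t = c * herm A s t"
  and herm_scale_right: "herm A s (c *\<^sub>C t) = cnj c * herm A s t"
  and herm_zero_left: "herm A 0 t = 0"
  and herm_zero_right: "herm A s 0 = 0"
  by (simp_all add: herm_def algebra_simps sum.distrib sum_subtractf sum_distrib_left scaleC_apply)

lemma herm_sum_left: "herm A (\<Sum>b\<in>B. f b) t = (\<Sum>b\<in>B. herm A (f b) t)"
  unfolding herm_def sum_apply sum_distrib_right by (rule sum.swap)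

lemma herm_sum_right: "herm A t (\<Sum>b\<in>B. f b) = (\<Sum>b\<in>B. herm A t (f b))"
  unfolding herm_def sum_apply cnj_sum sum_distrib_left by (rule sum.swap)

lemma herm_cnj: "cnj (herm A s t) = herm A t s"
  by (simp add: herm_def mult.commute)

lemma herm_self: "herm A s s = of_real (\<Sum>i\<in>A. (cmod (s i))\<^sup>2)"
  unfolding herm_def of_real_sum complex_norm_square ..

lemma herm_self_eq_0:
  assumes "finite A" "s \<in> funs A" "herm A s s = 0"
  shows "s = 0"
proof
  fix i
  have "(\<Sum>i\<in>A. (cmod (s i))\<^sup>2) = 0" using assms(3) unfolding herm_self of_real_eq_0_iff .
  then have "\<forall>i\<in>A. s i = 0" using assms(1) by (simp add: sum_nonneg_eq_0_iff)
  then show "s i = 0 i" using assms(2) by (auto simp: funs_def)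
qed

lemma herm_delta_right: "finite A \<Longrightarrow> i \<in> A \<Longrightarrow> herm A s (delta i) = s i"
  by (simp add: herm_def delta_def if_distrib[of cnj] if_distrib[of "\<lambda>x. _ * x"] cong: if_cong)

lemma subspace_funs: "cvec.subspace (funs A)"
  by (auto simp: cvec.subspace_def funs_def scaleC_apply)

lemma funs_expand: "finite A \<Longrightarrow> t \<in> funs A \<Longrightarrow> t = (\<Sum>i\<in>A. t i *\<^sub>C delta i)"
  by (auto simp: fun_eq_iff sum_apply scaleC_apply delta_def funs_def
      if_distrib[of "\<lambda>x. _ * x"] cong: if_cong)

definition orthonormal :: "'a set \<Rightarrow> ('a \<Rightarrow> complex) set \<Rightarrow> bool" where
  "orthonormal A B \<longleftrightarrow> (\<forall>b\<in>B. \<forall>c\<in>B. herm A b c = (if b = c then 1 else 0))"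

lemma orthonormal_sum:
  assumes "finite B" "orthonormal A B" "c \<in> B"
  shows "(\<Sum>b\<in>B. herm A c b *\<^sub>C b) = c"
proof -
  have "(\<Sum>b\<in>B. herm A c b *\<^sub>C b) = (\<Sum>b\<in>B. if b = c then c else 0)"
    using assms(2,3) by (intro sum.cong refl) (auto simp: orthonormal_def cvec.scale_one)
  then show ?thesis using assms(1,3) by simp
qed

text \<open>The conclusion carries the expansion of every vector of the span in the orthonormal set,
  since the projection is defined by this very formula.\<close>

lemma gram_schmidt:
  assumes A: "finite A" and "finite S" "S \<subseteq> funs A"
  shows "\<exists>B. finite B \<and> B \<subseteq> cvec.span S \<and> orthonormal A B \<and>
    (\<forall>z\<in>cvec.span S. z = (\<Sum>b\<in>B. herm A z b *\<^sub>C b))"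
  using assms(2,3)
proof (induction S rule: finite_induct)
  case empty
  then show ?case by (intro exI[of _ "{}"]) (simp add: orthonormal_def)
next
  case (insert s S)
  then obtain B where B: "finite B" "B \<subseteq> cvec.span S" "orthonormal A B"
    and exp: "\<And>z. z \<in> cvec.span S \<Longrightarrow> z = (\<Sum>b\<in>B. herm A z b *\<^sub>C b)" by auto
  define p where "p = (\<Sum>b\<in>B. herm A s b *\<^sub>C b)"
  define r where "r = s - p"
  have p: "p \<in> cvec.span S"
    unfolding p_def using B(2) by (intro cvec.span_sum cvec.span_scale) auto
  have rB: "herm A r b = 0" if "b \<in> B" for b
  proof -
    have "herm A p b = (\<Sum>c\<in>B. if c = b then herm A s b else 0)"
      unfolding p_def herm_sum_left herm_scale_left
      using that B(3) by (intro sum.cong refl) (auto simp: orthonormal_def)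
    then show ?thesis using that B(1) by (simp add: r_def herm_diff_left)
  qed
  show ?case
  proof (cases "r = 0")
    case True
    then have "s \<in> cvec.span S" using p by (simp add: r_def)
    then have "cvec.span (insert s S) = cvec.span S" by (rule cvec.span_redundant)
    then show ?thesis using B exp by auto
  next
    case False
    have mono: "cvec.span S \<subseteq> cvec.span (insert s S)" by (rule cvec.span_mono) auto
    have rs: "r \<in> cvec.span (insert s S)"
      unfolding r_def by (rule cvec.span_diff[OF cvec.span_base[OF insertI1] subsetD[OF mono p]])
    moreover have "cvec.span (insert s S) \<subseteq> funs A"
      using insert.prems by (intro cvec.span_minimal subspace_funs) auto
    ultimately have "herm A r r \<noteq> 0" using herm_self_eq_0[OF A] False by auto
    define q where "q = (\<Sum>i\<in>A. (cmod (r i))\<^sup>2)"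
    have hq: "herm A r r = of_real q" unfolding q_def by (rule herm_self)
    have "q \<ge> 0" unfolding q_def by (intro sum_nonneg) auto
    then have q: "q > 0" using \<open>herm A r r \<noteq> 0\<close> hq by (cases "q = 0") auto
    \<comment> \<open>The remainder \<open>r\<close> is divided by its norm; positivity of the
      squared norm \<open>q\<close> is what makes the complex square root of the form
      unproblematic.\<close>
    define u where "u = (1 / of_real (sqrt q)) *\<^sub>C r"
    have sq: "of_real (sqrt q) * of_real (sqrt q) = (of_real q :: complex)"
      using q by (simp flip: of_real_mult)
    have uu: "herm A u u = 1"
      using q by (simp add: u_def herm_scale_left herm_scale_right hq sq[symmetric])
    have uB: "herm A u b = 0" "herm A b u = 0" if "b \<in> B" for b
    proof -
      show "herm A u b = 0" using rB[OF that] by (simp add: u_def herm_scale_left)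
      then show "herm A b u = 0" using herm_cnj[of A u b] by simp
    qed
    have uni: "u \<notin> B" using uB uu by force
    have r_u: "r = of_real (sqrt q) *\<^sub>C u" using q by (simp add: u_def cvec.scale_one)
    have on: "orthonormal A (insert u B)"
      using B(3) uu uB uni unfolding orthonormal_def by auto
    \<comment> \<open>The vectors with the desired expansion form a subspace, so it is enough to
      find the old span and the new generator in it.\<close>
    define Q where "Q = {z. z = (\<Sum>b\<in>insert u B. herm A z b *\<^sub>C b)}"
    have subQ: "cvec.subspace Q"
    proof (rule cvec.subspaceI)
      show "0 \<in> Q" by (simp add: Q_def herm_zero_left cvec.scale_zero_left)
    next
      fix x y assume "x \<in> Q" "y \<in> Q"
      then have "x + y = (\<Sum>b\<in>insert u B. herm A x b *\<^sub>C b) + (\<Sum>b\<in>insert u B. herm A y b *\<^sub>C b)"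
        unfolding Q_def mem_Collect_eq by (rule arg_cong2[of _ _ _ _ "(+)"])
      then show "x + y \<in> Q"
        unfolding Q_def mem_Collect_eq herm_add_left cvec.scale_left_distrib sum.distrib .
    next
      fix c x assume "x \<in> Q"
      then have "c *\<^sub>C x = c *\<^sub>C (\<Sum>b\<in>insert u B. herm A x b *\<^sub>C b)"
        unfolding Q_def mem_Collect_eq by (rule arg_cong)
      then show "c *\<^sub>C x \<in> Q"
        unfolding Q_def mem_Collect_eq herm_scale_left cvec.scale_sum_right cvec.scale_scale .
    qed
    have BQ: "insert u B \<subseteq> Q"
      unfolding Q_def using orthonormal_sum[OF _ on] B(1) by auto
    have SQ: "cvec.span S \<subseteq> Q"
    proof
      fix z assume "z \<in> cvec.span S"
      from exp[OF this] have "z = (\<Sum>b\<in>B. herm A z b *\<^sub>C b)" .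
      moreover have "(\<Sum>b\<in>B. herm A z b *\<^sub>C b) \<in> Q"
        using BQ by (intro cvec.subspace_sum[OF subQ] cvec.subspace_scale[OF subQ]) auto
      ultimately show "z \<in> Q" by simp
    qed
    have "s = p + r" by (simp add: r_def)
    moreover have "r \<in> Q" unfolding r_u using BQ by (intro cvec.subspace_scale[OF subQ]) auto
    ultimately have "s \<in> Q" using p SQ cvec.subspace_add[OF subQ] by auto
    then have "cvec.span (insert s S) \<subseteq> Q"
      using SQ cvec.span_superset[of S] by (intro cvec.span_minimal subQ) auto
    moreover have "u \<in> cvec.span (insert s S)"
      unfolding u_def by (intro cvec.span_scale rs)
    ultimately show ?thesis
      using B(1,2) on mono by (intro exI[of _ "insert u B"]) (auto simp: Q_def)
  qed
qed

lemma subspace_funs_span: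
  assumes A: "finite A" and W: "cvec.subspace W" "W \<subseteq> funs A"
  shows "\<exists>S. finite S \<and> S \<subseteq> W \<and> cvec.span S = W"
proof -
  obtain S where S: "S \<subseteq> W" "cvec.independent S" "W \<subseteq> cvec.span S"
    by (rule cvec.basis_exists)
  have "funs A \<subseteq> cvec.span (delta ` A)"
  proof
    fix t assume "t \<in> funs A"
    then have "t = (\<Sum>i\<in>A. t i *\<^sub>C delta i)" by (rule funs_expand[OF A])
    moreover have "(\<Sum>i\<in>A. t i *\<^sub>C delta i) \<in> cvec.span (delta ` A)"
      by (intro cvec.span_sum cvec.span_scale cvec.span_base) auto
    ultimately show "t \<in> cvec.span (delta ` A)" by simp
  qed
  then have "finite S" using cvec.independent_span_bound[of "delta ` A" S] S(1,2) W(2) A by auto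
  moreover have "cvec.span S = W"
    using S W(1) by (intro equalityI cvec.span_minimal) auto
  ultimately show ?thesis using S by blast
qed

lemma orthonormal_basis:
  assumes "finite A" "cvec.subspace W" "W \<subseteq> funs A"
  shows "\<exists>B. finite B \<and> B \<subseteq> W \<and> orthonormal A B \<and> (\<forall>z\<in>W. z = (\<Sum>b\<in>B. herm A z b *\<^sub>C b))"
proof -
  obtain S where S: "finite S" "S \<subseteq> W" "cvec.span S = W"
    using subspace_funs_span[OF assms] by blast
  have "S \<subseteq> funs A" using S(2) assms(3) by blast
  from gram_schmidt[OF assms(1) S(1) this] show ?thesis unfolding S(3) .
qed

text \<open>The basis is an arbitrary choice; \<open>proj_unique\<close> shows that the projection
  does not depend on it.\<close>

definition orth_basis :: "'a set \<Rightarrow> ('a \<Rightarrow> complex) set \<Rightarrow> ('a \<Rightarrow> complex) set" where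
  "orth_basis A W = (SOME B. finite B \<and> B \<subseteq> W \<and> orthonormal A B \<and>
     (\<forall>z\<in>W. z = (\<Sum>b\<in>B. herm A z b *\<^sub>C b)))"

definition proj :: "'a set \<Rightarrow> ('a \<Rightarrow> complex) set \<Rightarrow> ('a \<Rightarrow> complex) \<Rightarrow> 'a \<Rightarrow> complex" where
  "proj A W t = (\<Sum>b\<in>orth_basis A W. herm A t b *\<^sub>C b)"

lemma proj_add: "proj A W (s + t) = proj A W s + proj A W t"
  by (simp add: proj_def herm_add_left cvec.scale_left_distrib sum.distrib)

lemma proj_scale: "proj A W (c *\<^sub>C t) = c *\<^sub>C proj A W t"
  by (simp add: proj_def herm_scale_left cvec.scale_sum_right)

lemma proj_zero: "proj A W 0 = 0"
  by (simp add: proj_def herm_zero_left cvec.scale_zero_left)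

context
  fixes A :: "'a set" and W :: "('a \<Rightarrow> complex) set"
  assumes A: "finite A" and W: "cvec.subspace W" "W \<subseteq> funs A"
begin

lemma orth_basis:
  shows "finite (orth_basis A W)" "orth_basis A W \<subseteq> W" "orthonormal A (orth_basis A W)"
    "z \<in> W \<Longrightarrow> (\<Sum>b\<in>orth_basis A W. herm A z b *\<^sub>C b) = z"
  using someI_ex[OF orthonormal_basis[OF A W]] unfolding orth_basis_def by auto

lemma proj_in: "proj A W t \<in> W"
  unfolding proj_def using orth_basis(2)
  by (intro cvec.subspace_sum[OF W(1)] cvec.subspace_scale[OF W(1)]) auto

lemma proj_id: "t \<in> W \<Longrightarrow> proj A W t = t"
  unfolding proj_def by (rule orth_basis)

lemma proj_orth: 
  assumes "w \<in> W" shows "herm A (t - proj A W t) w = 0"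
proof -
  have b: "herm A (t - proj A W t) b = 0" if "b \<in> orth_basis A W" for b
  proof -
    have "herm A (proj A W t) b = (\<Sum>c\<in>orth_basis A W. if c = b then herm A t b else 0)"
      unfolding proj_def herm_sum_left herm_scale_left
      using that orth_basis(3) by (intro sum.cong refl) (auto simp: orthonormal_def)
    then show ?thesis using that orth_basis(1) by (simp add: herm_diff_left)
  qed
  have "herm A (t - proj A W t) w
      = herm A (t - proj A W t) (\<Sum>b\<in>orth_basis A W. herm A w b *\<^sub>C b)"
    using orth_basis(4)[OF assms] by simp
  also have "\<dots> = 0" by (simp add: herm_sum_right herm_scale_right b)
  finally show ?thesis .
qed

lemma proj_unique:
  assumes "w \<in> W" and "\<And>u. u \<in> W \<Longrightarrow> herm A (t - w) u = 0"
  shows "proj A W t = w"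
proof -
  let ?d = "proj A W t - w"
  have d: "?d \<in> W" using proj_in assms(1) by (intro cvec.subspace_diff[OF W(1)])
  have "herm A ?d ?d = herm A (t - w) ?d - herm A (t - proj A W t) ?d"
    by (simp add: herm_diff_left)
  also have "\<dots> = 0" using assms(2)[OF d] proj_orth[OF d] by simp
  finally have "?d = 0" using herm_self_eq_0[OF A] d W(2) by blast
  then show ?thesis by simp
qed

lemma proj_orthogonal: "(\<And>u. u \<in> W \<Longrightarrow> herm A t u = 0) \<Longrightarrow> proj A W t = 0"
  by (rule proj_unique) (auto intro: cvec.subspace_0[OF W(1)])

text \<open>Stability of \<open>W\<close> under the adjoint \<open>X'\<close> makes \<open>X\<close>
  preserve orthogonality to \<open>W\<close>. So \<open>X\<close> applied to the decomposition of
  \<open>t\<close> is the decomposition of \<open>X t\<close>.\<close>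

lemma proj_commute:
  assumes X: "\<And>s t. s \<in> funs A \<Longrightarrow> t \<in> funs A \<Longrightarrow> X (s - t) = X s - X t"
    and XW: "\<And>w. w \<in> W \<Longrightarrow> X w \<in> W"
    and adj: "\<And>s w. s \<in> funs A \<Longrightarrow> w \<in> W \<Longrightarrow> herm A (X s) w = herm A s (X' w)"
    and XW': "\<And>w. w \<in> W \<Longrightarrow> X' w \<in> W"
    and t: "t \<in> funs A"
  shows "proj A W (X t) = X (proj A W t)"
proof (rule proj_unique)
  show "X (proj A W t) \<in> W" by (intro XW proj_in)
  fix u assume u: "u \<in> W"
  have p: "proj A W t \<in> funs A" using proj_in W(2) by blast
  have "X t - X (proj A W t) = X (t - proj A W t)" using X[OF t p] by simp
  moreover have "t - proj A W t \<in> funs A" by (rule cvec.subspace_diff[OF subspace_funs t p])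
  ultimately show "herm A (X t - X (proj A W t)) u = 0"
    using adj u proj_orth[OF XW'[OF u]] by simp
qed

end

section \<open>Invariant pairings of Specht modules\<close>

lemma column_group_transpose:
  assumes "x \<in> {1..m}" "x' \<in> {1..m}" "snd (T x) = snd (T x')"
  shows "Transposition.transpose x x' \<in> column_group m T"
  using assms by (auto simp: column_group_def permutes_swap_id Transposition.transpose_def)

lemma tabloid_comp:
  assumes "q permutes {1..m}"
  shows "tabloid m (T \<circ> q) = tabloid m T \<circ> q"
  using permutes_in_image[OF assms] by (auto simp: tabloid_def fun_eq_iff)

text \<open>Right multiplication by a transposition from the column group permutes that group and
  reverses every sign.\<close>

lemma polytabloid_transpose:
  assumes x: "x \<in> {1..m}" "x' \<in> {1..m}" "x \<noteq> x'" "snd (T x) = snd (T x')"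
  shows "tabloid_op (Transposition.transpose x x') (polytabloid m T) = - polytabloid m T"
proof
  fix r
  let ?\<tau> = "Transposition.transpose x x'" and ?C = "column_group m T"
  have tt: "?\<tau> \<circ> ?\<tau> = id" by (simp add: fun_eq_iff)
  have \<tau>: "?\<tau> permutes {1..m}" by (rule permutes_swap_id) (use x in auto)
  have C: "q \<circ> ?\<tau> \<in> ?C" if "q \<in> ?C" for q
    using that column_group_transpose[OF x(1,2,4)] permutes_in_image[OF \<tau>]
    unfolding column_group_def by (auto intro: permutes_compose)
  have sgn: "sign (q \<circ> ?\<tau>) = - sign q" if "q \<in> ?C" for q
    using that x(3) \<tau> by (subst sign_compose)
      (auto simp: column_group_def sign_swap_id intro: permutes_imp_permutation[of "{1..m}"])
  have tab: "tabloid m (T \<circ> (q \<circ> ?\<tau>)) = tabloid m (T \<circ> q) \<circ> ?\<tau>" for q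
    using tabloid_comp[OF \<tau>, of "T \<circ> q"] by (simp add: comp_assoc)
  have "tabloid_op ?\<tau> (polytabloid m T) r
      = (\<Sum>q\<in>?C. if r \<circ> ?\<tau> = tabloid m (T \<circ> q) then of_int (sign q) else 0)"
    by (simp add: tabloid_op_def polytabloid_def)
  also have "\<dots> = (\<Sum>q\<in>?C. if r = tabloid m (T \<circ> q) then - of_int (sign q) else 0)"
  proof (rule sum.reindex_bij_witness[where i = "\<lambda>q. q \<circ> ?\<tau>" and j = "\<lambda>q. q \<circ> ?\<tau>"])
    fix q assume q: "q \<in> ?C"
    show "q \<circ> ?\<tau> \<circ> ?\<tau> = q" by (simp add: comp_assoc tt)
    show "q \<circ> ?\<tau> \<in> ?C" by (rule C[OF q])
    have "r \<circ> ?\<tau> = tabloid m (T \<circ> q) \<longleftrightarrow> r = tabloid m (T \<circ> q) \<circ> ?\<tau>"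
      by (metis comp_assoc comp_id tt)
    then show "(if r = tabloid m (T \<circ> (q \<circ> ?\<tau>)) then - of_int (sign (q \<circ> ?\<tau>)) else 0)
        = (if r \<circ> ?\<tau> = tabloid m (T \<circ> q) then of_int (sign q) else (0 :: complex))"
      unfolding tab using sgn[OF q] by auto
  next
    fix q assume q: "q \<in> ?C"
    show "q \<circ> ?\<tau> \<circ> ?\<tau> = q" by (simp add: comp_assoc tt)
    show "q \<circ> ?\<tau> \<in> ?C" by (rule C[OF q])
  qed
  also have "\<dots> = (- polytabloid m T) r"
    by (simp add: polytabloid_def sum_negf[symmetric] if_distrib[of uminus] cong: if_cong)
  finally show "tabloid_op ?\<tau> (polytabloid m T) r = (- polytabloid m T) r" .
qed

lemma tabloid_op_delta:
  assumes "r x = r x'"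
  shows "tabloid_op (Transposition.transpose x x') (delta r) = delta r"
proof
  fix s
  have "s \<circ> Transposition.transpose x x' = r \<longleftrightarrow> s = r"
  proof -
    have "r \<circ> Transposition.transpose x x' = r" using assms
        by (auto simp: fun_eq_iff Transposition.transpose_def)
    moreover have "Transposition.transpose x x' \<circ> Transposition.transpose x x' = id"
        by (simp add: fun_eq_iff)
    ultimately show ?thesis by (metis comp_assoc comp_id)
  qed
  then show "tabloid_op (Transposition.transpose x x') (delta r) s = delta r s"
    by (simp add: tabloid_op_def delta_def)
qed

lemma polytabloid_expand:
  "polytabloid m T = (\<Sum>q\<in>column_group m T. of_int (sign q) *\<^sub>C delta (tabloid m (T \<circ> q)))"
  by (auto simp: fun_eq_iff polytabloid_def sum_apply scaleC_apply delta_def intro!: sum.cong)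

lemma young_down: "young_diagram \<mu> \<Longrightarrow> (r, c) \<in> \<mu> \<Longrightarrow> r' \<le> r \<Longrightarrow> c' \<le> c \<Longrightarrow> (r', c') \<in> \<mu>"
  by (auto simp: young_diagram_def)

text \<open>Each column of the tableau \<open>T\<close> contributes at most \<open>j\<close> entries to the first \<open>j\<close> rows of
  \<open>T'\<close>, and at most its length.\<close>

lemma row_dominance:
  fixes T T' :: "nat \<Rightarrow> nat \<times> nat"
  assumes \<mu>: "young_diagram \<mu>" and T: "bij_betw T {1..m} \<mu>" and T': "bij_betw T' {1..m} \<nu>"
    and rows: "\<And>x x'. x \<in> {1..m} \<Longrightarrow> x' \<in> {1..m} \<Longrightarrow> x \<noteq> x' \<Longrightarrow> snd (T x) = snd (T x') \<Longrightarrow>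
      fst (T' x) \<noteq> fst (T' x')"
  shows "card {b \<in> \<nu>. fst b < j} \<le> card {b \<in> \<mu>. fst b < j}"
proof -
  define X where "X = {x \<in> {1..m}. fst (T' x) < j}"
  define Y where "Y = {x \<in> {1..m}. fst (T x) < j}"
  define cols where "cols = (\<lambda>x. snd (T x)) ` {1..m}"
  have fin: "finite X" "finite Y" "finite cols" by (simp_all add: X_def Y_def cols_def)
  have "card X = card {b \<in> \<nu>. fst b < j}"
    by (rule bij_betw_same_card[of T'], rule bij_betw_subset[OF T', THEN bij_betw_cong[THEN iffD1,
        rotated]])
      (use T' in \<open>auto simp: X_def bij_betw_def\<close>)
  moreover have "card Y = card {b \<in> \<mu>. fst b < j}"
    by (rule bij_betw_same_card[of T], rule bij_betw_subset[OF T, THEN bij_betw_cong[THEN iffD1,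
        rotated]])
      (use T in \<open>auto simp: Y_def bij_betw_def\<close>)
  moreover have "card X \<le> card Y"
  proof -
    have fib: "card Z = (\<Sum>c\<in>cols. card {x \<in> Z. snd (T x) = c})" if "finite Z" "Z \<subseteq> {1..m}" for Z
    proof -
      have "(\<Sum>c\<in>cols. \<Sum>x\<in>{x \<in> Z. snd (T x) = c}. 1) = (\<Sum>x\<in>Z. 1 :: nat)"
        by (rule sum.group) (use that fin in \<open>auto simp: cols_def\<close>)
      then show ?thesis by simp
    qed
    have "card {x \<in> X. snd (T x) = c} \<le> card {x \<in> Y. snd (T x) = c}" for c
    proof (cases "\<forall>r<j. (r, c) \<in> \<mu>")
      case True
      \<comment> \<open>Entries from one column of \<open>T\<close> lie in different rows of
        \<open>T'\<close>, so at most \<open>j\<close> of them are in the first \<open>j\<close>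
        rows. The first \<open>j\<close> boxes of the column are all present and supply
        \<open>j\<close> elements of \<open>Y\<close>.\<close>
      have "card {x \<in> X. snd (T x) = c} = card ((\<lambda>x. fst (T' x)) ` {x \<in> X. snd (T x) = c})"
        by (rule card_image[symmetric], rule inj_onI) (use rows in \<open>auto simp: X_def\<close>)
      also have "\<dots> \<le> card {..<j}" by (rule card_mono) (auto simp: X_def)
      also have "\<dots> = card ((\<lambda>r. inv_into {1..m} T (r, c)) ` {..<j})"
        by (rule card_image[symmetric], rule inj_onI)
          (metis T True bij_betw_imp_surj_on inv_into_injective lessThan_iff prod.inject)
      also have "\<dots> \<le> card {x \<in> Y. snd (T x) = c}"
      proof (rule card_mono)
        show "(\<lambda>r. inv_into {1..m} T (r, c)) ` {..<j} \<subseteq> {x \<in> Y. snd (T x) = c}"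
        proof
          fix x assume "x \<in> (\<lambda>r. inv_into {1..m} T (r, c)) ` {..<j}"
          then obtain r where r: "r < j" "x = inv_into {1..m} T (r, c)" by auto
          have "(r, c) \<in> T ` {1..m}" using r True T by (simp add: bij_betw_def)
          then have "T x = (r, c)" "x \<in> {1..m}"
            unfolding r by (rule f_inv_into_f, rule inv_into_into)
          then show "x \<in> {x \<in> Y. snd (T x) = c}" using r by (simp add: Y_def)
        qed
      qed (use fin in simp)
      finally show ?thesis .
    next
      case False
      \<comment> \<open>Column \<open>c\<close> ends before row \<open>j\<close>, hence all its
        entries lie in the first \<open>j\<close> rows of \<open>T\<close>.\<close>
      then obtain r where r: "r < j" "(r, c) \<notin> \<mu>" by auto
      have "{x \<in> X. snd (T x) = c} \<subseteq> {x \<in> Y. snd (T x) = c}"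
      proof
        fix x assume "x \<in> {x \<in> X. snd (T x) = c}"
        then have x: "x \<in> {1..m}" "snd (T x) = c" by (auto simp: X_def)
        then have "(fst (T x), c) \<in> \<mu>" using T by (auto simp: bij_betw_def)
        then have "fst (T x) < r" using r(2) young_down[OF \<mu>] by (meson le_refl not_less)
        then show "x \<in> {x \<in> Y. snd (T x) = c}" using x r(1) by (simp add: Y_def)
      qed
      then show ?thesis using fin by (intro card_mono) auto
    qed
    moreover have "X \<subseteq> {1..m}" "Y \<subseteq> {1..m}" by (auto simp: X_def Y_def)
    ultimately show ?thesis
      using fib[of X] fib[of Y] fin by (simp add: sum_mono)
  qed
  ultimately show ?thesis by simp
qed

text \<open>A row of a Young diagram is an initial segment, so its length determines it.\<close>

lemma young_diagram_row_iff:
  assumes "young_diagram \<mu>"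
  shows "(r, c) \<in> \<mu> \<longleftrightarrow> c < card {b \<in> \<mu>. fst b = r}"
proof -
  let ?S = "{c. (r, c) \<in> \<mu>}"
  have fin: "finite \<mu>" using assms by (simp add: young_diagram_def)
  have row: "{b \<in> \<mu>. fst b = r} = Pair r ` ?S" by force
  have finS: "finite ?S"
    by (rule finite_imageD[of "Pair r"]) (use fin row[symmetric] in \<open>auto simp: inj_on_def\<close>)
  have "card {b \<in> \<mu>. fst b = r} = card ?S" unfolding row
      by (rule card_image) (auto simp: inj_on_def)
  moreover have "c \<in> ?S \<longleftrightarrow> c < card ?S"
  proof
    assume "c \<in> ?S"
    then have "{..c} \<subseteq> ?S" using young_down[OF assms] by auto
    then have "card {..c} \<le> card ?S" by (rule card_mono[OF finS])
    then show "c < card ?S" by simp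
  next
    assume c: "c < card ?S"
    show "c \<in> ?S"
    proof (rule ccontr)
      assume "c \<notin> ?S"
      then have "?S \<subseteq> {..<c}" using young_down[OF assms, of r _ r c]
          by (auto simp: not_le[symmetric])
      then have "card ?S \<le> card {..<c}" by (intro card_mono) auto
      then show False using c by simp
    qed
  qed
  ultimately show ?thesis by simp
qed

lemma young_diagram_eqI:
  assumes \<mu>: "young_diagram \<mu>" and \<nu>: "young_diagram \<nu>"
    and eq: "\<And>j. card {b \<in> \<mu>. fst b < j} = card {b \<in> \<nu>. fst b < j}"
  shows "\<mu> = \<nu>"
proof -
  have row: "card {b \<in> \<kappa>. fst b < Suc r} = card {b \<in> \<kappa>. fst b < r} + card {b \<in> \<kappa>. fst b = r}"
    if "young_diagram \<kappa>" for \<kappa> r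
  proof -
    have "finite \<kappa>" using that by (simp add: young_diagram_def)
    moreover have "{b \<in> \<kappa>. fst b < Suc r} = {b \<in> \<kappa>. fst b < r} \<union> {b \<in> \<kappa>. fst b = r}" by auto
    ultimately show ?thesis by (simp add: card_Un_disjoint disjoint_iff)
  qed
  have "card {b \<in> \<mu>. fst b = r} = card {b \<in> \<nu>. fst b = r}" for r
    using row[OF \<mu>, of r] row[OF \<nu>, of r] eq[of r] eq[of "Suc r"] by simp
  then have "(r, c) \<in> \<mu> \<longleftrightarrow> (r, c) \<in> \<nu>" for r c
    by (simp add: young_diagram_row_iff[OF \<mu>] young_diagram_row_iff[OF \<nu>])
  then show ?thesis by auto
qed

text \<open>Some tabloid occurring in the second polytabloid pairs nontrivially with the first one.
  If two entries shared a column of \<open>T\<close> and a row of this tabloid, their transposition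
  would negate one argument and fix the other, so the pairing would be its own negative. Hence
  \<open>row_dominance\<close> applies. The scaling hypothesis is so weak in order to cover a
  sesquilinear form with its arguments in either order.\<close>

lemma polytabloid_pairing_dominance:
  fixes
    \<gamma> :: "((nat \<Rightarrow> nat) \<Rightarrow> complex) \<Rightarrow> ((nat \<Rightarrow> nat) \<Rightarrow> complex) \<Rightarrow> complex"
  assumes \<mu>: "young_diagram \<mu>" and T: "bij_betw T {1..m} \<mu>" and T': "bij_betw T' {1..m} \<nu>"
    and minus: "\<And>x y. \<gamma> (- x) y = - \<gamma> x y"
    and add: "\<And>x y y'. \<gamma> x (y + y') = \<gamma> x y + \<gamma> x y'"
    and scale: "\<And>c x y. \<gamma> x y = 0 \<Longrightarrow> \<gamma> x (c *\<^sub>C y) = 0"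
    and inv: "\<And>q x y. q permutes {1..m} \<Longrightarrow> \<gamma> (tabloid_op q x) (tabloid_op q y) = \<gamma> x y"
    and nz: "\<gamma> (polytabloid m T) (polytabloid m T') \<noteq> 0"
  shows "card {b \<in> \<nu>. fst b < j} \<le> card {b \<in> \<mu>. fst b < j}"
proof -
  have sum0: "\<gamma> x (\<Sum>q\<in>Q. f q) = 0" if "\<And>q. q \<in> Q \<Longrightarrow> \<gamma> x (f q) = 0" for x f and Q :: "(nat \<Rightarrow> nat) set"
  proof -
    have z: "\<gamma> x 0 = 0" using add[of x 0 0] by simp
    from that show ?thesis
      by (induction Q rule: infinite_finite_induct) (simp_all add: z add del: zero_fun_apply
          plus_fun_apply)
  qed
  obtain q where q: "q \<in> column_group m T'"
    and nq: "\<gamma> (polytabloid m T) (delta (tabloid m (T' \<circ> q))) \<noteq> 0"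
  proof -
    have "\<exists>q\<in>column_group m T'. \<gamma> (polytabloid m T) (delta (tabloid m (T' \<circ> q))) \<noteq> 0"
    proof (rule ccontr)
      assume "\<not> ?thesis"
      then have "\<gamma> (polytabloid m T) (polytabloid m T') = 0"
        unfolding polytabloid_expand[of m T'] by (intro sum0 scale) blast
      then show False using nz by simp
    qed
    then show ?thesis using that by blast
  qed
  have qp: "q permutes {1..m}" using q by (simp add: column_group_def)
  have T'': "bij_betw (T' \<circ> q) {1..m} \<nu>"
    by (rule bij_betw_trans[OF permutes_imp_bij[OF qp] T'])
  show ?thesis
  proof (rule row_dominance[OF \<mu> T T''])
    fix x x' assume x: "x \<in> {1..m}" "x' \<in> {1..m}" "x \<noteq> x'" "snd (T x) = snd (T x')"
    show "fst ((T' \<circ> q) x) \<noteq> fst ((T' \<circ> q) x')"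
    proof
      assume e: "fst ((T' \<circ> q) x) = fst ((T' \<circ> q) x')"
      let ?r = "tabloid m (T' \<circ> q)" and ?\<tau> = "Transposition.transpose x x'"
      have "?r x = ?r x'" using e x by (simp add: tabloid_def)
      then have "\<gamma> (polytabloid m T) (delta ?r)
          = \<gamma> (tabloid_op ?\<tau> (- polytabloid m T)) (tabloid_op ?\<tau> (delta ?r))"
      proof -
        assume r: "?r x = ?r x'"
        have "tabloid_op ?\<tau> (- polytabloid m T) = - tabloid_op ?\<tau> (polytabloid m T)"
          by (simp add: tabloid_op_def fun_eq_iff)
        then show ?thesis by (simp add: polytabloid_transpose[OF x] tabloid_op_delta[of ?r, OF r])
      qed
      also have "\<dots> = - \<gamma> (polytabloid m T) (delta ?r)"
        by (subst inv[OF permutes_swap_id[OF x(1,2)]]) (rule minus)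
      finally show False using nq by simp
    qed
  qed
qed

text \<open>A nonzero value on two polytabloids would give dominance of the shapes in both
  directions, by exchanging the arguments of \<beta>; the partial row sums then agree and the shapes
  coincide. Polytabloids span, so this settles all vectors.\<close>

theorem specht_form_eq_0:
  fixes \<beta> :: "((nat \<Rightarrow> nat) \<Rightarrow> complex) \<Rightarrow> ((nat \<Rightarrow> nat) \<Rightarrow> complex) \<Rightarrow> complex"
  assumes \<mu>: "young_diagram \<mu>" and \<nu>: "young_diagram \<nu>" and ne: "\<mu> \<noteq> \<nu>"
    and card: "card \<mu> = m" "card \<nu> = m"
    and add: "\<And>x x' y. \<beta> (x + x') y = \<beta> x y + \<beta> x' y" "\<And>x y y'. \<beta> x (y + y') = \<beta> x y + \<beta> x y'"
    and scale: "\<And>c x y. \<beta> (c *\<^sub>C x) y = cnj c * \<beta> x y" "\<And>c x y. \<beta> x (c *\<^sub>C y) = c * \<beta> x y"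
    and inv: "\<And>q x y. q permutes {1..m} \<Longrightarrow> \<beta> (tabloid_op q x) (tabloid_op q y) = \<beta> x y"
    and x: "x \<in> specht \<mu>" and y: "y \<in> specht \<nu>"
  shows "\<beta> x y = 0"
proof -
  have zero: "\<beta> 0 y = 0" "\<beta> x 0 = 0" for x y
    using add(1)[of 0 0 y] add(2)[of x 0 0] by simp_all
  have neg: "- z = (- 1) *\<^sub>C z" for z :: "(nat \<Rightarrow> nat) \<Rightarrow> complex"
    by (simp add: fun_eq_iff scaleC_apply)
  have minus: "\<beta> (- x) y = - \<beta> x y" "\<beta> x (- y) = - \<beta> x y" for x y
    unfolding neg scale by simp_all
  have poly: "\<beta> (polytabloid m T) (polytabloid m T') = 0"
    if T: "bij_betw T {1..m} \<mu>" and T': "bij_betw T' {1..m} \<nu>" for T T'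
  proof (rule ccontr)
    assume nz: "\<beta> (polytabloid m T) (polytabloid m T') \<noteq> 0"
    have "card {b \<in> \<nu>. fst b < j} \<le> card {b \<in> \<mu>. fst b < j}" for j
      by (rule polytabloid_pairing_dominance[OF \<mu> T T', of \<beta>])
        (simp_all add: minus add scale inv nz)
    moreover have "card {b \<in> \<mu>. fst b < j} \<le> card {b \<in> \<nu>. fst b < j}" for j
      by (rule polytabloid_pairing_dominance[OF \<nu> T' T, of "\<lambda>x y. \<beta> y x"])
        (simp_all add: minus add scale inv nz)
    ultimately show False using young_diagram_eqI[OF \<mu> \<nu>] ne by (meson antisym)
  qed
  have px: "\<beta> x (polytabloid m T') = 0" if T': "bij_betw T' {1..m} \<nu>" for T'
    using x unfolding specht_def card
    by (induction rule: cvec.span_induct_alt) (auto simp: zero add scale poly[OF _ T'] simp del: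
        zero_fun_apply plus_fun_apply)
  show ?thesis
    using y unfolding specht_def card
    by (induction rule: cvec.span_induct_alt) (auto simp: zero add scale px simp del:
        zero_fun_apply plus_fun_apply)
qed

section \<open>Operators on tensors and their kernels\<close>

lemma tensors_funs: "tensors n = funs (indices n)"
  by (simp add: tensors_def funs_def)

lemma subspace_tensors: "cvec.subspace (tensors n)"
  unfolding tensors_funs by (rule subspace_funs)

lemma delta_tensors: "j \<in> indices n \<Longrightarrow> delta j \<in> tensors n"
  by (auto simp: tensors_def delta_def)

lemma linear_on_sum:
  assumes f: "linear_on V W f" and V: "cvec.subspace V" and x: "\<And>b. b \<in> B \<Longrightarrow> x b \<in> V"
  shows "f (\<Sum>b\<in>B. c b *\<^sub>C x b) = (\<Sum>b\<in>B. c b *\<^sub>C f (x b))"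
proof -
  have f0: "f 0 = 0"
  proof -
    have "f (0 *\<^sub>C 0) = 0 *\<^sub>C f 0" using f cvec.subspace_0[OF V] unfolding linear_on_def by blast
    then show ?thesis by simp
  qed
  from x show ?thesis
  proof (induction B rule: infinite_finite_induct)
    case (insert b B)
    have "(\<Sum>b\<in>B. c b *\<^sub>C x b) \<in> V" "c b *\<^sub>C x b \<in> V"
      using insert.prems by (auto intro!: cvec.subspace_sum[OF V] cvec.subspace_scale[OF V])
    moreover have "f (c b *\<^sub>C x b) = c b *\<^sub>C f (x b)"
      using f insert.prems unfolding linear_on_def by blast
    ultimately show ?case
      using f insert unfolding linear_on_def by simp
  qed (simp_all add: f0)
qed

text \<open>The operator with matrix \<open>K\<close>, vanishing off the tensors as elements of
  \<open>hom_space\<close> do. Equality and composition of operators thereby become statements about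
  matrices.\<close>

definition kop :: "nat \<Rightarrow> ((nat \<Rightarrow> 'N) \<Rightarrow> (nat \<Rightarrow> 'N) \<Rightarrow> complex) \<Rightarrow> 'N::finite tensor_op" where
  "kop n K = (\<lambda>t. if t \<in> tensors n then
     (\<lambda>i. if i \<in> indices n then \<Sum>j\<in>indices n. K i j * t j else 0) else 0)"

definition kmul :: "nat \<Rightarrow> ((nat \<Rightarrow> 'N::finite) \<Rightarrow> (nat \<Rightarrow> 'N) \<Rightarrow> complex) \<Rightarrow>
    ((nat \<Rightarrow> 'N) \<Rightarrow> (nat \<Rightarrow> 'N) \<Rightarrow> complex) \<Rightarrow> (nat \<Rightarrow> 'N) \<Rightarrow> (nat \<Rightarrow> 'N) \<Rightarrow> complex" where
  "kmul n K L i j = (\<Sum>h\<in>indices n. K i h * L h j)"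

text \<open>The matrix of the tensor power of \<open>g\<close> over the slots \<open>I\<close>;
  other slot sets than \<open>{1..n}\<close> occur when the tensor factors are split into two
  groups.\<close>

definition gker :: "'x set \<Rightarrow> complex ^ 'N ^ 'N::finite \<Rightarrow> ('x \<Rightarrow> 'N) \<Rightarrow> ('x \<Rightarrow> 'N) \<Rightarrow> complex" where
  "gker I g i j = (\<Prod>l\<in>I. g $ i l $ j l)"

definition gcommutes :: "nat \<Rightarrow> ((nat \<Rightarrow> 'N::finite) \<Rightarrow> (nat \<Rightarrow> 'N) \<Rightarrow> complex) \<Rightarrow> bool" where
  "gcommutes n K \<longleftrightarrow> (\<forall>g\<in>orthogonal_group. \<forall>i\<in>indices n. \<forall>j\<in>indices n.
     kmul n K (gker {1..n} g) i j = kmul n (gker {1..n} g) K i j)"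

lemma kop_apply: "t \<in> tensors n \<Longrightarrow> i \<in> indices n \<Longrightarrow> kop n K t i = (\<Sum>j\<in>indices n. K i j * t j)"
  by (simp add: kop_def)

lemma kop_tensors: "kop n K t \<in> tensors n"
  by (auto simp: kop_def tensors_def)

lemma kop_outside: "t \<notin> tensors n \<Longrightarrow> kop n K t = 0"
  by (simp add: kop_def)

lemma tensor_eqI:
  assumes "s \<in> tensors n" "t \<in> tensors n" "\<And>i. i \<in> indices n \<Longrightarrow> s i = t i"
  shows "s = t"
proof
  fix i show "s i = t i" by (cases "i \<in> indices n") (use assms in \<open>simp_all add: tensors_def\<close>)
qed

lemma kop_cong: "(\<And>i j. i \<in> indices n \<Longrightarrow> j \<in> indices n \<Longrightarrow> K i j = L i j) \<Longrightarrow> kop n K = kop n L"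
  by (auto simp: kop_def fun_eq_iff intro!: sum.cong)

lemma kop_delta:
  assumes "i \<in> indices n" "j \<in> indices n" shows "kop n K (delta j) i = K i j"
  using assms
      by (simp add: kop_apply delta_tensors) (simp add: delta_def if_distrib[of "\<lambda>x. _
          * x"] cong: if_cong)

lemma kop_comp: "kop n K \<circ> kop n L = kop n (kmul n K L)"
proof
  fix t :: "'a tensor"
  show "(kop n K \<circ> kop n L) t = kop n (kmul n K L) t"
  proof (cases "t \<in> tensors n")
    case True
    show ?thesis
    proof (rule tensor_eqI[of _ n])
      fix i :: "nat \<Rightarrow> 'a" assume i: "i \<in> indices n"
      have "(kop n K \<circ> kop n L) t i = (\<Sum>h\<in>indices n. \<Sum>j\<in>indices n. K i h * (L h j * t j))"
        using i True by (simp add: kop_apply kop_tensors sum_distrib_left)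
      also have "\<dots> = (\<Sum>j\<in>indices n. \<Sum>h\<in>indices n. K i h * (L h j * t j))" by (rule sum.swap)
      also have "\<dots> = kop n (kmul n K L) t i"
        using i True by (simp add: kop_apply kmul_def sum_distrib_right mult.assoc)
      finally show "(kop n K \<circ> kop n L) t i = kop n (kmul n K L) t i" .
    qed (simp_all add: kop_tensors)
  next
    case False
    then show ?thesis by (auto simp: kop_outside kop_def fun_eq_iff)
  qed
qed

lemma linear_on_kop: "linear_on (tensors n) (tensors n) (kop n K)"
  unfolding linear_on_def
proof (intro conjI allI ballI)
  fix x y :: "'a tensor" and c assume x: "x \<in> tensors n"
  have cx: "c *\<^sub>C x \<in> tensors n" by (rule cvec.subspace_scale[OF subspace_tensors x])
  show "kop n K (c *\<^sub>C x) = c *\<^sub>C kop n K x"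
    by (rule tensor_eqI[of _ n])
      (simp_all add: kop_tensors cvec.subspace_scale[OF subspace_tensors] kop_apply x cx
          scaleC_apply
         sum_distrib_left mult_ac)
  assume y: "y \<in> tensors n"
  have xy: "x + y \<in> tensors n" by (rule cvec.subspace_add[OF subspace_tensors x y])
  show "kop n K (x + y) = kop n K x + kop n K y"
    by (rule tensor_eqI[of _ n])
      (simp_all add: kop_tensors cvec.subspace_add[OF subspace_tensors] kop_apply x y xy
         sum.distrib distrib_left)
qed (auto simp: kop_tensors)

lemma group_op_tensors: "group_op n g t \<in> tensors n"
  by (auto simp: group_op_def tensors_def)

lemma group_op_kop: "t \<in> tensors n \<Longrightarrow> group_op n g t = kop n (gker {1..n} g) t"
  by (simp add: group_op_def kop_def gker_def fun_eq_iff)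

lemma centralizer_kop:
  assumes "F \<in> centralizer n"
  shows "F = kop n (\<lambda>i j. F (delta j) i)"
proof
  fix t :: "'a tensor"
  have lin: "linear_on (tensors n) (tensors n) F" and out: "\<And>t. t \<notin> tensors n \<Longrightarrow> F t = 0"
    using assms by (auto simp: centralizer_def hom_space_def)
  show "F t = kop n (\<lambda>i j. F (delta j) i) t"
  proof (cases "t \<in> tensors n")
    case True
    have "F t = F (\<Sum>j\<in>indices n. t j *\<^sub>C delta j)"
      using funs_expand[of "indices n" t] True by (simp add: tensors_funs)
    also have "\<dots> = (\<Sum>j\<in>indices n. t j *\<^sub>C F (delta j))"
      by (rule linear_on_sum[OF lin subspace_tensors]) (rule delta_tensors)
    finally have Ft: "F t = (\<Sum>j\<in>indices n. t j *\<^sub>C F (delta j))" .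
    have "F t \<in> tensors n" using lin True by (auto simp: linear_on_def)
    then show ?thesis
      by (rule tensor_eqI) (simp_all add: kop_tensors kop_apply True Ft sum_apply scaleC_apply
          mult.commute)
  qed (simp add: out kop_outside)
qed

lemma kop_centralizer_iff: "kop n K \<in> centralizer n \<longleftrightarrow> gcommutes n K"
proof
  assume c: "kop n K \<in> centralizer n"
  show "gcommutes n K"
    unfolding gcommutes_def
  proof (intro ballI)
    fix g :: "complex ^ 'a ^ 'a" and i j :: "nat \<Rightarrow> 'a"
    assume g: "g \<in> orthogonal_group" and ij: "i \<in> indices n" "j \<in> indices n"
    have d: "delta j \<in> tensors n" by (rule delta_tensors[OF ij(2)])
    have "kop n K (group_op n g (delta j)) = group_op n g (kop n K (delta j))"
      using c g d unfolding centralizer_def hom_space_def by blast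
    then have "(kop n K \<circ> kop n (gker {1..n} g)) (delta j) i
        = (kop n (gker {1..n} g) \<circ> kop n K) (delta j) i"
      by (simp add: group_op_kop kop_tensors d)
    then show "kmul n K (gker {1..n} g) i j = kmul n (gker {1..n} g) K i j"
      unfolding kop_comp using ij by (simp add: kop_delta)
  qed
next
  assume c: "gcommutes n K"
  show "kop n K \<in> centralizer n"
    unfolding centralizer_def hom_space_def mem_Collect_eq
  proof (intro conjI allI ballI impI linear_on_kop kop_outside)
    fix g :: "complex ^ 'a ^ 'a" and t :: "'a tensor"
    assume g: "g \<in> orthogonal_group" and t: "t \<in> tensors n"
    have "kop n (kmul n K (gker {1..n} g)) = kop n (kmul n (gker {1..n} g) K)"
      by (rule kop_cong) (use c g in \<open>simp add: gcommutes_def\<close>)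
    then have "kop n K \<circ> kop n (gker {1..n} g) = kop n (gker {1..n} g) \<circ> kop n K"
      by (simp only: kop_comp)
    from fun_cong[OF this, of t] show "kop n K (group_op n g t) = group_op n g (kop n K t)"
      by (simp add: group_op_kop kop_tensors t)
  qed
qed

lemma herm_kop:
  assumes "s \<in> tensors n" "t \<in> tensors n"
  shows "herm (indices n) (kop n K s) t = herm (indices n) s (kop n (\<lambda>i j. cnj (K j i)) t)"
proof -
  have "herm (indices n) (kop n K s) t = (\<Sum>i\<in>indices n. \<Sum>j\<in>indices n. K i j * s j * cnj (t i))"
    using assms(1) by (simp add: herm_def kop_apply sum_distrib_right)
  also have "\<dots> = (\<Sum>j\<in>indices n. \<Sum>i\<in>indices n. K i j * s j * cnj (t i))" by (rule sum.swap)
  also have "\<dots> = herm (indices n) s (kop n (\<lambda>i j. cnj (K j i)) t)"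
    using assms(2) by (simp add: herm_def kop_apply sum_distrib_left mult_ac)
  finally show ?thesis .
qed

text \<open>The conjugate transpose. It stays in the complex orthogonal group because the defining
  equations have real coefficients and transposition exchanges rows and columns.\<close>

definition adj :: "complex ^ 'N ^ 'N::finite \<Rightarrow> complex ^ 'N ^ 'N" where
  "adj g = (\<chi> a b. cnj (g $ b $ a))"

lemma adj_orthogonal: "g \<in> orthogonal_group \<Longrightarrow> adj g \<in> orthogonal_group"
  by (auto simp: orthogonal_group_def orthogonal_matrix_iff adj_def
      simp flip: complex_cnj_mult cnj_sum)

lemma gker_adj: "cnj (gker I g j i) = gker I (adj g) i j"
  by (simp add: gker_def adj_def)

lemma herm_group_op:
  assumes "s \<in> tensors n" "t \<in> tensors n"
  shows "herm (indices n) (group_op n g s) t = herm (indices n) s (group_op n (adj g) t)"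
  by (simp add: group_op_kop assms herm_kop gker_adj)

text \<open>Conjugating and transposing the commutation relation of \<open>K\<close> with
  \<open>adj g\<close> gives the relation of the adjoint matrix with \<open>g\<close>.\<close>

lemma gcommutes_adj:
  assumes "gcommutes n K"
  shows "gcommutes n (\<lambda>i j. cnj (K j i))"
  unfolding gcommutes_def
proof (intro ballI)
  fix g :: "complex ^ 'a ^ 'a" and i j :: "nat \<Rightarrow> 'a"
  assume g: "g \<in> orthogonal_group" and ij: "i \<in> indices n" "j \<in> indices n"
  have gg: "gker {1..n} g a b = cnj (gker {1..n} (adj g) b a)" for a b
    by (simp add: gker_adj) (simp add: adj_def vec_nth_inverse gker_def)
  have "kmul n (\<lambda>i j. cnj (K j i)) (gker {1..n} g) i j = cnj (kmul n (gker {1..n} (adj g)) K j i)"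
    unfolding gg by (simp add: kmul_def mult.commute)
  also have "\<dots> = cnj (kmul n K (gker {1..n} (adj g)) j i)"
    using assms ij adj_orthogonal[OF g] by (simp add: gcommutes_def)
  also have "\<dots> = kmul n (gker {1..n} g) (\<lambda>i j. cnj (K j i)) i j"
    unfolding gg by (simp add: kmul_def mult.commute)
  finally show "kmul n (\<lambda>i j. cnj (K j i)) (gker {1..n} g) i j
      = kmul n (gker {1..n} g) (\<lambda>i j. cnj (K j i)) i j" .
qed

lemma centralizer_adjoint:
  assumes "H \<in> centralizer n"
  shows "\<exists>H'\<in>centralizer n. \<forall>s\<in>tensors n. \<forall>t\<in>tensors n.
    herm (indices n) (H s) t = herm (indices n) s (H' t)"
proof -
  define K where "K i j = H (delta j) i" for i j
  have H: "H = kop n K" unfolding K_def by (rule centralizer_kop[OF assms])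
  then have "gcommutes n K" using assms kop_centralizer_iff by metis
  then have "kop n (\<lambda>i j. cnj (K j i)) \<in> centralizer n"
    by (simp add: kop_centralizer_iff gcommutes_adj)
  then show ?thesis unfolding H by (auto intro!: bexI herm_kop)
qed

text \<open>For real entries the Hermitian adjoint is the transpose, so orthogonal matrices and
  their tensor powers are unitary.\<close>

lemma group_op_real_herm:
  assumes g: "orthogonal_matrix g" "\<forall>a b. g $ a $ b \<in> \<real>" and st: "s \<in> tensors n" "t \<in> tensors n"
  shows "herm (indices n) (group_op n g s) (group_op n g t) = herm (indices n) s t"
proof -
  have adj: "adj g = transpose g"
    using g(2) by (simp add: adj_def transpose_def vec_eq_iff Reals_cnj_iff)
  have "kmul n (gker {1..n} (adj g)) (gker {1..n} g) i j = (if j = i then 1 else 0)"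
    if ij: "i \<in> indices n" "j \<in> indices n" for i j :: "nat \<Rightarrow> 'a"
  proof -
    have "kmul n (gker {1..n} (adj g)) (gker {1..n} g) i j
        = (\<Sum>h\<in>{1..n} \<rightarrow>\<^sub>E UNIV. \<Prod>l\<in>{1..n}. g $ h l $ i l * g $ h l $ j l)"
      unfolding adj by (simp add: kmul_def gker_def indices_def transpose_def prod.distrib)
    also have "\<dots> = (\<Prod>l\<in>{1..n}. \<Sum>a\<in>UNIV. g $ a $ i l * g $ a $ j l)"
      by (rule prod_sum_PiE[symmetric]) auto
    also have "\<dots> = (\<Prod>l\<in>{1..n}. if i l = j l then 1 else 0)"
      using g(1) by (simp add: orthogonal_matrix_iff)
    also have "\<dots> = (if j = i then 1 else 0)"
      using ij by (intro prod_delta_eq) (auto simp: indices_def)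
    finally show ?thesis .
  qed
  then have "kop n (kmul n (gker {1..n} (adj g)) (gker {1..n} g))
      = kop n (\<lambda>i j. if j = i then 1 else 0)"
    by (rule kop_cong)
  note unit = this
  have "group_op n (adj g) (group_op n g t)
      = (kop n (gker {1..n} (adj g)) \<circ> kop n (gker {1..n} g)) t"
    using st by (simp add: group_op_kop kop_tensors)
  also have "\<dots> = kop n (\<lambda>i j. if j = i then 1 else 0) t"
    by (simp only: kop_comp unit)
  also have "\<dots> = t"
    by (rule tensor_eqI[of _ n])
      (simp_all add: kop_tensors st kop_apply if_distrib[of "\<lambda>x. x * _"] cong: if_cong)
  finally show ?thesis by (simp add: herm_group_op st group_op_tensors)
qed

text \<open>The value 0 off the tensors makes this an element of \<open>centralizer n\<close> in the
  sense of \<open>hom_space\<close>.\<close>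

definition tproj :: "nat \<Rightarrow> 'N::finite tensor set \<Rightarrow> 'N tensor_op" where
  "tproj n W t = (if t \<in> tensors n then proj (indices n) W t else 0)"

lemma linear_on_group_op: "linear_on (tensors n) (tensors n) (group_op n g)"
proof -
  have "linear_on (tensors n) (tensors n) (kop n (gker {1..n} g))" by (rule linear_on_kop)
  moreover have "group_op n g t = kop n (gker {1..n} g) t" if "t \<in> tensors n" for t
    by (rule group_op_kop[OF that])
  ultimately show ?thesis
    using cvec.subspace_add[OF subspace_tensors[of n]] cvec.subspace_scale[OF subspace_tensors[of
        n]]
    unfolding linear_on_def by (metis (no_types, lifting) image_cong)
qed

lemma group_op_diff:
  assumes "s \<in> tensors n" "t \<in> tensors n"
  shows "group_op n g (s - t) = group_op n g s - group_op n g t"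
proof -
  have d: "s - t \<in> tensors n" by (rule cvec.subspace_diff[OF subspace_tensors assms])
  have "group_op n g ((s - t) + t) = group_op n g (s - t) + group_op n g t"
    using linear_on_group_op[of n g] d assms(2) unfolding linear_on_def by blast
  then show ?thesis by (simp add: algebra_simps)
qed

lemma proj_group_op:
  assumes W: "cvec.subspace W" "W \<subseteq> tensors n"
    and inv: "\<And>g w. g \<in> G \<Longrightarrow> w \<in> W \<Longrightarrow> group_op n g w \<in> W"
    and G: "\<And>g. g \<in> G \<Longrightarrow> adj g \<in> G" and g: "g \<in> G" and t: "t \<in> tensors n"
  shows "proj (indices n) W (group_op n g t) = group_op n g (proj (indices n) W t)"
proof (rule proj_commute[where X' = "group_op n (adj g)"])
  show "W \<subseteq> funs (indices n)" "t \<in> funs (indices n)" using W t by (simp_all add: tensors_funs)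
  show "group_op n g (s - s') = group_op n g s - group_op n g s'"
    if "s \<in> funs (indices n)" "s' \<in> funs (indices n)" for s s'
    by (rule group_op_diff) (use that in \<open>simp_all add: tensors_funs\<close>)
  show "herm (indices n) (group_op n g s) w = herm (indices n) s (group_op n (adj g) w)"
    if "s \<in> funs (indices n)" "w \<in> W" for s w
    by (rule herm_group_op) (use that W in \<open>auto simp: tensors_funs\<close>)
qed (use W inv G g in auto)

lemma tproj_centralizer:
  assumes W: "cvec.subspace W" "W \<subseteq> tensors n"
    and inv: "\<And>g w. g \<in> orthogonal_group \<Longrightarrow> w \<in> W \<Longrightarrow> group_op n g w \<in> W"
  shows "tproj n W \<in> centralizer n"
  unfolding centralizer_def hom_space_def mem_Collect_eq
proof (intro conjI allI ballI impI)
  have W': "W \<subseteq> funs (indices n)" using W(2) by (simp add: tensors_funs)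
  show "linear_on (tensors n) (tensors n) (tproj n W)"
    using cvec.subspace_add[OF subspace_tensors[of n]] cvec.subspace_scale[OF subspace_tensors[of
        n]]
      proj_in[OF _ W(1) W'] W(2)
    unfolding linear_on_def by (auto simp: tproj_def proj_add proj_scale)
  show "tproj n W (group_op n g t) = group_op n g (tproj n W t)"
    if "g \<in> orthogonal_group" "t \<in> tensors n" for g t
    using proj_group_op[OF W inv adj_orthogonal that] that by (simp add: tproj_def group_op_tensors)
qed (simp add: tproj_def)

text \<open>Together with \<open>H\<close> its adjoint lies in the centralizer and preserves
  \<open>W\<close>, so \<open>proj_commute\<close> applies.\<close>

lemma tproj_central:
  assumes W: "cvec.subspace W" "W \<subseteq> tensors n"
    and inv: "\<And>H w. H \<in> centralizer n \<Longrightarrow> w \<in> W \<Longrightarrow> H w \<in> W"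
    and H: "H \<in> centralizer n"
  shows "tproj n W \<circ> H = H \<circ> tproj n W"
proof
  fix t
  have lin: "linear_on (tensors n) (tensors n) H" and out: "\<And>t. t \<notin> tensors n \<Longrightarrow> H t = 0"
    using H by (auto simp: centralizer_def hom_space_def)
  have H_diff: "H (s - t) = H s - H t" if "s \<in> tensors n" "t \<in> tensors n" for s t
  proof -
    have d: "s - t \<in> tensors n" by (rule cvec.subspace_diff[OF subspace_tensors that])
    have "H ((s - t) + t) = H (s - t) + H t" using lin d that(2) unfolding linear_on_def by blast
    then show ?thesis by (simp add: algebra_simps)
  qed
  obtain H' where H': "H' \<in> centralizer n"
    and adj: "\<And>s t. s \<in> tensors n \<Longrightarrow> t \<in> tensors n \<Longrightarrow>
        herm (indices n) (H s) t = herm (indices n) s (H' t)"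
    using centralizer_adjoint[OF H] by blast
  have H0: "H 0 = 0"
      using H_diff[OF cvec.subspace_0 cvec.subspace_0, OF subspace_tensors subspace_tensors] by simp
  show "(tproj n W \<circ> H) t = (H \<circ> tproj n W) t"
  proof (cases "t \<in> tensors n")
    case True
    have "proj (indices n) W (H t) = H (proj (indices n) W t)"
    proof (rule proj_commute[where X' = H'])
      show "W \<subseteq> funs (indices n)" "t \<in> funs (indices n)" using W True
          by (simp_all add: tensors_funs)
      show "H (s - s') = H s - H s'"
        if "s \<in> funs (indices n)" "s' \<in> funs (indices n)" for s s'
        by (rule H_diff) (use that in \<open>simp_all add: tensors_funs\<close>)
      show "herm (indices n) (H s) w = herm (indices n) s (H' w)"
        if "s \<in> funs (indices n)" "w \<in> W" for s w
        by (rule adj) (use that W in \<open>auto simp: tensors_funs\<close>)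
    qed (use W inv H H' in auto)
    then show ?thesis using True lin by (auto simp: tproj_def linear_on_def)
  next
    case False
    then show ?thesis using H0 by (simp add: tproj_def out proj_zero)
  qed
qed

section \<open>Weyl modules\<close>

text \<open>The matrix of the operator of \<open>bar_diagram n k l\<close>. Its symmetry lets
  multiplication from the left and from the right be computed by the single formula
  \<open>bker_sum\<close>.\<close>

definition bker :: "nat \<Rightarrow> nat \<Rightarrow> nat \<Rightarrow> (nat \<Rightarrow> 'N) \<Rightarrow> (nat \<Rightarrow> 'N) \<Rightarrow> complex" where
  "bker n k l i j = (if i k = i l \<and> j k = j l \<and> (\<forall>m\<in>{1..n} - {k, l}. i m = j m) then 1 else 0)"

lemma bker_sym: "bker n k l i j = bker n k l j i"
  unfolding bker_def by metis

lemma brauer_op_bar_kop: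
  assumes kl: "k \<in> {1..n}" "l \<in> {1..n}" "k \<noteq> l"
  shows "brauer_op n (brauer_basis (bar_diagram n k l)) = kop n (bker n k l)"
proof -
  have "compatible (bar_diagram n k l) i j \<longleftrightarrow>
      i k = i l \<and> j k = j l \<and> (\<forall>m\<in>{1..n}-{k,l}. i m = j m)" for i j :: "nat \<Rightarrow> 'a"
    by (auto simp: compatible_def bar_diagram_def label_def)
  then have "(if compatible (bar_diagram n k l) i j then t j else 0) = bker n k l i j * t j"
    for i j and t :: "'a tensor" by (simp add: bker_def)
  then show ?thesis
    unfolding brauer_op_basis[OF bar_diagram_in_diagrams[OF kl]] diagram_op_def kop_def
    by (simp only:)
qed

lemma indices_upd: "i \<in> indices n \<Longrightarrow> l \<in> {1..n} \<Longrightarrow> i(l := b) \<in> indices n"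
  unfolding indices_def by (rule upd_PiE)

lemma bker_sum:
  fixes i :: "nat \<Rightarrow> 'N::finite"
  assumes kl: "k \<in> {1..n}" "l \<in> {1..n}" "k \<noteq> l" and i: "i \<in> indices n"
  shows "(\<Sum>h\<in>indices n. bker n k l i h * X h)
    = (if i k = i l then \<Sum>a\<in>UNIV. X (i(k := a, l := a)) else 0)"
proof (cases "i k = i l")
  case True
  let ?u = "\<lambda>a. i(k := a, l := a)"
  have u: "?u a \<in> indices n" for a using indices_upd i kl by metis
  have "(\<Sum>h\<in>indices n. bker n k l i h * X h) = (\<Sum>h\<in>range ?u. bker n k l i h * X h)"
  proof (rule sum.mono_neutral_right)
    show "\<forall>h\<in>indices n - range ?u. bker n k l i h * X h = 0"
    proof
      fix h assume h: "h \<in> indices n - range ?u"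
      have "\<not> (h k = h l \<and> (\<forall>m\<in>{1..n} - {k, l}. i m = h m))"
      proof
        assume a: "h k = h l \<and> (\<forall>m\<in>{1..n} - {k, l}. i m = h m)"
        have "h = ?u (h k)"
          by (rule PiE_ext[of h "{1..n}" "\<lambda>_. UNIV"]) (use h u[of "h k"] a
              in \<open>auto simp: indices_def\<close>)
        then show False using h by blast
      qed
      then show "bker n k l i h * X h = 0" by (auto simp: bker_def)
    qed
  qed (use u in auto)
  also have "\<dots> = (\<Sum>a\<in>UNIV. bker n k l i (?u a) * X (?u a))"
    by (subst sum.reindex) (use kl in \<open>auto intro!: inj_onI dest: fun_cong[of _ _ l]\<close>)
  also have "\<dots> = (\<Sum>a\<in>UNIV. X (?u a))"
    by (intro sum.cong refl) (use True kl in \<open>simp add: bker_def\<close>)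
  finally show ?thesis using True by simp
qed (simp add: bker_def)

lemma gker_pair:
  assumes "finite I" "k \<in> I" "l \<in> I" "k \<noteq> l"
  shows "gker I g i j = g $ i k $ j k * g $ i l $ j l * gker (I - {k, l}) g i j"
proof -
  have "gker I g i j = gker (insert k (insert l (I - {k, l}))) g i j"
    using assms by (intro arg_cong[of _ _ "\<lambda>I. gker I g i j"]) auto
  then show ?thesis using assms by (simp add: gker_def mult.assoc)
qed

lemma gker_upd: "l \<notin> I \<Longrightarrow> gker I g (i(l := b)) j = gker I g i j"
  and gker_upd': "l \<notin> I \<Longrightarrow> gker I g i (j(l := b)) = gker I g i j"
  unfolding gker_def by (auto intro!: prod.cong)

text \<open>Orthonormality of the columns evaluates one product and orthonormality of the rows the
  other. Both give the action of \<open>g\<close> on the slots other than \<open>k\<close>,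
  \<open>l\<close>, under the conditions \<open>i k = i l\<close> and
  \<open>j k = j l\<close>.\<close>

lemma gcommutes_bker:
  assumes kl: "k \<in> {1..n}" "l \<in> {1..n}" "k \<noteq> l"
  shows "gcommutes n (bker n k l :: (nat \<Rightarrow> 'N::finite) \<Rightarrow> _)"
  unfolding gcommutes_def
proof (intro ballI)
  fix g :: "complex ^ 'N ^ 'N" and i j :: "nat \<Rightarrow> 'N"
  assume g: "g \<in> orthogonal_group" and ij: "i \<in> indices n" "j \<in> indices n"
  have orth: "(\<Sum>c\<in>UNIV. g $ c $ a * g $ c $ b) = (if a = b then 1 else 0)"
    "(\<Sum>c\<in>UNIV. g $ a $ c * g $ b $ c) = (if a = b then 1 else 0)" for a b
    using g by (auto simp: orthogonal_group_def orthogonal_matrix_iff)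
  let ?r = "gker ({1..n} - {k, l}) g i j"
  have left: "gker {1..n} g (i(k := a, l := a)) j = g $ a $ j k * g $ a $ j l * ?r" for a
    using kl by (subst gker_pair[OF _ kl]) (simp_all add: gker_upd)
  have right: "gker {1..n} g i (j(k := a, l := a)) = g $ i k $ a * g $ i l $ a * ?r" for a
    using kl by (subst gker_pair[OF _ kl]) (simp_all add: gker_upd')
  have "kmul n (bker n k l) (gker {1..n} g) i j
      = (if i k = i l then \<Sum>a\<in>UNIV. gker {1..n} g (i(k := a, l := a)) j else 0)"
    unfolding kmul_def by (rule bker_sum[OF kl ij(1)])
  also have "\<dots> = (if i k = i l then (\<Sum>a\<in>UNIV. g $ a $ j k * g $ a $ j l) * ?r else 0)"
    unfolding left by (simp only: sum_distrib_right)
  also have "\<dots> = (if j k = j l then (\<Sum>a\<in>UNIV. g $ i k $ a * g $ i l $ a) * ?r else 0)"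
    by (simp add: orth)
  also have "\<dots> = (if j k = j l then \<Sum>a\<in>UNIV. gker {1..n} g i (j(k := a, l := a)) else 0)"
    unfolding right by (simp only: sum_distrib_right)
  also have "\<dots> = (\<Sum>h\<in>indices n. bker n k l j h * gker {1..n} g i h)"
    by (rule bker_sum[OF kl ij(2), symmetric])
  also have "\<dots> = kmul n (gker {1..n} g) (bker n k l) i j"
    unfolding kmul_def by (simp add: bker_sym[of n k l j] mult.commute)
  finally show "kmul n (bker n k l) (gker {1..n} g) i j = kmul n (gker {1..n} g) (bker n k l) i j" .
qed

lemma kop_bker_centralizer:
  "k \<in> {1..n} \<Longrightarrow> l \<in> {1..n} \<Longrightarrow> k \<noteq> l \<Longrightarrow> kop n (bker n k l) \<in> centralizer n"
  unfolding kop_centralizer_iff by (rule gcommutes_bker)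

lemma traceless_iff:
  fixes t :: "'N::finite tensor"
  shows "t \<in> traceless m \<longleftrightarrow> t \<in> tensors m \<and> (\<forall>i\<in>indices m. \<forall>k\<in>{1..m}. \<forall>l\<in>{1..m}. k \<noteq> l \<longrightarrow>
     (\<Sum>a\<in>UNIV. t (i(k := a, l := a))) = 0)"
proof -
  have "kop m (bker m k l) t = 0 \<longleftrightarrow> (\<forall>i\<in>indices m. (\<Sum>a\<in>UNIV. t (i(k := a, l := a))) = 0)"
    if t: "t \<in> tensors m" and kl: "k \<in> {1..m}" "l \<in> {1..m}" "k \<noteq> l" for k l
  proof -
    have e: "kop m (bker m k l) t i = (if i k = i l then \<Sum>a\<in>UNIV. t (i(k := a, l := a)) else 0)"
      if "i \<in> indices m" for i :: "nat \<Rightarrow> 'N"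
      using that by (simp add: kop_apply t bker_sum[OF kl])
    show ?thesis
    proof
      assume z: "kop m (bker m k l) t = 0"
      show "\<forall>i\<in>indices m. (\<Sum>a\<in>UNIV. t (i(k := a, l := a))) = 0"
      proof
        fix i :: "nat \<Rightarrow> 'N" assume i: "i \<in> indices m"
        \<comment> \<open>The operator sees only indices with equal entries at \<open>k\<close> and
          \<open>l\<close>. As the trace overwrites both entries, \<open>i\<close> may be replaced
          by such an index.\<close>
        define i' where "i' = i(k := i k, l := i k)"
        have i': "i' \<in> indices m" unfolding i'_def using indices_upd i kl by metis
        have "i' k = i' l" using kl by (simp add: i'_def)
        then have "(\<Sum>a\<in>UNIV. t (i'(k := a, l := a))) = 0"
          using e[OF i'] by (simp add: z)
        moreover have "i'(k := a, l := a) = i(k := a, l := a)" for a by (auto simp: i'_def)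
        ultimately show "(\<Sum>a\<in>UNIV. t (i(k := a, l := a))) = 0" by simp
      qed
    next
      assume "\<forall>i\<in>indices m. (\<Sum>a\<in>UNIV. t (i(k := a, l := a))) = 0"
      then show "kop m (bker m k l) t = 0"
        by (intro tensor_eqI[OF kop_tensors cvec.subspace_0[OF subspace_tensors]]) (simp add: e)
    qed
  qed
  then show ?thesis by (auto simp: traceless_def brauer_op_bar_kop)
qed

lemma traceless_tensors: "traceless m \<subseteq> tensors m"
  by (auto simp: traceless_def)

lemma subspace_traceless: "cvec.subspace (traceless m)"
proof (rule cvec.subspaceI)
  show "0 \<in> traceless m"
    using cvec.subspace_0[OF subspace_tensors] by (simp add: traceless_iff)
  show "x + y \<in> traceless m" if "x \<in> traceless m" "y \<in> traceless m" for x y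
    using that cvec.subspace_add[OF subspace_tensors] unfolding traceless_iff
    by (auto simp: sum.distrib)
  show "c *\<^sub>C x \<in> traceless m" if "x \<in> traceless m" for c x
    using that cvec.subspace_scale[OF subspace_tensors] unfolding traceless_iff
    by (auto simp: scaleC_apply sum_distrib_left[symmetric])
qed

lemma traceless_group_op:
  assumes "g \<in> orthogonal_group" "t \<in> traceless m"
  shows "group_op m g t \<in> traceless m"
  unfolding traceless_def
proof (intro CollectI conjI ballI impI group_op_tensors)
  fix k l assume kl: "k \<in> {1..m}" "l \<in> {1..m}" "k \<noteq> l"
  have t: "t \<in> tensors m" using assms(2) traceless_tensors by blast
  have "kop m (bker m k l) (group_op m g t) = group_op m g (kop m (bker m k l) t)"
    using kop_bker_centralizer[OF kl] assms(1) t unfolding centralizer_def hom_space_def by blast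
  also have "kop m (bker m k l) t = 0"
    using assms(2) kl by (simp add: traceless_def brauer_op_bar_kop)
  also have "group_op m g (0 :: 'a tensor) = 0"
    by (simp add: group_op_def fun_eq_iff)
  finally show "brauer_op m (brauer_basis (bar_diagram m k l)) (group_op m g t) = 0"
    by (simp add: brauer_op_bar_kop[OF kl])
qed

text \<open>Permuting tensor factors and permuting the entries of tabloids are the same operation on
  functions; both are unitary for the respective Hermitian form.\<close>

definition pact :: "('x \<Rightarrow> 'x) \<Rightarrow> (('x \<Rightarrow> 'b) \<Rightarrow> complex) \<Rightarrow> ('x \<Rightarrow> 'b) \<Rightarrow> complex" where
  "pact p f = (\<lambda>i. f (i \<circ> p))"

lemma tabloid_op_pact: "tabloid_op = pact"
  by (simp add: fun_eq_iff tabloid_op_def pact_def)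

lemma pact_comp: "pact p (pact q f) = pact (p \<circ> q) f"
  by (simp add: pact_def comp_assoc)

lemma pact_id: "pact id f = f"
  by (simp add: pact_def)

lemma pact_add: "pact p (f + g) = pact p f + pact p g"
  and pact_diff: "pact p (f - g) = pact p f - pact p g"
  and pact_scale: "pact p (c *\<^sub>C f) = c *\<^sub>C pact p f"
  and pact_sum: "pact p (\<Sum>b\<in>B. h b) = (\<Sum>b\<in>B. pact p (h b))"
  by (simp_all add: fun_eq_iff pact_def scaleC_apply sum_apply)

lemma herm_pact:
  assumes p: "p permutes S" and A: "\<And>i. i \<in> A \<Longrightarrow> i \<circ> p \<in> A" "\<And>i. i \<in> A \<Longrightarrow> i \<circ> inv p \<in> A"
  shows "herm A (pact p s) t = herm A s (pact (inv p) t)"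
  unfolding herm_def
  by (rule sum.reindex_bij_witness[where i = "\<lambda>i. i \<circ> inv p" and j = "\<lambda>i. i \<circ> p"])
    (use A in \<open>auto simp: pact_def comp_assoc permutes_inv_o[OF p]\<close>)

lemma indices_perm:
  assumes "p permutes {1..m}"
  shows "i \<in> indices m \<Longrightarrow> i \<circ> p \<in> indices m"
  using permutes_not_in[OF assms] permutes_in_image[OF assms]
  by (auto simp: indices_def PiE_iff extensional_def)

lemma indices_perm_iff:
  assumes p: "p permutes {1..m}"
  shows "i \<circ> p \<in> indices m \<longleftrightarrow> i \<in> indices m"
  using indices_perm[OF p, of i] indices_perm[OF permutes_inv[OF p], of "i \<circ> p"]
  by (auto simp: comp_assoc permutes_inv_o[OF p])

lemma pact_tensors: "p permutes {1..m} \<Longrightarrow> t \<in> tensors m \<Longrightarrow> pact p t \<in> tensors m"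
  by (simp add: tensors_def pact_def indices_perm_iff)

lemma brauer_op_perm_pact:
  assumes p: "p permutes {1..m}" and t: "t \<in> tensors m"
  shows "brauer_op m (brauer_basis (perm_diagram m p)) t = pact p t"
proof (rule tensor_eqI[of _ m])
  show "brauer_op m (brauer_basis (perm_diagram m p)) t \<in> tensors m"
    by (auto simp: brauer_op_basis[OF perm_diagram_in_diagrams[OF p]] diagram_op_def tensors_def)
  show "pact p t \<in> tensors m" by (rule pact_tensors[OF p t])
qed (simp add: brauer_op_perm[OF p t] pact_def)

lemma herm_pact_tensors:
  assumes "p permutes {1..m}"
  shows "herm (indices m) (pact p s) t = herm (indices m) s (pact (inv p) t)"
  by (rule herm_pact[OF assms]) (intro indices_perm assms permutes_inv | assumption)+

lemma upd_comp_perm: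
  assumes "p permutes S"
  shows "i(k := a) \<circ> p = (i \<circ> p)(inv p k := a)"
  using permutes_inverses[OF assms] by (auto simp: fun_eq_iff)

lemma traceless_pact:
  assumes p: "p permutes {1..m}" and t: "t \<in> traceless m"
  shows "pact p t \<in> traceless m"
proof -
  have "(\<Sum>a\<in>UNIV. t ((i \<circ> p)(inv p k := a, inv p l := a))) = 0"
    if "i \<in> indices m" "k \<in> {1..m}" "l \<in> {1..m}" "k \<noteq> l" for i k l
  proof -
    have "inv p k \<noteq> inv p l" using that(4) permutes_inverses[OF p] by metis
    moreover have "inv p k \<in> {1..m}" "inv p l \<in> {1..m}"
      using that permutes_in_image[OF permutes_inv[OF p]] by metis+
    ultimately show ?thesis using t indices_perm[OF p that(1)] unfolding traceless_iff by blast
  qed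
  then show ?thesis
    using t pact_tensors[OF p] unfolding traceless_iff
    by (auto simp: pact_def upd_comp_perm[OF p])
qed

lemma group_op_pact:
  assumes p: "p permutes {1..m}" and t: "t \<in> tensors m"
  shows "group_op m g (pact p t) = pact p (group_op m g t)"
proof (rule tensor_eqI[OF group_op_tensors pact_tensors[OF p group_op_tensors]])
  fix i :: "nat \<Rightarrow> 'a" assume i: "i \<in> indices m"
  have "group_op m g (pact p t) i = (\<Sum>j\<in>indices m. (\<Prod>l\<in>{1..m}. g $ i l $ j l) * t (j \<circ> p))"
    using i by (simp add: group_op_def pact_def)
  also have "\<dots> = (\<Sum>j\<in>indices m. (\<Prod>l\<in>{1..m}. g $ i (p l) $ j l) * t j)"
  proof (rule sum.reindex_bij_witness[where i = "\<lambda>i. i \<circ> inv p" and j = "\<lambda>i. i \<circ> p"])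
    fix j :: "nat \<Rightarrow> 'a"
    have "(\<Prod>l\<in>{1..m}. g $ i l $ j l) = (\<Prod>l\<in>{1..m}. g $ i (p l) $ (j \<circ> p) l)"
      by (subst prod.permute[OF p]) (simp add: comp_def)
    then show "(\<Prod>l\<in>{1..m}. g $ i (p l) $ (j \<circ> p) l) * t (j \<circ> p)
        = (\<Prod>l\<in>{1..m}. g $ i l $ j l) * t (j \<circ> p)"
      by (simp only:)
  qed (auto simp: comp_assoc permutes_inv_o[OF p] intro: indices_perm[OF p] indices_perm[OF
      permutes_inv[OF p]])
  also have "\<dots> = pact p (group_op m g t) i"
    using indices_perm[OF p i] by (simp add: pact_def group_op_def)
  finally show "group_op m g (pact p t) i = pact p (group_op m g t) i" .
qed

text \<open>A finite set that supports the Specht module and is stable under permutations, so that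
  the Specht module inherits an invariant Hermitian form.\<close>

definition tabloids :: "young \<Rightarrow> (nat \<Rightarrow> nat) set" where
  "tabloids \<mu> = tabloid (card \<mu>) ` {T. bij_betw T {1..card \<mu>} \<mu>}"

lemma finite_tabloids: "finite \<mu> \<Longrightarrow> finite (tabloids \<mu>)"
proof (rule finite_subset)
  let ?f = "\<lambda>h x. if x \<in> {1..card \<mu>} then h x else (0::nat)"
  show "tabloids \<mu> \<subseteq> ?f ` ({1..card \<mu>} \<rightarrow>\<^sub>E fst ` \<mu>)"
  proof
    fix r assume "r \<in> tabloids \<mu>"
    then obtain T where T: "bij_betw T {1..card \<mu>} \<mu>" "r = tabloid (card \<mu>) T"
      by (auto simp: tabloids_def)
    then have "r = ?f (restrict (\<lambda>x. fst (T x)) {1..card \<mu>})"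
      by (auto simp: tabloid_def fun_eq_iff)
    moreover have "restrict (\<lambda>x. fst (T x)) {1..card \<mu>} \<in> {1..card \<mu>} \<rightarrow>\<^sub>E fst ` \<mu>"
      using T(1) by (auto simp: bij_betw_def)
    ultimately show "r \<in> ?f ` ({1..card \<mu>} \<rightarrow>\<^sub>E fst ` \<mu>)" by blast
  qed
  show "finite \<mu> \<Longrightarrow> finite (?f ` ({1..card \<mu>} \<rightarrow>\<^sub>E fst ` \<mu>))"
    by (intro finite_imageI finite_PiE) auto
qed

lemma tabloids_perm:
  assumes "p permutes {1..card \<mu>}" "r \<in> tabloids \<mu>"
  shows "r \<circ> p \<in> tabloids \<mu>"
proof -
  obtain T where T: "bij_betw T {1..card \<mu>} \<mu>" "r = tabloid (card \<mu>) T"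
    using assms(2) by (auto simp: tabloids_def)
  have "bij_betw (T \<circ> p) {1..card \<mu>} \<mu>"
    by (rule bij_betw_trans[OF permutes_imp_bij[OF assms(1)] T(1)])
  then show ?thesis unfolding T(2) tabloid_comp[OF assms(1), symmetric] by (auto simp: tabloids_def)
qed

lemma herm_pact_tabloids:
  assumes "p permutes {1..card \<mu>}"
  shows "herm (tabloids \<mu>) (pact p s) t = herm (tabloids \<mu>) s (pact (inv p) t)"
  by (rule herm_pact[OF assms]) (intro tabloids_perm assms permutes_inv | assumption)+

lemma subspace_specht: "cvec.subspace (specht \<mu>)"
  unfolding specht_def by (rule cvec.subspace_span)

lemma specht_funs: "specht \<mu> \<subseteq> funs (tabloids \<mu>)"
  unfolding specht_def
proof (rule cvec.span_minimal[OF _ subspace_funs], rule image_subsetI)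
  fix T assume T: "T \<in> {T. bij_betw T {1..card \<mu>} \<mu>}"
  have "tabloid (card \<mu>) (T \<circ> q) \<in> tabloids \<mu>" if "q \<in> column_group (card \<mu>) T" for q
  proof -
    have "bij_betw (T \<circ> q) {1..card \<mu>} \<mu>"
      using that T by (intro bij_betw_trans[OF permutes_imp_bij]) (auto simp: column_group_def)
    then show ?thesis by (auto simp: tabloids_def)
  qed
  then show "polytabloid (card \<mu>) T \<in> funs (tabloids \<mu>)"
    unfolding funs_def polytabloid_def by (auto intro!: sum.neutral)
qed

text \<open>Conjugation by \<open>p\<close> carries the column group of \<open>T\<close> to that of
  \<open>T \<circ> inv p\<close> and preserves signs.\<close>

lemma pact_polytabloid:
  assumes p: "p permutes {1..m}"
  shows "pact p (polytabloid m T) = polytabloid m (T \<circ> inv p)"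
proof
  fix r
  let ?C = "column_group m T" and ?D = "column_group m (T \<circ> inv p)"
  note ip = permutes_inv[OF p] and inv = permutes_inv_o[OF p]
  have perm: "permutation q" if "q permutes {1..m}" for q :: "nat \<Rightarrow> nat"
    using permutes_imp_permutation[OF _ that] by simp
  have "pact p (polytabloid m T) r
      = (\<Sum>q\<in>?C. if r \<circ> p = tabloid m (T \<circ> q) then of_int (sign q) else 0)"
    by (simp add: pact_def polytabloid_def)
  also have "\<dots> = (\<Sum>q\<in>?D. if r = tabloid m (T \<circ> inv p \<circ> q) then of_int (sign q) else 0)"
  proof (rule sum.reindex_bij_witness[where i = "\<lambda>q. inv p \<circ> q \<circ> p" and j = "\<lambda>q. p \<circ> q \<circ> inv p"])
    fix q assume q: "q \<in> ?C"
    then have qp: "q permutes {1..m}" by (simp add: column_group_def)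
    show "inv p \<circ> (p \<circ> q \<circ> inv p) \<circ> p = q"
      using inv by (simp add: comp_assoc[symmetric]) (simp add: comp_assoc)
    have "p \<circ> q \<circ> inv p permutes {1..m}"
      by (intro permutes_compose p ip qp)
    moreover have "snd ((T \<circ> inv p) ((p \<circ> q \<circ> inv p) x)) = snd ((T \<circ> inv p) x)" if "x \<in> {1..m}"
        for x
    proof -
      have "inv p x \<in> {1..m}" using that permutes_in_image[OF ip] by blast
      then show ?thesis using q by (simp add: column_group_def permutes_inverses[OF p])
    qed
    ultimately show "p \<circ> q \<circ> inv p \<in> ?D" by (simp add: column_group_def)
    have "tabloid m (T \<circ> inv p \<circ> (p \<circ> q \<circ> inv p)) = tabloid m (T \<circ> q \<circ> inv p)"
    proof -
      have "T \<circ> inv p \<circ> (p \<circ> q \<circ> inv p) = T \<circ> (inv p \<circ> p) \<circ> q \<circ> inv p" by (simp only: comp_assoc)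
      then show ?thesis using inv by simp
    qed
    also have "\<dots> = tabloid m (T \<circ> q) \<circ> inv p" by (rule tabloid_comp[OF ip])
    finally have "r = tabloid m (T \<circ> inv p \<circ> (p \<circ> q \<circ> inv p)) \<longleftrightarrow> r \<circ> p = tabloid m (T \<circ> q)"
      using inv by (metis comp_assoc comp_id)
    moreover have "sign (p \<circ> q \<circ> inv p) = sign q"
      using perm[OF p] perm[OF qp] perm[OF ip]
      by (simp add: sign_compose permutation_compose sign_inverse sign_idempotent)
    ultimately show "(if r
        = tabloid m (T \<circ> inv p \<circ> (p \<circ> q \<circ> inv p)) then of_int (sign (p \<circ> q \<circ> inv p)) else 0)
        = (if r \<circ> p = tabloid m (T \<circ> q) then of_int (sign q) else (0 :: complex))"
      by simp
  next
    fix q assume q: "q \<in> ?D"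
    then have qp: "q permutes {1..m}" by (simp add: column_group_def)
    show "p \<circ> (inv p \<circ> q \<circ> p) \<circ> inv p = q"
      using inv by (simp add: comp_assoc[symmetric]) (simp add: comp_assoc)
    have "inv p \<circ> q \<circ> p permutes {1..m}"
      by (intro permutes_compose p ip qp)
    moreover have "snd (T ((inv p \<circ> q \<circ> p) x)) = snd (T x)" if "x \<in> {1..m}" for x
    proof -
      have "p x \<in> {1..m}" using that permutes_in_image[OF p] by blast
      then show ?thesis using q by (simp add: column_group_def permutes_inverses[OF p])
    qed
    ultimately show "inv p \<circ> q \<circ> p \<in> ?C" by (simp add: column_group_def)
  qed
  also have "\<dots> = polytabloid m (T \<circ> inv p) r" by (simp add: polytabloid_def)
  finally show "pact p (polytabloid m T) r = polytabloid m (T \<circ> inv p) r" .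
qed

lemma specht_pact:
  assumes p: "p permutes {1..card \<mu>}" and x: "x \<in> specht \<mu>"
  shows "pact p x \<in> specht \<mu>"
proof -
  have "pact p (polytabloid (card \<mu>) T) \<in> specht \<mu>" if "bij_betw T {1..card \<mu>} \<mu>" for T
  proof -
    have "bij_betw (T \<circ> inv p) {1..card \<mu>} \<mu>"
      by (rule bij_betw_trans[OF permutes_imp_bij[OF permutes_inv[OF p]] that])
    then show ?thesis unfolding pact_polytabloid[OF p] specht_def by (auto intro: cvec.span_base)
  qed
  moreover have "cvec.subspace {x. pact p x \<in> specht \<mu>}"
    using subspace_specht[of \<mu>] unfolding cvec.subspace_def
    by (simp add: pact_add pact_scale) (simp add: pact_def zero_fun_def)
  ultimately have "specht \<mu> \<subseteq> {x. pact p x \<in> specht \<mu>}"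
    by (subst specht_def, intro cvec.span_minimal) auto
  then show ?thesis using x by blast
qed

lemma subspace_hom_space:
  assumes W: "cvec.subspace W"
    and \<sigma>: "\<And>a x y. a \<in> A \<Longrightarrow> x \<in> W \<Longrightarrow> y \<in> W \<Longrightarrow> \<sigma> a (x + y) = \<sigma> a x + \<sigma> a y"
      "\<And>a c x. a \<in> A \<Longrightarrow> x \<in> W \<Longrightarrow> \<sigma> a (c *\<^sub>C x) = c *\<^sub>C \<sigma> a x"
  shows "cvec.subspace (hom_space A V \<rho> W \<sigma>)"
proof (rule cvec.subspaceI)
  have \<sigma>0: "\<sigma> a 0 = 0" if "a \<in> A" for a
    using \<sigma>(2)[OF that cvec.subspace_0[OF W], of 0] by simp
  show "0 \<in> hom_space A V \<rho> W \<sigma>"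
    using cvec.subspace_0[OF W] \<sigma>0 by (auto simp: hom_space_def linear_on_def)
next
  fix f g assume f: "f \<in> hom_space A V \<rho> W \<sigma>" and g: "g \<in> hom_space A V \<rho> W \<sigma>"
  have "f x \<in> W" "g x \<in> W" if "x \<in> V" for x
    using f g that by (auto simp: hom_space_def linear_on_def)
  then show "f + g \<in> hom_space A V \<rho> W \<sigma>"
    using f g cvec.subspace_add[OF W]
    by (auto simp: hom_space_def linear_on_def \<sigma> cvec.scale_right_distrib)
next
  fix c f assume f: "f \<in> hom_space A V \<rho> W \<sigma>"
  have "f x \<in> W" if "x \<in> V" for x
    using f that by (auto simp: hom_space_def linear_on_def)
  then show "c *\<^sub>C f \<in> hom_space A V \<rho> W \<sigma>"
    using f cvec.subspace_scale[OF W]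
    by (auto simp: hom_space_def linear_on_def \<sigma> scaleC_fun_def cvec.scale_right_distrib
        mult.commute)
qed

lemma subspace_weyl: "cvec.subspace (weyl_module \<mu>)"
proof -
  have "brauer_op m (brauer_basis (perm_diagram m p)) t = pact p t"
    if "p permutes {1..m}" "t \<in> traceless m" for m p and t :: "'a tensor"
    using brauer_op_perm_pact that traceless_tensors by blast
  then show ?thesis
    unfolding weyl_module_def
    by (intro subspace_hom_space subspace_traceless)
      (auto simp: pact_add pact_scale cvec.subspace_add[OF subspace_traceless]
        cvec.subspace_scale[OF subspace_traceless])
qed

lemma weyl_module_iff:
  "\<phi> \<in> weyl_module \<mu> \<longleftrightarrow> linear_on (specht \<mu>) (traceless (card \<mu>)) \<phi> \<and> (\<forall>x. x \<notin> specht \<mu> \<longrightarrow> \<phi> x = 0) \<and>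
     (\<forall>p x. p permutes {1..card \<mu>} \<longrightarrow> x \<in> specht \<mu> \<longrightarrow> \<phi> (pact p x) = pact p (\<phi> x))"
proof -
  have "\<phi> x \<in> tensors (card \<mu>)" if "linear_on (specht \<mu>) (traceless (card \<mu>)) \<phi>" "x \<in> specht \<mu>"
      for x
    using that traceless_tensors by (auto simp: linear_on_def)
  then show ?thesis
    by (auto simp: weyl_module_def hom_space_def tabloid_op_pact brauer_op_perm_pact)
qed

text \<open>The sum over all permutations of the conjugates of the rank-one map sending
  \<open>z\<close> to the inner product of \<open>z\<close> with \<open>x\<close> times
  \<open>t\<close>. It is conjugate-linear in \<open>x\<close> and linear in \<open>t\<close>, and
  provides explicit elements of the Weyl module.\<close>

definition sym_hom ::
  "young \<Rightarrow> ((nat \<Rightarrow> nat) \<Rightarrow> complex) \<Rightarrow> 'N::finite tensor \<Rightarrow> ((nat \<Rightarrow> nat) \<Rightarrow> complex) \<Rightarrow> 'N tensor" where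
  "sym_hom \<mu> x t = (\<lambda>z. if z \<in> specht \<mu> then
     \<Sum>p\<in>{p. p permutes {1..card \<mu>}}. herm (tabloids \<mu>) z (pact p x) *\<^sub>C pact p t else 0)"

lemma scaleC_fun_apply: "(c *\<^sub>C f) z = c *\<^sub>C f z"
  by (simp add: scaleC_fun_def)

lemma sym_hom_add_left: "sym_hom \<mu> (x + y) t = sym_hom \<mu> x t + sym_hom \<mu> y t"
  by (rule ext) (simp add: sym_hom_def pact_add herm_add_right cvec.scale_left_distrib sum.distrib)

lemma sym_hom_scale_left: "sym_hom \<mu> (c *\<^sub>C x) t = cnj c *\<^sub>C sym_hom \<mu> x t"
  by (rule ext, subst scaleC_fun_apply) (simp add: sym_hom_def pact_scale herm_scale_right
      cvec.scale_sum_right)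

lemma sym_hom_add_right: "sym_hom \<mu> x (t + t') = sym_hom \<mu> x t + sym_hom \<mu> x t'"
  by (rule ext) (simp add: sym_hom_def pact_add cvec.scale_right_distrib sum.distrib)

lemma sym_hom_scale_right: "sym_hom \<mu> x (c *\<^sub>C t) = c *\<^sub>C sym_hom \<mu> x t"
  by (rule ext, subst scaleC_fun_apply)
    (simp add: sym_hom_def pact_scale cvec.scale_sum_right mult.commute)

lemma sym_hom_pact:
  assumes q: "q permutes {1..card \<mu>}"
  shows "sym_hom \<mu> x (pact q t) = sym_hom \<mu> (pact (inv q) x) t"
proof
  fix z
  have "(\<Sum>p\<in>{p. p permutes {1..card \<mu>}}. herm (tabloids \<mu>) z (pact p x) *\<^sub>C pact p (pact q t))
      = (\<Sum>p\<in>{p. p permutes {1..card \<mu>}}. herm (tabloids \<mu>) z (pact p (pact (inv q) x)) *\<^sub>C pact p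
          t)"
    by (rule sum.reindex_bij_witness[where i = "\<lambda>p. p \<circ> inv q" and j = "\<lambda>p. p \<circ> q"])
      (use q in \<open>auto simp: pact_comp comp_assoc permutes_inv_o permutes_compose permutes_inv\<close>)
  then show "sym_hom \<mu> x (pact q t) z = sym_hom \<mu> (pact (inv q) x) t z"
    by (simp add: sym_hom_def)
qed

text \<open>Translating the summation variable by \<open>q\<close> gives equivariance, as
  permutations are unitary on tabloids; they also preserve tracelessness.\<close>

lemma sym_hom_weyl:
  assumes t: "t \<in> traceless (card \<mu>)"
  shows "sym_hom \<mu> x t \<in> weyl_module \<mu>"
  unfolding weyl_module_iff
proof (intro conjI allI impI)
  let ?P = "{p. p permutes {1..card \<mu>}}"
  have T: "sym_hom \<mu> x t z \<in> traceless (card \<mu>)" for z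
    unfolding sym_hom_def
    by (auto intro!: cvec.subspace_sum[OF subspace_traceless] cvec.subspace_scale[OF
        subspace_traceless]
        cvec.subspace_0[OF subspace_traceless] traceless_pact t)
  show "linear_on (specht \<mu>) (traceless (card \<mu>)) (sym_hom \<mu> x t)"
    unfolding linear_on_def
  proof (intro conjI ballI allI)
    show "sym_hom \<mu> x t ` specht \<mu> \<subseteq> traceless (card \<mu>)" using T by auto
    show "sym_hom \<mu> x t (y + z) = sym_hom \<mu> x t y + sym_hom \<mu> x t z"
      if "y \<in> specht \<mu>" "z \<in> specht \<mu>" for y z
      using that cvec.subspace_add[OF subspace_specht that]
      by (simp add: sym_hom_def herm_add_left cvec.scale_left_distrib sum.distrib)
    show "sym_hom \<mu> x t (c *\<^sub>C z) = c *\<^sub>C sym_hom \<mu> x t z" if "z \<in> specht \<mu>" for c z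
      using that cvec.subspace_scale[OF subspace_specht that]
      by (simp add: sym_hom_def herm_scale_left cvec.scale_sum_right)
  qed
  show "sym_hom \<mu> x t z = 0" if "z \<notin> specht \<mu>" for z using that by (simp add: sym_hom_def)
  fix q z assume q: "q permutes {1..card \<mu>}" and z: "z \<in> specht \<mu>"
  note iq = permutes_inv[OF q]
  have "(\<Sum>p\<in>?P. herm (tabloids \<mu>) (pact q z) (pact p x) *\<^sub>C pact p t)
      = (\<Sum>p\<in>?P. herm (tabloids \<mu>) z (pact p x) *\<^sub>C pact (q \<circ> p) t)"
  proof (rule sum.reindex_bij_witness[where i = "\<lambda>p. q \<circ> p" and j = "\<lambda>p. inv q \<circ> p"])
    fix p assume p: "p \<in> ?P"
    show "q \<circ> (inv q \<circ> p) = p" by (simp add: comp_assoc[symmetric] permutes_inv_o[OF q])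
    then show "herm (tabloids \<mu>) z (pact (inv q \<circ> p) x) *\<^sub>C pact (q \<circ> (inv q \<circ> p)) t
        = herm (tabloids \<mu>) (pact q z) (pact p x) *\<^sub>C pact p t"
      by (simp add: herm_pact_tabloids[OF q] pact_comp)
  qed (use q iq in \<open>auto simp: comp_assoc[symmetric] permutes_inv_o permutes_compose\<close>)
  then show "sym_hom \<mu> x t (pact q z) = pact q (sym_hom \<mu> x t z)"
    using z specht_pact[OF q z] by (simp add: sym_hom_def pact_sum pact_scale pact_comp)
qed

lemma weyl_op_sym_hom:
  assumes t: "t \<in> tensors (card \<mu>)"
  shows "weyl_op (card \<mu>) g (sym_hom \<mu> x t) = sym_hom \<mu> x (group_op (card \<mu>) g t)"
proof
  fix z
  let ?P = "{p. p permutes {1..card \<mu>}}"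
  have "group_op (card \<mu>) g (0 :: 'a tensor) = 0"
    by (simp add: group_op_def fun_eq_iff)
  moreover have "group_op (card \<mu>) g (\<Sum>p\<in>?P. herm (tabloids \<mu>) z (pact p x) *\<^sub>C pact p t)
      = (\<Sum>p\<in>?P. herm (tabloids \<mu>) z (pact p x) *\<^sub>C pact p (group_op (card \<mu>) g t))"
  proof -
    have "group_op (card \<mu>) g (\<Sum>p\<in>?P. herm (tabloids \<mu>) z (pact p x) *\<^sub>C pact p t)
      = (\<Sum>p\<in>?P. herm (tabloids \<mu>) z (pact p x) *\<^sub>C group_op (card \<mu>) g (pact p t))"
      by (rule linear_on_sum[OF linear_on_group_op subspace_tensors]) (simp add: pact_tensors t)
    also have "\<dots> = (\<Sum>p\<in>?P. herm (tabloids \<mu>) z (pact p x) *\<^sub>C pact p (group_op (card \<mu>) g t))"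
      by (rule sum.cong[OF refl]) (simp add: group_op_pact t)
    finally show ?thesis .
  qed
  ultimately show "weyl_op (card \<mu>) g (sym_hom \<mu> x t) z = sym_hom \<mu> x (group_op (card \<mu>) g t) z"
    by (simp add: weyl_op_def sym_hom_def)
qed

text \<open>As \<open>x\<close> runs over an orthonormal basis of the Specht module, the maps \<open>sym_hom \<mu> x (\<phi> x)\<close>
  add up to a multiple of \<open>\<phi>\<close>; this takes the place of Schur's lemma for the Specht module.\<close>

lemma sum_sym_hom:
  fixes \<phi> :: "((nat \<Rightarrow> nat) \<Rightarrow> complex) \<Rightarrow> 'N::finite tensor"
  assumes fin: "finite \<mu>" and \<phi>: "\<phi> \<in> weyl_module \<mu>"
  shows "(\<Sum>e\<in>orth_basis (tabloids \<mu>) (specht \<mu>). sym_hom \<mu> e (\<phi> e)) = of_nat (fact (card \<mu>)) *\<^sub>C \<phi>"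
proof
  fix z
  let ?P = "{p. p permutes {1..card \<mu>}}" and ?B = "orth_basis (tabloids \<mu>) (specht \<mu>)"
  note B = orth_basis[OF finite_tabloids[OF fin] subspace_specht specht_funs]
  have lin: "linear_on (specht \<mu>) (traceless (card \<mu>)) \<phi>"
    and eq: "\<And>p x. p permutes {1..card \<mu>} \<Longrightarrow> x \<in> specht \<mu> \<Longrightarrow> \<phi> (pact p x) = pact p (\<phi> x)"
    and out: "\<And>x. x \<notin> specht \<mu> \<Longrightarrow> \<phi> x = 0"
    using \<phi> by (auto simp: weyl_module_iff)
  show "(\<Sum>e\<in>?B. sym_hom \<mu> e (\<phi> e)) z = (of_nat (fact (card \<mu>)) *\<^sub>C \<phi>) z"
  proof (cases "z \<in> specht \<mu>")
    case True
    have "(\<Sum>e\<in>?B. sym_hom \<mu> e (\<phi> e)) z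
        = (\<Sum>e\<in>?B. \<Sum>p\<in>?P. herm (tabloids \<mu>) z (pact p e) *\<^sub>C pact p (\<phi> e))"
      by (subst sum_apply) (simp add: sym_hom_def True)
    also have "\<dots> = (\<Sum>p\<in>?P. \<Sum>e\<in>?B. herm (tabloids \<mu>) z (pact p e) *\<^sub>C pact p (\<phi> e))"
      by (rule sum.swap)
    \<comment> \<open>All permutations contribute equally, whence the factorial: moving
      \<open>p\<close> to the other argument of the form and through \<phi> leaves the expansion of
      \<open>pact (inv p) z\<close> in the orthonormal basis.\<close>
    also have "\<dots> = (\<Sum>p\<in>?P. \<phi> z)"
    proof (rule sum.cong[OF refl])
      fix p assume "p \<in> ?P"
      then have p: "p permutes {1..card \<mu>}" by simp
      note ip = permutes_inv[OF p]
      have "(\<Sum>e\<in>?B. herm (tabloids \<mu>) z (pact p e) *\<^sub>C pact p (\<phi> e))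
          = (\<Sum>e\<in>?B. herm (tabloids \<mu>) (pact (inv p) z) e *\<^sub>C \<phi> (pact p e))"
        using B(2) by (intro sum.cong refl)
          (auto simp: eq[OF p] herm_pact_tabloids[OF ip] permutes_inv_inv[OF p])
      also have "\<dots> = \<phi> (\<Sum>e\<in>?B. herm (tabloids \<mu>) (pact (inv p) z) e *\<^sub>C pact p e)"
        by (rule linear_on_sum[OF lin subspace_specht, symmetric]) (use B(2) specht_pact[OF p]
            in auto)
      also have "(\<Sum>e\<in>?B. herm (tabloids \<mu>) (pact (inv p) z) e *\<^sub>C pact p e)
          = pact p (\<Sum>e\<in>?B. herm (tabloids \<mu>) (pact (inv p) z) e *\<^sub>C e)"
        by (simp add: pact_sum pact_scale)
      also have "\<dots> = pact p (pact (inv p) z)" using B(4)[OF specht_pact[OF ip True]] by simp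
      also have "\<dots> = z" by (simp add: pact_comp permutes_inv_o[OF p] pact_id)
      finally show "(\<Sum>e\<in>?B. herm (tabloids \<mu>) z (pact p e) *\<^sub>C pact p (\<phi> e)) = \<phi> z" .
    qed
    also have "\<dots> = of_nat (card ?P) *\<^sub>C \<phi> z"
      by (simp add: fun_eq_iff sum_apply scaleC_apply)
    also have "card ?P = fact (card \<mu>)" by (simp add: card_permutations)
    finally show ?thesis by (subst scaleC_fun_apply)
  next
    case False
    then show ?thesis by (subst sum_apply) (simp add: sym_hom_def out scaleC_fun_apply)
  qed
qed

lemma weyl_module_range: "\<phi> \<in> weyl_module \<mu> \<Longrightarrow> \<phi> x \<in> traceless (card \<mu>)"
  using cvec.subspace_0[OF subspace_traceless]
      by (cases "x \<in> specht \<mu>") (auto simp: weyl_module_iff linear_on_def)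

section \<open>Pairs of tensors as arrays on a disjoint union of slots\<close>

lemma PiE_Plus_case_sum:
  "c \<in> A \<rightarrow>\<^sub>E UNIV \<Longrightarrow> d \<in> B \<rightarrow>\<^sub>E UNIV \<Longrightarrow> case_sum c d \<in> (A <+> B) \<rightarrow>\<^sub>E UNIV"
  by (auto simp: PiE_iff extensional_def split: sum.splits)

lemma PiE_Plus_comp:
  assumes "j \<in> (A <+> B) \<rightarrow>\<^sub>E UNIV"
  shows "j \<circ> Inl \<in> A \<rightarrow>\<^sub>E UNIV" "j \<circ> Inr \<in> B \<rightarrow>\<^sub>E UNIV"
  using assms by (auto simp: PiE_iff extensional_def)

lemma case_sum_comp: "case_sum (j \<circ> Inl) (j \<circ> Inr) = j"
  by (auto simp: fun_eq_iff split: sum.splits)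

lemma sum_PiE_Plus:
  fixes F :: "('x + 'y \<Rightarrow> 'N) \<Rightarrow> 'c::comm_monoid_add"
  shows "(\<Sum>j\<in>(A <+> B) \<rightarrow>\<^sub>E UNIV. F j) = (\<Sum>c\<in>A \<rightarrow>\<^sub>E UNIV. \<Sum>d\<in>B \<rightarrow>\<^sub>E UNIV. F (case_sum c d))"
proof -
  have "(\<Sum>j\<in>(A <+> B) \<rightarrow>\<^sub>E UNIV. F j) = (\<Sum>(c, d)\<in>(A \<rightarrow>\<^sub>E UNIV) \<times> (B \<rightarrow>\<^sub>E UNIV). F (case_sum c d))"
  proof (rule sum.reindex_bij_witness[where i = "\<lambda>(c, d). case_sum c d"
      and j = "\<lambda>j. (j \<circ> Inl, j \<circ> Inr)"])
    fix p :: "('x \<Rightarrow> 'N) \<times> ('y \<Rightarrow> 'N)" assume p: "p \<in> (A \<rightarrow>\<^sub>E UNIV) \<times> (B \<rightarrow>\<^sub>E UNIV)"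
    have "case_sum (fst p) (snd p) \<in> (A <+> B) \<rightarrow>\<^sub>E UNIV"
      by (rule PiE_Plus_case_sum) (use p in auto)
    then show "(case p of (c, d) \<Rightarrow> case_sum c d) \<in> (A <+> B) \<rightarrow>\<^sub>E UNIV"
      by (simp only: case_prod_beta)
  qed (simp_all add: case_sum_comp case_sum_o_inj PiE_Plus_comp split: prod.splits)
  then show ?thesis by (simp add: sum.cartesian_product)
qed

lemma pact_delta:
  assumes p: "p permutes {1..m}"
  shows "pact (inv p) (delta d) = delta (d \<circ> p)"
proof
  fix i
  have "i \<circ> inv p = d \<longleftrightarrow> i = d \<circ> p"
    using permutes_inv_o[OF p] by (metis comp_assoc comp_id)
  then show "pact (inv p) (delta d) i = delta (d \<circ> p) i" by (simp add: pact_def delta_def)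
qed

text \<open>
  The coordinates of \<open>H x y\<close> form an invariant array on a disjoint union of two index sets. As \<open>H
      x y\<close>
  lives on traceless tensors, only the contractions that pair the two sets can be nonzero, and these
  are invariant pairings of \<open>x\<close> and \<open>y\<close>.
\<close>

theorem specht_tensor_form_eq_0:
  fixes H :: "((nat \<Rightarrow> nat) \<Rightarrow> complex) \<Rightarrow> ((nat \<Rightarrow> nat) \<Rightarrow> complex) \<Rightarrow>
    'N::finite tensor \<Rightarrow> 'N tensor \<Rightarrow> complex"
  assumes \<mu>: "young_diagram \<mu>" and \<nu>: "young_diagram \<nu>" and ne: "\<mu> \<noteq> \<nu>"
    and m: "m = card \<mu>" and m': "m' = card \<nu>"
    and add: "\<And>x x' y t t'. H (x + x') y t t' = H x y t t' + H x' y t t'"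
      "\<And>x y y' t t'. H x (y + y') t t' = H x y t t' + H x y' t t'"
      "\<And>x y s t t'. H x y (s + t) t' = H x y s t' + H x y t t'"
      "\<And>x y t s t'. H x y t (s + t') = H x y t s + H x y t t'"
    and scale: "\<And>c x y t t'. H (c *\<^sub>C x) y t t' = cnj c * H x y t t'"
      "\<And>c x y t t'. H x (c *\<^sub>C y) t t' = c * H x y t t'"
      "\<And>c x y t t'. H x y (c *\<^sub>C t) t' = c * H x y t t'"
      "\<And>c x y t t'. H x y t (c *\<^sub>C t') = cnj c * H x y t t'"
    and perm: "\<And>p x y t t'. p permutes {1..m} \<Longrightarrow> t \<in> tensors m \<Longrightarrow>
        H x y (pact p t) t' = H (pact (inv p) x) y t t'"
      "\<And>p x y t t'. p permutes {1..m'} \<Longrightarrow> t' \<in> tensors m' \<Longrightarrow>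
          H x y t (pact p t') = H x (pact (inv p) y) t t'"
    and ginv: "\<And>g x y t t'. orthogonal_matrix g \<Longrightarrow> \<forall>a b. g $ a $ b \<in> \<real> \<Longrightarrow> t \<in> tensors m \<Longrightarrow>
        t' \<in> tensors m' \<Longrightarrow>
      H x y (group_op m g t) (group_op m' g t') = H x y t t'"
    and tr: "\<And>u k l x y t'. u \<in> indices m \<Longrightarrow> k \<in> {1..m} \<Longrightarrow> l \<in> {1..m} \<Longrightarrow> k \<noteq> l \<Longrightarrow>
        H x y (\<Sum>a\<in>UNIV. delta (u(k := a, l := a))) t' = 0"
      "\<And>u k l x y t. u \<in> indices m' \<Longrightarrow> k \<in> {1..m'} \<Longrightarrow> l \<in> {1..m'} \<Longrightarrow> k \<noteq> l \<Longrightarrow>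
        H x y t (\<Sum>a\<in>UNIV. delta (u(k := a, l := a))) = 0"
    and x: "x \<in> specht \<mu>" and y: "y \<in> specht \<nu>"
    and t: "t \<in> tensors m" and t': "t' \<in> tensors m'"
  shows "H x y t t' = 0"
proof -
  have zero: "H x y 0 t = 0" "H x y t 0 = 0" for x y t
    using add(3)[of x y 0 0 t] add(4)[of x y t 0 0] by simp_all
  have sum3: "H x y (\<Sum>b\<in>B. f b) t' = (\<Sum>b\<in>B. H x y (f b) t')"
    and sum4: "H x y t' (\<Sum>b\<in>B. f b) = (\<Sum>b\<in>B. H x y t' (f b))" for x y t' f and B :: "'b set"
    by (induction B rule: infinite_finite_induct) (simp_all add: zero add del: zero_fun_apply
        plus_fun_apply)
  define I where "I = {1..m} <+> {1..m'}"
  define f where "f j = H x y (delta (j \<circ> Inl)) (delta (j \<circ> Inr))" for j :: "nat + nat \<Rightarrow> 'N"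
  have fin: "finite I" by (simp add: I_def)
  have inv: "invariant_array I f"
    unfolding invariant_array_def
  proof (intro allI impI ballI)
    fix g :: "complex ^ 'N ^ 'N" and i
    assume g: "orthogonal_matrix g \<and> (\<forall>a b. g $ a $ b \<in> \<real>)" and i: "i \<in> I \<rightarrow>\<^sub>E (UNIV :: 'N set)"
    \<comment> \<open>With the transpose, the coordinates of the transformed basis tensor are the
      coefficients \<open>gker\<close> of \<open>g\<close> that the definition of invariance asks
      for. The second tensor argument is conjugate-linear, so real entries are needed there.\<close>
    let ?h = "transpose g" and ?c = "i \<circ> Inl" and ?d = "i \<circ> Inr"
    have h: "orthogonal_matrix ?h" "\<forall>a b. ?h $ a $ b \<in> \<real>"
      using g by (auto simp: orthogonal_matrix_def transpose_def)
    have cd: "?c \<in> indices m" "?d \<in> indices m'"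
      using PiE_Plus_comp[of i "{1..m}" "{1..m'}"] i unfolding I_def indices_def by auto
    have expand: "group_op k ?h (delta c) = (\<Sum>a\<in>indices k. gker {1..k} g c a *\<^sub>C delta a)"
      if c: "c \<in> indices k" for c k
    proof -
      have "group_op k ?h (delta c) a = gker {1..k} g c a" if "a \<in> indices k" for a
        using that c by (simp add: group_op_kop delta_tensors kop_delta gker_def transpose_def)
      then show ?thesis
        using funs_expand[of "indices k" "group_op k ?h (delta c)"] group_op_tensors[of k ?h
            "delta c"]
        by (simp add: tensors_funs)
    qed
    have real: "cnj (gker {1..k} g a b) = gker {1..k} g a b" for k a b
      using g by (simp add: gker_def Reals_cnj_iff)
    have "f i = H x y (group_op m ?h (delta ?c)) (group_op m' ?h (delta ?d))"
      unfolding f_def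
          by (rule ginv[symmetric, OF h delta_tensors[OF cd(1)] delta_tensors[OF cd(2)]])
    also have "\<dots>
        = (\<Sum>a\<in>indices m. \<Sum>b\<in>indices m'. gker {1..m} g ?c a * (gker {1..m'} g ?d b * H x y (delta
            a) (delta b)))"
      unfolding expand[OF cd(1)] expand[OF cd(2)] sum3 sum4 scale real sum_distrib_left
      by (subst sum.swap) (simp only: mult.left_commute)
    also have "\<dots> = (\<Sum>j \<in> I \<rightarrow>\<^sub>E UNIV. (\<Prod>l\<in>I. g $ i l $ j l) * f j)"
      unfolding I_def sum_PiE_Plus f_def indices_def
      by (simp add: prod.Plus gker_def case_sum_o_inj mult.assoc)
    finally show "(\<Sum>j \<in> I \<rightarrow>\<^sub>E UNIV. (\<Prod>l\<in>I. g $ i l $ j l) * f j) = f i" by simp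
  qed
  have trl: "(\<Sum>c\<in>UNIV. f (i(Inl k := c, Inl l := c))) = 0"
    if i: "i \<in> (I - {Inl k, Inl l}) \<rightarrow>\<^sub>E (UNIV :: 'N set)"
        and kl: "k \<in> {1..m}" "l \<in> {1..m}" "k \<noteq> l" for i k l
  proof -
    define w where "w = (i \<circ> Inl)(k := undefined, l := undefined :: 'N)"
    have w: "w \<in> indices m"
      unfolding indices_def
    proof (rule PiE_I)
      fix a assume "a \<notin> {1..m}"
      then have "Inl a \<notin> I - {Inl k, Inl l}" by (auto simp: I_def)
      then have "i (Inl a) = undefined" by (rule PiE_arb[OF i])
      then show "w a = undefined" by (simp add: w_def)
    qed simp
    have e: "i(Inl k := c, Inl l := c) \<circ> Inl = w(k := c, l := c)"
      "i(Inl k := c, Inl l := c) \<circ> Inr = i \<circ> Inr" for c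
      by (rule ext, simp add: w_def)+
    show ?thesis unfolding f_def e sum3[symmetric] by (rule tr(1)[OF w kl])
  qed
  have trr: "(\<Sum>c\<in>UNIV. f (i(Inr k := c, Inr l := c))) = 0"
    if i: "i \<in> (I - {Inr k, Inr l}) \<rightarrow>\<^sub>E (UNIV :: 'N set)"
        and kl: "k \<in> {1..m'}" "l \<in> {1..m'}" "k \<noteq> l" for i k l
  proof -
    define w where "w = (i \<circ> Inr)(k := undefined, l := undefined :: 'N)"
    have w: "w \<in> indices m'"
      unfolding indices_def
    proof (rule PiE_I)
      fix a assume "a \<notin> {1..m'}"
      then have "Inr a \<notin> I - {Inr k, Inr l}" by (auto simp: I_def)
      then have "i (Inr a) = undefined" by (rule PiE_arb[OF i])
      then show "w a = undefined" by (simp add: w_def)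
    qed simp
    have e: "i(Inr k := c, Inr l := c) \<circ> Inr = w(k := c, l := c)"
      "i(Inr k := c, Inr l := c) \<circ> Inl = i \<circ> Inl" for c
      by (rule ext, simp add: w_def)+
    show ?thesis unfolding f_def e sum4[symmetric] by (rule tr(2)[OF w kl])
  qed
  have f0: "f j = 0" if "j \<in> I \<rightarrow>\<^sub>E UNIV" for j
  proof (rule invariant_array_eq_0[OF fin inv _ that])
    fix \<sigma> assume \<sigma>: "\<And>l. l \<in> I \<Longrightarrow> \<sigma> l \<in> I \<and> \<sigma> l \<noteq> l \<and> \<sigma> (\<sigma> l) = l"
    then have match: "\<forall>l\<in>I. \<sigma> l \<in> I \<and> \<sigma> l \<noteq> l \<and> \<sigma> (\<sigma> l) = l" by blast
    let ?s = "\<Sum>i\<in>{i \<in> I \<rightarrow>\<^sub>E UNIV. \<forall>l\<in>I. i (\<sigma> l) = i l}. f i"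
    \<comment> \<open>Either the matching has a pair on one side, and the inner sum is a trace that
      vanishes, or it is a bijection between the two sides.\<close>
    consider (l) k l where "Inl k \<in> I" "\<sigma> (Inl k) = Inl l"
      | (r) k l where "Inr k \<in> I" "\<sigma> (Inr k) = Inr l"
      | (cross) "\<And>k. Inl k \<in> I \<Longrightarrow> \<exists>l. \<sigma> (Inl k) = Inr l" "\<And>k. Inr k \<in> I \<Longrightarrow> \<exists>l. \<sigma> (Inr k) = Inl l"
      by (metis sum.exhaust)
    then show "?s = 0"
    proof cases
      case l
      then have "k \<in> {1..m}" "l \<in> {1..m}" "k \<noteq> l" using \<sigma>[OF l(1)] by (auto simp: I_def)
      then show ?thesis
        unfolding sum_matching_pair[OF fin match l(1)] l(2)
            by (intro sum.neutral) (auto intro!: trl)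
    next
      case r
      then have "k \<in> {1..m'}" "l \<in> {1..m'}" "k \<noteq> l" using \<sigma>[OF r(1)] by (auto simp: I_def)
      then show ?thesis
        unfolding sum_matching_pair[OF fin match r(1)] r(2)
            by (intro sum.neutral) (auto intro!: trr)
    next
      case cross
      \<comment> \<open>Outside the slots \<tau> is the identity, so that it is a permutation once
        the two numbers of slots are known to agree.\<close>
      define \<tau> where "\<tau> k = (if k \<in> {1..m} then projr (\<sigma> (Inl k)) else k)" for k
      have \<tau>: "\<sigma> (Inl k) = Inr (\<tau> k)" "\<tau> k \<in> {1..m'}" if "k \<in> {1..m}" for k
      proof -
        have k: "Inl k \<in> I" using that by (auto simp: I_def)
        from cross(1)[OF k] obtain l where l: "\<sigma> (Inl k) = Inr l" by blast
        then show "\<sigma> (Inl k) = Inr (\<tau> k)" using that by (simp add: \<tau>_def)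
        then have "Inr (\<tau> k) \<in> I" using \<sigma>[OF k] by simp
        then show "\<tau> k \<in> {1..m'}" by (auto simp: I_def)
      qed
      have inj: "inj_on \<tau> {1..m}"
      proof (rule inj_onI)
        fix a b assume ab: "a \<in> {1..m}" "b \<in> {1..m}" "\<tau> a = \<tau> b"
        then have "\<sigma> (\<sigma> (Inl a)) = \<sigma> (\<sigma> (Inl b))" by (simp add: \<tau>)
        moreover have "Inl a \<in> I" "Inl b \<in> I" using ab by (auto simp: I_def)
        ultimately show "a = b" using \<sigma> by (metis sum.inject(1))
      qed
      have surj: "\<tau> ` {1..m} = {1..m'}"
      proof
        show "\<tau> ` {1..m} \<subseteq> {1..m'}" using \<tau>(2) by auto
        show "{1..m'} \<subseteq> \<tau> ` {1..m}"
        proof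
          fix k assume "k \<in> {1..m'}"
          then have k: "Inr k \<in> I" by (auto simp: I_def)
          from cross(2)[OF k] obtain l where l: "\<sigma> (Inr k) = Inl l" by blast
          then have lm: "l \<in> {1..m}" using \<sigma>[OF k] by (auto simp: I_def)
          have "Inr k = Inr (\<tau> l)" using \<sigma>[OF k] l \<tau>(1)[OF lm] by simp
          then have "k = \<tau> l" by simp
          then show "k \<in> \<tau> ` {1..m}" using lm by (rule image_eqI)
        qed
      qed
      have mm: "m' = m"
        using card_image[OF inj] surj by simp
      have \<tau>p: "\<tau> permutes {1..m}"
        using inj surj unfolding mm by (intro bij_imp_permutes) (auto simp: bij_betw_def \<tau>_def)
      note i\<tau> = permutes_inv[OF \<tau>p]
      \<comment> \<open>Complete contraction of the two tensor arguments along the identity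
        matching. The actual matching differs by \<tau>, which \<open>perm\<close> moves into the
        argument \<open>x\<close>. Simultaneous permutation of both arguments only reorders the sum,
        so \<beta> is an invariant form on the two Specht modules.\<close>
      define \<beta> where "\<beta> x y = (\<Sum>d\<in>indices m. H x y (delta d) (delta d))" for x y
      have "?s = (\<Sum>d\<in>indices m. f (case_sum (d \<circ> \<tau>) d))"
      proof (rule sum.reindex_bij_witness[where i = "\<lambda>d. case_sum (d \<circ> \<tau>) d" and j = "\<lambda>j. j \<circ> Inr"])
        fix j assume j: "j \<in> {i \<in> I \<rightarrow>\<^sub>E (UNIV :: 'N set). \<forall>l\<in>I. i (\<sigma> l) = i l}"
        show jr: "j \<circ> Inr \<in> indices m"
          using PiE_Plus_comp[of j "{1..m}" "{1..m}"] j by (auto simp: I_def mm indices_def)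
        have "j (Inr (\<tau> k)) = j (Inl k)" for k
        proof (cases "k \<in> {1..m}")
          case True
          then have "Inl k \<in> I" by (auto simp: I_def)
          then show ?thesis using j \<tau>(1)[OF True] by force
        next
          case False
          then have "Inl k \<notin> I" "Inr k \<notin> I" by (auto simp: I_def mm)
          then show ?thesis using j False by (auto simp: \<tau>_def PiE_iff extensional_def)
        qed
        then have "j \<circ> Inr \<circ> \<tau> = j \<circ> Inl" by (simp add: fun_eq_iff)
        then show "case_sum (j \<circ> Inr \<circ> \<tau>) (j \<circ> Inr) = j" by (simp add: case_sum_comp)
        then show "f (case_sum (j \<circ> Inr \<circ> \<tau>) (j \<circ> Inr)) = f j" by simp
      next
        fix d :: "nat \<Rightarrow> 'N" assume d: "d \<in> indices m"
        show "case_sum (d \<circ> \<tau>) d \<circ> Inr = d" by (simp add: case_sum_o_inj)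
        have "case_sum (d \<circ> \<tau>) d \<in> I \<rightarrow>\<^sub>E UNIV"
          using d indices_perm[OF \<tau>p d] unfolding I_def mm indices_def by (intro PiE_Plus_case_sum)
        moreover have "case_sum (d \<circ> \<tau>) d (\<sigma> l) = case_sum (d \<circ> \<tau>) d l" if l: "l \<in> I" for l
        proof (cases l)
          case (Inl k)
          then show ?thesis using l \<tau>(1)[of k] by (auto simp: I_def)
        next
          case (Inr k)
          then obtain k' where k': "\<sigma> l = Inl k'" using cross(2) l by blast
          then have "k' \<in> {1..m}" using \<sigma>[OF l] by (auto simp: I_def)
          then have "\<sigma> (\<sigma> l) = Inr (\<tau> k')" using \<tau>(1) k' by simp
          then have "l = Inr (\<tau> k')" using \<sigma>[OF l] by simp
          then show ?thesis using k' by simp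
        qed
        ultimately show "case_sum (d \<circ> \<tau>) d \<in> {i \<in> I \<rightarrow>\<^sub>E UNIV. \<forall>l\<in>I. i (\<sigma> l) = i l}" by simp
      qed
      also have "\<dots> = (\<Sum>d\<in>indices m. H x y (pact (inv \<tau>) (delta d)) (delta d))"
        by (simp add: f_def case_sum_o_inj pact_delta[OF \<tau>p])
      also have "\<dots> = \<beta> (pact \<tau> x) y"
        unfolding \<beta>_def
            by (intro sum.cong refl) (simp add: perm(1)[OF i\<tau>] delta_tensors permutes_inv_inv[OF
                \<tau>p])
      also have "\<dots> = 0"
      proof (rule specht_form_eq_0[where \<beta> = \<beta> and m = m, OF \<mu> \<nu> ne])
        show "card \<mu> = m" "card \<nu> = m" using m m' mm by simp_all
        show "pact \<tau> x \<in> specht \<mu>" by (rule specht_pact[OF _ x]) (use \<tau>p m in simp)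
        show "y \<in> specht \<nu>" by (rule y)
        show "\<beta> (tabloid_op q x) (tabloid_op q y) = \<beta> x y" if q: "q permutes {1..m}" for q x y
        proof -
          note iq = permutes_inv[OF q]
          have "\<beta> (pact q x) (pact q y)
              = (\<Sum>d\<in>indices m. H x y (pact (inv q) (delta d)) (pact (inv q) (delta d)))"
            unfolding \<beta>_def
            by (intro sum.cong refl)
              (simp add: perm(1)[OF iq] perm(2)[OF iq[folded mm]] delta_tensors
                  permutes_inv_inv[OF q] mm pact_tensors[OF iq])
          also have "\<dots> = (\<Sum>d\<in>indices m. H x y (delta (d \<circ> q)) (delta (d \<circ> q)))"
            by (simp add: pact_delta[OF q])
          also have "\<dots> = \<beta> x y"
            unfolding \<beta>_def
            by (rule sum.reindex_bij_witness[where i = "\<lambda>d. d \<circ> inv q" and j = "\<lambda>d. d \<circ> q"])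
              (auto simp: comp_assoc permutes_inv_o[OF q] intro: indices_perm[OF q]
                  indices_perm[OF iq])
          finally show ?thesis by (simp add: tabloid_op_pact)
        qed
      qed (simp_all add: \<beta>_def add scale sum.distrib sum_distrib_left del: plus_fun_apply)
      finally show ?thesis .
    qed
  qed
  have H0: "H x y (delta c) (delta d) = 0" if "c \<in> indices m" "d \<in> indices m'" for c d
    using f0[of "case_sum c d"] PiE_Plus_case_sum[of c "{1..m}" d "{1..m'}"] that
    unfolding I_def f_def indices_def by (simp add: case_sum_o_inj)
  have "t = (\<Sum>i\<in>indices m. t i *\<^sub>C delta i)" "t' = (\<Sum>i\<in>indices m'. t' i *\<^sub>C delta i)"
    using t t' by (simp_all add: tensors_funs funs_expand[symmetric])
  then have "H x y t t' = H x y (\<Sum>i\<in>indices m. t i *\<^sub>C delta i) (\<Sum>i\<in>indices m'. t' i *\<^sub>C delta i)"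
    by simp
  also have "\<dots> = 0" unfolding sum3 sum4 scale by (simp add: H0)
  finally show ?thesis .
qed

section \<open>The central projections\<close>

lemma traceless_funs: "traceless m \<subseteq> funs (indices m)"
  using traceless_tensors by (simp add: tensors_funs)

lemma group_op_zero: "group_op m g 0 = 0"
  by (simp add: group_op_def fun_eq_iff)

lemma tensor_mult_spaceD:
  assumes "\<Phi> \<in> tensor_mult_space n \<mu>"
  shows "linear_on (weyl_module \<mu>) (tensors n) \<Phi>"
    and "\<And>a. a \<notin> weyl_module \<mu> \<Longrightarrow> \<Phi> a = 0"
    and "\<And>g a. g \<in> orthogonal_group \<Longrightarrow> a \<in> weyl_module \<mu> \<Longrightarrow>
        \<Phi> (weyl_op (card \<mu>) g a) = group_op n g (\<Phi> a)"
    and "\<And>a. \<Phi> a \<in> tensors n"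
proof -
  show 1: "linear_on (weyl_module \<mu>) (tensors n) \<Phi>" and 2: "\<And>a. a \<notin> weyl_module \<mu> \<Longrightarrow> \<Phi> a = 0"
    and "\<And>g a. g \<in> orthogonal_group \<Longrightarrow> a \<in> weyl_module \<mu> \<Longrightarrow>
        \<Phi> (weyl_op (card \<mu>) g a) = group_op n g (\<Phi> a)"
    using assms by (auto simp: tensor_mult_space_def hom_space_def)
  show "\<Phi> a \<in> tensors n" for a
    using 1 2[of a] cvec.subspace_0[OF subspace_tensors] unfolding linear_on_def
    by (cases "a \<in> weyl_module \<mu>") auto
qed

text \<open>Feeding both equivariant maps with symmetrized rank-one maps gives a form in two Specht
  vectors and two tensors, to which \<open>specht_tensor_form_eq_0\<close> applies. Every element of
  a Weyl module is a combination of such maps by \<open>sum_sym_hom\<close>.\<close>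

theorem mult_space_orthogonal:
  fixes \<Phi> \<Psi> :: "(((nat \<Rightarrow> nat) \<Rightarrow> complex) \<Rightarrow> 'N::finite tensor) \<Rightarrow> 'N tensor"
  assumes \<mu>: "young_diagram \<mu>" and \<nu>: "young_diagram \<nu>" and ne: "\<mu> \<noteq> \<nu>"
    and \<Phi>: "\<Phi> \<in> tensor_mult_space n \<mu>" and \<Psi>: "\<Psi> \<in> tensor_mult_space n \<nu>"
    and a: "a \<in> weyl_module \<mu>" and b: "b \<in> weyl_module \<nu>"
  shows "herm (indices n) (\<Phi> a) (\<Psi> b) = 0"
proof -
  note \<Phi>D = tensor_mult_spaceD[OF \<Phi>] and \<Psi>D = tensor_mult_spaceD[OF \<Psi>]
  \<comment> \<open>Basis tensors are in general not traceless, but \<open>sym_hom\<close> lands in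
    the Weyl module only for traceless ones. The projection extends the form to all tensors,
    commutes with permutations and the group, and fixes traceless tensors.\<close>
  define pp :: "nat \<Rightarrow> 'N tensor \<Rightarrow> 'N tensor" where "pp k = proj (indices k) (traceless k)" for k
  have pD: "pp k t \<in> traceless k" for k t
    unfolding pp_def by (rule proj_in[OF finite_indices subspace_traceless traceless_funs])
  have pp_add: "pp k (s + t) = pp k s + pp k t" and pp_scale: "pp k (c *\<^sub>C t) = c *\<^sub>C pp k t"
      for k c s t
    by (simp_all only: pp_def proj_add proj_scale)
  have pp_zero: "pp k 0 = 0" for k by (simp only: pp_def proj_zero)
  define F where "F x t = \<Phi> (sym_hom \<mu> x (pp (card \<mu>) t))" for x t
  define G where "G y t = \<Psi> (sym_hom \<nu> y (pp (card \<nu>) t))" for y t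
  have w\<mu>: "sym_hom \<mu> x (pp (card \<mu>) t) \<in> weyl_module \<mu>" for x t by (rule sym_hom_weyl[OF pD])
  have w\<nu>: "sym_hom \<nu> x (pp (card \<nu>) t) \<in> weyl_module \<nu>" for x t by (rule sym_hom_weyl[OF pD])
  have F: "F (x + x') t = F x t + F x' t" "F x (t + t') = F x t + F x t'"
    "F (c *\<^sub>C x) t = cnj c *\<^sub>C F x t" "F x (c *\<^sub>C t) = c *\<^sub>C F x t" for x x' t t' c
    using \<Phi>D(1) w\<mu> unfolding F_def linear_on_def pp_add pp_scale sym_hom_add_left sym_hom_add_right
      sym_hom_scale_left sym_hom_scale_right by blast+
  have G: "G (x + x') t = G x t + G x' t" "G x (t + t') = G x t + G x t'"
    "G (c *\<^sub>C x) t = cnj c *\<^sub>C G x t" "G x (c *\<^sub>C t) = c *\<^sub>C G x t" for x x' t t' c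
    using \<Psi>D(1) w\<nu> unfolding G_def linear_on_def pp_add pp_scale sym_hom_add_left sym_hom_add_right
      sym_hom_scale_left sym_hom_scale_right by blast+
  have pp_perm: "pp m (pact p t) = pact p (pp m t)" if p: "p permutes {1..m}"
      and t: "t \<in> tensors m" for m p t
    unfolding pp_def
  proof (rule proj_commute[OF finite_indices subspace_traceless traceless_funs,
      where X' = "pact (inv p)"])
    show "herm (indices m) (pact p s) w = herm (indices m) s (pact (inv p) w)"
        for s w :: "'N tensor"
      by (rule herm_pact_tensors[OF p])
    show "pact p (s - s') = pact p s - pact p s'" for s s' :: "'N tensor" by (rule pact_diff)
  qed (use t traceless_pact[OF p] traceless_pact[OF permutes_inv[OF p]]
      in \<open>simp_all add: tensors_funs\<close>)
  have pp_group: "pp m (group_op m g t) = group_op m g (pp m t)"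
    if "g \<in> orthogonal_group" "t \<in> tensors m" for g m t
    unfolding pp_def
    by (rule proj_group_op[OF subspace_traceless traceless_tensors traceless_group_op
        adj_orthogonal that])
  \<comment> \<open>The inner product with such a trace tensor is a trace, which is 0 on traceless
    tensors.\<close>
  have pp_trace: "pp m (\<Sum>a\<in>UNIV. delta (u(k := a, l := a))) = 0"
    if u: "u \<in> indices m" and kl: "k \<in> {1..m}" "l \<in> {1..m}" "k \<noteq> l" for m u k l
    unfolding pp_def
  proof (rule proj_orthogonal[OF finite_indices subspace_traceless traceless_funs])
    fix t :: "'N tensor" assume t: "t \<in> traceless m"
    have "u(k := a, l := a) \<in> indices m" for a using indices_upd u kl by metis
    then have "herm (indices m) t (\<Sum>a\<in>UNIV. delta (u(k := a, l := a)))
        = (\<Sum>a\<in>UNIV. t (u(k := a, l := a)))"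
      by (simp add: herm_sum_right herm_delta_right)
    also have "\<dots> = 0" using t u kl by (simp add: traceless_iff)
    finally show "herm (indices m) (\<Sum>a\<in>UNIV. delta (u(k := a, l := a))) t = 0"
      by (metis herm_cnj complex_cnj_zero)
  qed
  define H where "H x y t t' = herm (indices n) (F x t) (G y t')" for x y t t'
  have F_g: "F x (group_op (card \<mu>) g t) = group_op n g (F x t)"
    and G_g: "G x (group_op (card \<nu>) g t') = group_op n g (G x t')"
    if g: "g \<in> orthogonal_group" and t: "t \<in> tensors (card \<mu>)" "t' \<in> tensors (card \<nu>)" for x g t t'
  proof -
    have pt: "pp k s \<in> tensors k" for k s using pD traceless_tensors by blast
    show "F x (group_op (card \<mu>) g t) = group_op n g (F x t)"
      unfolding F_def pp_group[OF g t(1)] weyl_op_sym_hom[OF pt, symmetric] by (rule \<Phi>D(3)[OF g w\<mu>])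
    show "G x (group_op (card \<nu>) g t') = group_op n g (G x t')"
      unfolding G_def pp_group[OF g t(2)] weyl_op_sym_hom[OF pt, symmetric] by (rule \<Psi>D(3)[OF g w\<nu>])
  qed
  have F0: "F x 0 = 0" and G0: "G x 0 = 0" for x
    using F(4)[of x 0 0] G(4)[of x 0 0] by simp_all
  have H0: "H x y t t' = 0"
    if x: "x \<in> specht \<mu>" and y: "y \<in> specht \<nu>" and t: "t \<in> tensors (card \<mu>)"
        and t': "t' \<in> tensors (card \<nu>)"
    for x y t t'
  proof (rule specht_tensor_form_eq_0[where H = H, OF \<mu> \<nu> ne refl refl])
    show "x \<in> specht \<mu>" "y \<in> specht \<nu>" "t \<in> tensors (card \<mu>)" "t' \<in> tensors (card \<nu>)"
      by (fact x, fact y, fact t, fact t')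
    show "H (x + x') y t t' = H x y t t' + H x' y t t'" "H x (y + y') t t'
        = H x y t t' + H x y' t t'"
      "H x y (s + t) t' = H x y s t' + H x y t t'" "H x y t (s + t') = H x y t s + H x y t t'"
      "H (c *\<^sub>C x) y t t' = cnj c * H x y t t'" "H x (c *\<^sub>C y) t t' = c * H x y t t'"
      "H x y (c *\<^sub>C t) t' = c * H x y t t'" "H x y t (c *\<^sub>C t') = cnj c * H x y t t'"
      for x x' y y' t s t' c
      by (simp_all only: H_def F G herm_add_left herm_add_right herm_scale_left herm_scale_right
          complex_cnj_cnj)
    show "H x y (pact p t) t' = H (pact (inv p) x) y t t'"
      if "p permutes {1..card \<mu>}" "t \<in> tensors (card \<mu>)" for p x y t t'
      unfolding H_def F_def pp_perm[OF that] sym_hom_pact[OF that(1)] ..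
    show "H x y t (pact p t') = H x (pact (inv p) y) t t'"
      if "p permutes {1..card \<nu>}" "t' \<in> tensors (card \<nu>)" for p x y t t'
      unfolding H_def G_def pp_perm[OF that] sym_hom_pact[OF that(1)] ..
    show "H x y (group_op (card \<mu>) g t) (group_op (card \<nu>) g t') = H x y t t'"
      if g: "orthogonal_matrix g" "\<forall>a b. g $ a $ b \<in> \<real>"
          and t: "t \<in> tensors (card \<mu>)" "t' \<in> tensors (card \<nu>)"
      for g x y t t'
    proof -
      have "g \<in> orthogonal_group" using g(1) by (simp add: orthogonal_group_def)
      then show ?thesis
        unfolding H_def using F_g[OF _ t] G_g[OF _ t] group_op_real_herm[OF g] \<Phi>D(4) \<Psi>D(4)
        by (simp add: F_def G_def)
    qed
    show "H x y (\<Sum>a\<in>UNIV. delta (u(k := a, l := a))) t' = 0"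
      if "u \<in> indices (card \<mu>)" "k \<in> {1..card \<mu>}" "l \<in> {1..card \<mu>}" "k \<noteq> l" for u k l x y t'
    proof -
      have "F x (\<Sum>a\<in>UNIV. delta (u(k := a, l := a))) = F x 0"
        by (simp only: F_def pp_trace[OF that] pp_zero)
      then show ?thesis by (simp only: H_def F0 herm_zero_left)
    qed
    show "H x y t (\<Sum>a\<in>UNIV. delta (u(k := a, l := a))) = 0"
      if "u \<in> indices (card \<nu>)" "k \<in> {1..card \<nu>}" "l \<in> {1..card \<nu>}" "k \<noteq> l" for u k l x y t
    proof -
      have "G y (\<Sum>a\<in>UNIV. delta (u(k := a, l := a))) = G y 0"
        by (simp only: G_def pp_trace[OF that] pp_zero)
      then show ?thesis by (simp only: H_def G0 herm_zero_right)
    qed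
  qed
  have fin: "finite \<mu>" "finite \<nu>" using \<mu> \<nu> by (simp_all add: young_diagram_def)
  let ?B = "\<lambda>\<kappa>. orth_basis (tabloids \<kappa>) (specht \<kappa>)"
  have B: "?B \<kappa> \<subseteq> specht \<kappa>" if "finite \<kappa>" for \<kappa>
    by (rule orth_basis(2)[OF finite_tabloids[OF that] subspace_specht specht_funs])
  \<comment> \<open>The factorial from \<open>sum_sym_hom\<close> is kept as a factor and cancelled
    at the end, being nonzero.\<close>
  have expand: "of_nat (fact (card \<kappa>)) *\<^sub>C \<Theta> c = (\<Sum>e\<in>?B \<kappa>. \<Theta> (sym_hom \<kappa> e (pp (card \<kappa>) (c e))))"
    if \<kappa>: "finite \<kappa>" and \<Theta>: "\<Theta> \<in> tensor_mult_space n \<kappa>" and c: "c \<in> weyl_module \<kappa>" 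
    for \<kappa> c and \<Theta> :: "(((nat \<Rightarrow> nat) \<Rightarrow> complex) \<Rightarrow> 'N tensor) \<Rightarrow> 'N tensor"
  proof -
    have lin: "linear_on (weyl_module \<kappa>) (tensors n) \<Theta>" using tensor_mult_spaceD(1)[OF \<Theta>] .
    have "of_nat (fact (card \<kappa>)) *\<^sub>C \<Theta> c = \<Theta> (of_nat (fact (card \<kappa>)) *\<^sub>C c)"
      using lin c unfolding linear_on_def by metis
    also have "\<dots> = \<Theta> (\<Sum>e\<in>?B \<kappa>. 1 *\<^sub>C sym_hom \<kappa> e (c e))"
      by (simp only: sum_sym_hom[OF \<kappa> c] cvec.scale_one)
    also have "\<dots> = (\<Sum>e\<in>?B \<kappa>. 1 *\<^sub>C \<Theta> (sym_hom \<kappa> e (c e)))"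
      by (rule linear_on_sum[OF lin subspace_weyl sym_hom_weyl[OF weyl_module_range[OF c]]])
    also have "\<dots> = (\<Sum>e\<in>?B \<kappa>. \<Theta> (sym_hom \<kappa> e (pp (card \<kappa>) (c e))))"
      unfolding pp_def
      by (simp only: cvec.scale_one proj_id[OF finite_indices subspace_traceless traceless_funs
          weyl_module_range[OF c]])
    finally show ?thesis .
  qed
  have "of_nat (fact (card \<mu>)) * (of_nat (fact (card \<nu>)) * herm (indices n) (\<Phi> a) (\<Psi> b))
      = herm (indices n) (of_nat (fact (card \<mu>)) *\<^sub>C \<Phi> a) (of_nat (fact (card \<nu>)) *\<^sub>C \<Psi> b)"
    by (simp add: herm_scale_left herm_scale_right del: of_nat_fact)
  also have "\<dots> = (\<Sum>e'\<in>?B \<nu>. \<Sum>e\<in>?B \<mu>. H e e' (a e) (b e'))"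
    unfolding expand[OF fin(1) \<Phi> a] expand[OF fin(2) \<Psi> b] herm_sum_left herm_sum_right H_def F_def
        G_def ..
  also have "\<dots> = 0"
  proof (intro sum.neutral ballI)
    fix e e' assume "e \<in> ?B \<mu>" "e' \<in> ?B \<nu>"
    then show "H e e' (a e) (b e') = 0"
      using B[OF fin(1)] B[OF fin(2)] weyl_module_range[OF a] weyl_module_range[OF b]
          traceless_tensors
      by (intro H0) blast+
  qed
  finally show ?thesis by simp
qed

text \<open>The sum of all equivariant images of the Weyl module, that is, the isotypic component of
  its type in the tensor power.\<close>

definition isotypic :: "nat \<Rightarrow> young \<Rightarrow> 'N::finite tensor set" where
  "isotypic n \<mu> = cvec.span (\<Union>\<Phi>\<in>tensor_mult_space n \<mu>. \<Phi> ` weyl_module \<mu>)"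

lemma isotypic_subset: "isotypic n \<mu> \<subseteq> tensors n"
  unfolding isotypic_def
  by (rule cvec.span_minimal[OF _ subspace_tensors]) (auto simp: tensor_mult_spaceD(4))

lemma subspace_isotypic: "cvec.subspace (isotypic n \<mu>)"
  unfolding isotypic_def by (rule cvec.subspace_span)

lemma isotypicI: "\<Phi> \<in> tensor_mult_space n \<mu> \<Longrightarrow> a \<in> weyl_module \<mu> \<Longrightarrow> \<Phi> a \<in> isotypic n \<mu>"
  unfolding isotypic_def by (auto intro: cvec.span_base)

lemma isotypic_invariant:
  assumes X: "linear_on (tensors n) (tensors n) X"
    and gen: "X ` (\<Union>\<Phi>\<in>tensor_mult_space n \<mu>. \<Phi> ` weyl_module \<mu>) \<subseteq> isotypic n \<mu>"
    and w: "w \<in> isotypic n \<mu>"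
  shows "X w \<in> isotypic n \<mu>"
proof -
  have X0: "X 0 = 0"
    using linear_on_sum[OF X subspace_tensors, of "{}" "\<lambda>_. 0"] by simp
  have "cvec.subspace {w \<in> tensors n. X w \<in> isotypic n \<mu>}"
  proof (rule cvec.subspaceI)
    show "0 \<in> {w \<in> tensors n. X w \<in> isotypic n \<mu>}"
      by (simp add: cvec.subspace_0[OF subspace_tensors] cvec.subspace_0[OF subspace_isotypic] X0)
  next
    fix x y assume "x \<in> {w \<in> tensors n. X w \<in> isotypic n \<mu>}"
        "y \<in> {w \<in> tensors n. X w \<in> isotypic n \<mu>}"
    then show "x + y \<in> {w \<in> tensors n. X w \<in> isotypic n \<mu>}"
      using X by (simp add: linear_on_def cvec.subspace_add[OF subspace_tensors]
          cvec.subspace_add[OF subspace_isotypic])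
  next
    fix c x assume "x \<in> {w \<in> tensors n. X w \<in> isotypic n \<mu>}"
    then show "c *\<^sub>C x \<in> {w \<in> tensors n. X w \<in> isotypic n \<mu>}"
      using X by (simp add: linear_on_def cvec.subspace_scale[OF subspace_tensors]
          cvec.subspace_scale[OF subspace_isotypic])
  qed
  then have "isotypic n \<mu> \<subseteq> {w \<in> tensors n. X w \<in> isotypic n \<mu>}"
    using gen
        by (subst (1) isotypic_def, intro cvec.span_minimal) (auto simp: tensor_mult_spaceD(4))
  then show ?thesis using w by blast
qed

lemma weyl_op_weyl:
  assumes g: "g \<in> orthogonal_group" and a: "a \<in> weyl_module \<mu>"
  shows "weyl_op (card \<mu>) g a \<in> weyl_module \<mu>"
proof -
  have T: "a x \<in> traceless (card \<mu>)" "a x \<in> tensors (card \<mu>)" for x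
    using weyl_module_range[OF a] traceless_tensors by blast+
  have lin: "group_op (card \<mu>) g (s + t) = group_op (card \<mu>) g s + group_op (card \<mu>) g t"
    "group_op (card \<mu>) g (c *\<^sub>C s) = c *\<^sub>C group_op (card \<mu>) g s"
    if "s \<in> tensors (card \<mu>)" "t \<in> tensors (card \<mu>)" for s t c
    using linear_on_group_op[of "card \<mu>" g] that unfolding linear_on_def by blast+
  show ?thesis
    using a T traceless_group_op[OF g] unfolding weyl_module_iff weyl_op_def linear_on_def
    by (auto simp: lin[OF T(2) T(2)] group_op_zero group_op_pact)
qed

lemma tensor_mult_space_comp:
  assumes H: "H \<in> centralizer n" and \<Phi>: "\<Phi> \<in> tensor_mult_space n \<mu>"
  shows "H \<circ> \<Phi> \<in> tensor_mult_space n \<mu>"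
proof -
  note D = tensor_mult_spaceD[OF \<Phi>]
  have lin: "linear_on (tensors n) (tensors n) H" and
    eq: "\<And>g t. g \<in> orthogonal_group \<Longrightarrow> t \<in> tensors n \<Longrightarrow> H (group_op n g t) = group_op n g (H t)"
    using H by (auto simp: centralizer_def hom_space_def)
  have H0: "H 0 = 0" using linear_on_sum[OF lin subspace_tensors, of "{}" "\<lambda>_. 0"] by simp
  have "linear_on (weyl_module \<mu>) (tensors n) (H \<circ> \<Phi>)"
    using D(1) lin unfolding linear_on_def by (auto simp: D(4))
  then show ?thesis
    unfolding tensor_mult_space_def hom_space_def by (simp add: D eq H0)
qed

definition iproj :: "nat \<Rightarrow> young \<Rightarrow> 'N::finite tensor_op" where
  "iproj n \<mu> = tproj n (isotypic n \<mu>)"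

text \<open>The orthogonal group preserves the isotypic component, because equivariant maps carry
  its action on the Weyl module to that on tensors.\<close>

lemma iproj_centralizer: "iproj n \<mu> \<in> centralizer n"
  unfolding iproj_def
proof (rule tproj_centralizer[OF subspace_isotypic isotypic_subset])
  fix g :: "complex ^ 'a ^ 'a" and w :: "'a tensor"
  assume g: "g \<in> orthogonal_group" and w: "w \<in> isotypic n \<mu>"
  have gen: "group_op n g (\<Phi> a) \<in> isotypic n \<mu>"
    if \<Phi>: "\<Phi> \<in> tensor_mult_space n \<mu>" and a: "a \<in> weyl_module \<mu>"
    for \<Phi> :: "(((nat \<Rightarrow> nat) \<Rightarrow> complex) \<Rightarrow> 'a tensor) \<Rightarrow> 'a tensor" and a
    using isotypicI[OF \<Phi> weyl_op_weyl[OF g a]] unfolding tensor_mult_spaceD(3)[OF \<Phi> g a] .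
  then have "group_op n g ` (\<Union>\<Phi>\<in>tensor_mult_space n \<mu>. \<Phi> ` weyl_module \<mu>) \<subseteq> isotypic n \<mu>"
    by auto
  from isotypic_invariant[OF linear_on_group_op this w] show "group_op n g w \<in> isotypic n \<mu>" .
qed

text \<open>The centralizer preserves the isotypic component too, since composing an equivariant map
  with a commuting operator gives an equivariant map.\<close>

lemma iproj_central: 
  assumes H: "H \<in> centralizer n"
  shows "iproj n \<mu> \<circ> H = H \<circ> iproj n \<mu>"
  unfolding iproj_def
proof (rule tproj_central[OF subspace_isotypic isotypic_subset _ H])
  fix X :: "'a tensor_op" and w :: "'a tensor" assume X: "X \<in> centralizer n"
      and w: "w \<in> isotypic n \<mu>"
  have lin: "linear_on (tensors n) (tensors n) X" using X
      by (auto simp: centralizer_def hom_space_def)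
  have gen: "X (\<Phi> a) \<in> isotypic n \<mu>" if \<Phi>: "\<Phi> \<in> tensor_mult_space n \<mu>" and a: "a \<in> weyl_module \<mu>"
    for \<Phi> :: "(((nat \<Rightarrow> nat) \<Rightarrow> complex) \<Rightarrow> 'a tensor) \<Rightarrow> 'a tensor" and a
  proof -
    have "X \<circ> \<Phi> \<in> tensor_mult_space n \<mu>" by (rule tensor_mult_space_comp[OF X \<Phi>])
    from isotypicI[OF this a] show ?thesis by (simp only: comp_apply)
  qed
  then have "X ` (\<Union>\<Phi>\<in>tensor_mult_space n \<mu>. \<Phi> ` weyl_module \<mu>) \<subseteq> isotypic n \<mu>" by auto
  from isotypic_invariant[OF lin this w] show "X w \<in> isotypic n \<mu>" .
qed

lemma isotypic_funs: "isotypic n \<mu> \<subseteq> funs (indices n)"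
  unfolding tensors_funs[symmetric] by (rule isotypic_subset)

lemma iproj_self:
  assumes \<Phi>: "\<Phi> \<in> tensor_mult_space n \<mu>"
  shows "iproj n \<mu> \<circ> \<Phi> = \<Phi>"
proof
  fix a
  have "\<Phi> a \<in> isotypic n \<mu>"
    using isotypicI[OF \<Phi>] tensor_mult_spaceD(2)[OF \<Phi>] cvec.subspace_0[OF subspace_isotypic]
    by (cases "a \<in> weyl_module \<mu>") auto
  then show "(iproj n \<mu> \<circ> \<Phi>) a = \<Phi> a"
    using tensor_mult_spaceD(4)[OF \<Phi>]
    by (simp add: iproj_def tproj_def proj_id[OF finite_indices subspace_isotypic isotypic_funs])
qed

text \<open>Images belonging to different shapes are orthogonal. As the centralizer acts on
  multiplicity spaces by composition, this reads off the action of the projection on the module of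
  another shape.\<close>

lemma iproj_other:
  assumes \<mu>: "young_diagram \<mu>" and \<nu>: "young_diagram \<nu>" and ne: "\<mu> \<noteq> \<nu>"
    and \<Psi>: "\<Psi> \<in> tensor_mult_space n \<nu>"
  shows "iproj n \<mu> \<circ> \<Psi> = 0"
proof
  fix b
  have "herm (indices n) (\<Psi> b) w = 0" if w: "w \<in> isotypic n \<mu>" for w
  proof (cases "b \<in> weyl_module \<nu>")
    case True
    have "cvec.subspace {w. herm (indices n) (\<Psi> b) w = 0}"
      by (rule cvec.subspaceI) (simp_all only: mem_Collect_eq herm_zero_right herm_add_right
          herm_scale_right, simp_all)
    moreover have "herm (indices n) (\<Psi> b) (\<Phi> a) = 0"
      if "\<Phi> \<in> tensor_mult_space n \<mu>" "a \<in> weyl_module \<mu>"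
      for \<Phi> :: "(((nat \<Rightarrow> nat) \<Rightarrow> complex) \<Rightarrow> 'a tensor) \<Rightarrow> 'a tensor" and a
      by (rule mult_space_orthogonal[OF \<nu> \<mu> ne[symmetric] \<Psi> that(1) True that(2)])
    then have "(\<Union>\<Phi>\<in>tensor_mult_space n \<mu>. \<Phi> ` weyl_module \<mu>) \<subseteq> {w. herm (indices n) (\<Psi> b) w = 0}"
      by auto
    ultimately have "isotypic n \<mu> \<subseteq> {w. herm (indices n) (\<Psi> b) w = 0}"
      unfolding isotypic_def by (intro cvec.span_minimal)
    then show ?thesis using w by blast
  qed (simp add: tensor_mult_spaceD(2)[OF \<Psi>] herm_zero_left)
  then have "proj (indices n) (isotypic n \<mu>) (\<Psi> b) = 0"
    by (rule proj_orthogonal[OF finite_indices subspace_isotypic isotypic_funs])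
  then show "(iproj n \<mu> \<circ> \<Psi>) b = 0 b"
    by (simp add: iproj_def tproj_def)
qed

section \<open>Subalgebras and the partial trace\<close>

text \<open>The matrix of the tensor product of \<open>A\<close> and \<open>B\<close> for the slots
  split after \<open>k\<close>. The second factor keeps the slot numbers \<open>{k+1..n}\<close>, so
  that \<open>restrict\<close> alone separates the two parts.\<close>

definition kprod :: "nat \<Rightarrow> nat \<Rightarrow> ((nat \<Rightarrow> 'N) \<Rightarrow> (nat \<Rightarrow> 'N) \<Rightarrow> complex) \<Rightarrow>
    ((nat \<Rightarrow> 'N) \<Rightarrow> (nat \<Rightarrow> 'N) \<Rightarrow> complex) \<Rightarrow> (nat \<Rightarrow> 'N) \<Rightarrow> (nat \<Rightarrow> 'N) \<Rightarrow> complex" where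
  "kprod k n A B i j
      = A (restrict i {1..k}) (restrict j {1..k}) * B (restrict i {k+1..n}) (restrict j {k+1..n})"

definition kid :: "'a \<Rightarrow> 'a \<Rightarrow> complex" where
  "kid x y = (if x = y then 1 else 0)"

lemma restrict_indices: "restrict i {1..k} \<in> indices k"
  by (simp add: indices_def)

lemma sum_indices_split:
  fixes f g :: "(nat \<Rightarrow> 'N::finite) \<Rightarrow> complex"
  assumes "k \<le> n"
  shows "(\<Sum>h\<in>indices n. f (restrict h {1..k}) * g (restrict h {k+1..n}))
    = (\<Sum>a\<in>indices k. f a) * (\<Sum>b\<in>{k+1..n} \<rightarrow>\<^sub>E UNIV. g b)"
proof -
  let ?m = "\<lambda>(a, b) l. if l \<in> {1..k} then a l else b l :: 'N"
  have "(\<Sum>h\<in>indices n. f (restrict h {1..k}) * g (restrict h {k+1..n}))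
      = (\<Sum>(a, b)\<in>indices k \<times> ({k+1..n} \<rightarrow>\<^sub>E UNIV). f a * g b)"
  proof (rule sum.reindex_bij_witness[where i = ?m
      and j = "\<lambda>h. (restrict h {1..k}, restrict h {k+1..n})"])
    fix h :: "nat \<Rightarrow> 'N" assume h: "h \<in> indices n"
    have "h l = undefined" if "l \<notin> {1..n}" for l
      using h that by (auto simp: indices_def PiE_iff extensional_def)
    then show "?m (restrict h {1..k}, restrict h {k+1..n}) = h"
      by (auto simp: fun_eq_iff)
    show "(restrict h {1..k}, restrict h {k+1..n}) \<in> indices k \<times> ({k+1..n} \<rightarrow>\<^sub>E UNIV)"
      using restrict_indices[of h k] by simp
  next
    fix p :: "(nat \<Rightarrow> 'N) \<times> (nat \<Rightarrow> 'N)" assume "p \<in> indices k \<times> ({k+1..n} \<rightarrow>\<^sub>E UNIV)"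
    then obtain a b where p: "p = (a, b)" and a: "a \<in> {1..k} \<rightarrow>\<^sub>E UNIV"
        and b: "b \<in> {k+1..n} \<rightarrow>\<^sub>E UNIV"
      by (auto simp: indices_def)
    have au: "a l = undefined" if "l \<notin> {1..k}" for l by (rule PiE_arb[OF a that])
    have bu: "b l = undefined" if "l \<notin> {k+1..n}" for l by (rule PiE_arb[OF b that])
    have "restrict (?m p) {1..k} = a" using au by (auto simp: fun_eq_iff p restrict_def)
    moreover have "restrict (?m p) {k+1..n} = b" using bu by (auto simp: fun_eq_iff p restrict_def)
    ultimately show "(restrict (?m p) {1..k}, restrict (?m p) {k+1..n}) = p" by (simp add: p)
    show "?m p \<in> indices n"
      unfolding indices_def by (rule PiE_I) (use assms bu in \<open>auto simp: p\<close>)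
  qed simp
  then show ?thesis by (simp add: sum_product sum.cartesian_product)
qed

lemma kmul_kprod:
  fixes A B A' B' :: "(nat \<Rightarrow> 'N::finite) \<Rightarrow> (nat \<Rightarrow> 'N) \<Rightarrow> complex"
  assumes "k \<le> n"
  shows "kmul n (kprod k n A B) (kprod k n A' B') i j
    = kmul k A A' (restrict i {1..k}) (restrict j {1..k})
      * (\<Sum>b\<in>{k+1..n} \<rightarrow>\<^sub>E UNIV. B (restrict i {k+1..n}) b * B' b (restrict j {k+1..n}))"
proof -
  have "kmul n (kprod k n A B) (kprod k n A' B') i j
      = (\<Sum>h\<in>indices n. (A (restrict i {1..k}) (restrict h {1..k}) * A' (restrict h {1..k})
          (restrict j {1..k}))
          * (B (restrict i {k+1..n}) (restrict h {k+1..n}) * B' (restrict h {k+1..n}) (restrict j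
              {k+1..n})))"
    unfolding kmul_def kprod_def by (intro sum.cong refl) (simp only: mult_ac)
  also have "\<dots> = kmul k A A' (restrict i {1..k}) (restrict j {1..k})
      * (\<Sum>b\<in>{k+1..n} \<rightarrow>\<^sub>E UNIV. B (restrict i {k+1..n}) b * B' b (restrict j {k+1..n}))"
    unfolding kmul_def by (rule sum_indices_split[OF assms])
  finally show ?thesis .
qed

lemma sum_kid_left: "finite S \<Longrightarrow> x \<in> S \<Longrightarrow> (\<Sum>b\<in>S. kid x b * f b) = f x"
  and sum_kid_right: "finite S \<Longrightarrow> x \<in> S \<Longrightarrow> (\<Sum>b\<in>S. f b * kid b x) = f x"
  by (simp_all add: kid_def if_distrib[of "\<lambda>z. z * _"] if_distrib[of "\<lambda>z. _ * z"] cong: if_cong)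

lemma kmul_kid:
  "i \<in> indices k \<Longrightarrow> kmul k kid A i j = A i j" "j \<in> indices k \<Longrightarrow> kmul k A kid i j = A i j"
  unfolding kmul_def by (rule sum_kid_left sum_kid_right; simp)+

lemma gker_kprod: "k \<le> n \<Longrightarrow> gker {1..n} g = kprod k n (gker {1..k} g) (gker {k+1..n} g)"
proof (intro ext)
  fix i j assume "k \<le> n"
  then have "{1..n} = {1..k} \<union> {k+1..n}" by auto
  then have "gker {1..n} g i j = gker {1..k} g i j * gker {k+1..n} g i j"
    unfolding gker_def by (simp only:) (rule prod.union_disjoint, auto)
  then show "gker {1..n} g i j = kprod k n (gker {1..k} g) (gker {k+1..n} g) i j"
    by (simp add: gker_def kprod_def)
qed

text \<open>The inclusion of the smaller algebra is tensoring with the identity; henceforth it is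
  computed on matrices.\<close>

lemma embed_op_kop:
  fixes K :: "(nat \<Rightarrow> 'N::finite) \<Rightarrow> (nat \<Rightarrow> 'N) \<Rightarrow> complex"
  assumes kn: "k \<le> n"
  shows "embed_op k n (kop k K) = kop n (kprod k n K kid)"
proof
  fix t :: "'N tensor"
  show "embed_op k n (kop k K) t = kop n (kprod k n K kid) t"
  proof (cases "t \<in> tensors n")
    case t: True
    show ?thesis
    proof (rule tensor_eqI[of _ n])
      show "embed_op k n (kop k K) t \<in> tensors n"
        using t by (simp add: embed_op_def tensors_def)
      fix i :: "nat \<Rightarrow> 'N" assume i: "i \<in> indices n"
      let ?m = "\<lambda>j l. if l \<in> {1..k} then j l else i l"
      define s where "s = (\<lambda>j. if j \<in> indices k then t (?m j) else 0)"
      have s: "s \<in> tensors k" by (simp add: s_def tensors_def)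
      have iu: "i l = undefined" if "l \<notin> {1..n}" for l
        using i that by (auto simp: indices_def PiE_iff extensional_def)
      have "embed_op k n (kop k K) t i = kop k K s (restrict i {1..k})"
        using t i by (simp add: embed_op_def s_def)
      also have "\<dots> = (\<Sum>j\<in>indices k. K (restrict i {1..k}) j * t (?m j))"
        unfolding kop_apply[OF s restrict_indices] by (rule sum.cong[OF refl]) (simp add: s_def)
      also have "\<dots> = (\<Sum>h\<in>{h \<in> indices n. restrict i {k+1..n} = restrict h {k+1..n}}.
          K (restrict i {1..k}) (restrict h {1..k}) * t h)"
      proof (rule sum.reindex_bij_witness[where i = "\<lambda>h. restrict h {1..k}" and j = ?m])
        fix j :: "nat \<Rightarrow> 'N" assume j: "j \<in> indices k"
        then have ju: "j l = undefined" if "l \<notin> {1..k}" for l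
          using that by (auto simp: indices_def PiE_iff extensional_def)
        show "restrict (?m j) {1..k} = j" using ju by (auto simp: fun_eq_iff restrict_def)
        then show "K (restrict i {1..k}) (restrict (?m j) {1..k}) * t (?m j)
            = K (restrict i {1..k}) j * t (?m j)"
          by simp
        have "?m j \<in> indices n"
          unfolding indices_def by (rule PiE_I) (use kn iu in auto)
        moreover have "restrict i {k+1..n} = restrict (?m j) {k+1..n}" by (auto simp: restrict_def)
        ultimately show "?m j \<in> {h \<in> indices n. restrict i {k+1..n} = restrict h {k+1..n}}" by blast
      next
        fix h :: "nat \<Rightarrow> 'N" assume "h \<in> {h \<in> indices n. restrict i {k+1..n} = restrict h {k+1..n}}"
        then have h: "h \<in> indices n" and e: "restrict i {k+1..n} = restrict h {k+1..n}" by auto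
        show "restrict h {1..k} \<in> indices k" by (rule restrict_indices)
        have hu: "h l = undefined" if "l \<notin> {1..n}" for l
          using h that by (auto simp: indices_def PiE_iff extensional_def)
        show "?m (restrict h {1..k}) = h"
        proof
          fix l
          show "?m (restrict h {1..k}) l = h l"
            using iu[of l] hu[of l] fun_cong[OF e, of l]
                by (cases "l \<in> {1..k}"; cases "l \<in> {1..n}") auto
        qed
      qed
      also have "\<dots> = (\<Sum>h\<in>indices n. if restrict i {k+1..n} = restrict h {k+1..n}
          then K (restrict i {1..k}) (restrict h {1..k}) * t h else 0)"
        by (rule sum.inter_filter) simp
      also have "\<dots> = kop n (kprod k n K kid) t i"
        unfolding kop_apply[OF t i] by (intro sum.cong refl) (simp add: kprod_def kid_def)
      finally show "embed_op k n (kop k K) t i = kop n (kprod k n K kid) t i" .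
    qed (rule kop_tensors)
  next
    case False
    then show ?thesis by (simp add: embed_op_def kop_def)
  qed
qed

lemma kmul_kprod_kid:
  assumes "k \<le> n"
  shows "kmul n (kprod k n K kid) (kprod k n L B) i j = kprod k n (kmul k K L) B i j"
    and "kmul n (kprod k n L B) (kprod k n K kid) i j = kprod k n (kmul k L K) B i j"
proof -
  have "(\<Sum>b\<in>{k+1..n} \<rightarrow>\<^sub>E UNIV. kid (restrict i {k+1..n}) b * B b (restrict j {k+1..n}))
      = B (restrict i {k+1..n}) (restrict j {k+1..n})"
    by (rule sum_kid_left) (simp_all add: finite_PiE)
  then show "kmul n (kprod k n K kid) (kprod k n L B) i j = kprod k n (kmul k K L) B i j"
    by (simp only: kmul_kprod[OF assms] kprod_def)
  have "(\<Sum>b\<in>{k+1..n} \<rightarrow>\<^sub>E UNIV. B (restrict i {k+1..n}) b * kid b (restrict j {k+1..n}))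
      = B (restrict i {k+1..n}) (restrict j {k+1..n})"
    by (rule sum_kid_right) (simp_all add: finite_PiE)
  then show "kmul n (kprod k n L B) (kprod k n K kid) i j = kprod k n (kmul k L K) B i j"
    by (simp only: kmul_kprod[OF assms] kprod_def)
qed

lemma gcommutes_embed:
  assumes "k \<le> n" "gcommutes k K"
  shows "gcommutes n (kprod k n K kid)"
  unfolding gcommutes_def gker_kprod[OF assms(1)] kmul_kprod_kid[OF assms(1)]
  using assms(2) by (simp add: kprod_def gcommutes_def restrict_indices[simplified])

lemma centralizer_kernel:
  assumes "F \<in> centralizer n"
  obtains K where "F = kop n K" "gcommutes n K"
  using centralizer_kop[OF assms] kop_centralizer_iff assms by metis

lemma embed_op_centralizer:
  assumes "k \<le> n" "F \<in> centralizer k"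
  shows "embed_op k n F \<in> centralizer n"
proof -
  obtain K where K: "F = kop k K" "gcommutes k K" by (rule centralizer_kernel[OF assms(2)])
  then show ?thesis
    by (simp only: embed_op_kop[OF assms(1)] kop_centralizer_iff gcommutes_embed[OF assms(1)])
qed

lemma embed_op_comp:
  assumes "k \<le> n" "F \<in> centralizer k" "H \<in> centralizer k"
  shows "embed_op k n (F \<circ> H) = embed_op k n F \<circ> embed_op k n H"
proof -
  obtain K where K: "F = kop k K" by (rule centralizer_kernel[OF assms(2)])
  obtain L where L: "H = kop k L" by (rule centralizer_kernel[OF assms(3)])
  show ?thesis
    unfolding K L kop_comp embed_op_kop[OF assms(1)]
    by (rule kop_cong) (simp only: kmul_kprod_kid[OF assms(1)])
qed

lemma brauer_op_sbar:
  assumes "k \<in> {1..n - 1}"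
  shows "brauer_op n (sbar n k) = kop n (bker n k (k + 1))"
  unfolding sbar_def by (rule brauer_op_bar_kop) (use assms in auto)

text \<open>For \<open>l < k\<close> the slots \<open>k\<close> and \<open>k + 1\<close> both come
  after the first \<open>l\<close>, so the two operators act on complementary tensor
  factors.\<close>

lemma embed_op_bar_commute_low:
  assumes k: "k \<in> {1..n - 1}" and l: "l < k" and F: "F \<in> centralizer l"
  shows "embed_op l n F \<circ> brauer_op n (sbar n k) = brauer_op n (sbar n k) \<circ> embed_op l n F"
proof -
  obtain K where K: "F = kop l K" by (rule centralizer_kernel[OF F])
  have ln: "l \<le> n" using k l by auto
  define B :: "(nat \<Rightarrow> 'a) \<Rightarrow> (nat \<Rightarrow> 'a) \<Rightarrow> complex" where
    "B i j = (if i k = i (k + 1) \<and> j k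
        = j (k + 1) \<and> (\<forall>m\<in>{l+1..n} - {k, k + 1}. i m = j m) then 1 else 0)" for i j
  have b: "bker n k (k + 1) = kprod l n kid B"
  proof (intro ext)
    fix i j :: "nat \<Rightarrow> 'a"
    let ?R = "{l+1..n}"
    have kk: "k \<in> ?R" "k + 1 \<in> ?R" using k l by auto
    have "{1..n} - {k, k + 1} = {1..l} \<union> (?R - {k, k + 1})" using k l by auto
    then have split: "(\<forall>m\<in>{1..n} - {k, k + 1}. i m = j m) \<longleftrightarrow>
        (\<forall>m\<in>{1..l}. i m = j m) \<and> (\<forall>m\<in>?R - {k, k + 1}. i m = j m)"
      by (simp only: ball_Un)
    have low: "restrict i {1..l} = restrict j {1..l} \<longleftrightarrow> (\<forall>m\<in>{1..l}. i m = j m)"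
      by (auto simp: restrict_def fun_eq_iff)
    have high: "(\<forall>m\<in>?R - {k, k + 1}. restrict i ?R m = restrict j ?R m) \<longleftrightarrow>
        (\<forall>m\<in>?R - {k, k + 1}. i m = j m)"
      by (intro ball_cong refl) simp
    have "(if P \<and> Q \<and> A \<and> B then 1 else 0)
        = (if A then 1 else 0) * (if P \<and> Q \<and> B then 1 else (0::complex))"
      for P Q A B by simp
    then show "bker n k (k + 1) i j = kprod l n kid B i j"
      unfolding bker_def kprod_def kid_def B_def split low high restrict_apply'[OF kk(1)]
          restrict_apply'[OF kk(2)] .
  qed
  show ?thesis
    unfolding K brauer_op_sbar[OF k] embed_op_kop[OF ln] kop_comp b kmul_kprod_kid[OF ln]
    by (rule kop_cong) (simp only: kmul_kprod_kid[OF ln] kprod_def kmul_kid restrict_indices)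
qed

lemma brauer_op_sbar_embed:
  assumes k: "k \<in> {1..n - 1}" and l: "k < l" "l \<le> n"
  shows "brauer_op n (sbar n k) = embed_op l n (kop l (bker l k (k + 1)) :: 'N::finite tensor_op)"
proof -
  have "(bker n k (k + 1) :: (nat \<Rightarrow> 'N) \<Rightarrow> _) = kprod l n (bker l k (k + 1)) kid"
  proof (intro ext)
    fix i j :: "nat \<Rightarrow> 'N"
    have kk: "k \<in> {1..l}" "k + 1 \<in> {1..l}" using k l by auto
    have "{1..n} - {k, k + 1} = ({1..l} - {k, k + 1}) \<union> {l+1..n}" using k l by auto
    then have split: "(\<forall>m\<in>{1..n} - {k, k + 1}. i m = j m) \<longleftrightarrow>
        (\<forall>m\<in>{1..l} - {k, k + 1}. i m = j m) \<and> (\<forall>m\<in>{l+1..n}. i m = j m)"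
      by (simp only: ball_Un)
    have high: "restrict i {l+1..n} = restrict j {l+1..n} \<longleftrightarrow> (\<forall>m\<in>{l+1..n}. i m = j m)"
      by (auto simp: restrict_def fun_eq_iff)
    have low: "(\<forall>m\<in>{1..l} - {k, k + 1}. restrict i {1..l} m = restrict j {1..l} m) \<longleftrightarrow>
        (\<forall>m\<in>{1..l} - {k, k + 1}. i m = j m)"
      by (intro ball_cong refl) simp
    have "(if P \<and> Q \<and> A \<and> B then 1 else 0)
        = (if P \<and> Q \<and> A then 1 else 0) * (if B then 1 else (0::complex))"
      for P Q A B by simp
    then show "bker n k (k + 1) i j = kprod l n (bker l k (k + 1)) kid i j"
      unfolding bker_def kprod_def kid_def split low high restrict_apply'[OF kk(1)]
          restrict_apply'[OF kk(2)] .
  qed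
  then show ?thesis unfolding brauer_op_sbar[OF k] embed_op_kop[OF l(2)] by simp
qed

text \<open>For \<open>l > k\<close> the slots \<open>k\<close> and \<open>k + 1\<close> are among
  the first \<open>l\<close>, so \<open>sbar\<close> comes from the centralizer on \<open>l\<close>
  factors and the centrality of \<open>F\<close> applies.\<close>

lemma embed_op_bar_commute_high:
  assumes k: "k \<in> {1..n - 1}" and l: "k < l" "l \<le> n" and F: "F \<in> centralizer l"
    and central: "\<And>H. H \<in> centralizer l \<Longrightarrow> F \<circ> H = H \<circ> F"
  shows "embed_op l n F \<circ> brauer_op n (sbar n k) = brauer_op n (sbar n k) \<circ> embed_op l n F"
proof -
  have c: "kop l (bker l k (k + 1)) \<in> centralizer l"
    by (rule kop_bker_centralizer) (use k l in auto)
  show ?thesis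
    unfolding brauer_op_sbar_embed[OF k l] embed_op_comp[OF l(2) F c, symmetric]
      embed_op_comp[OF l(2) c F, symmetric] central[OF c] ..
qed

lemma brauer_op_sbar_centralizer: "k \<in> {1..n - 1} \<Longrightarrow> brauer_op n (sbar n k) \<in> centralizer n"
  unfolding brauer_op_sbar by (rule kop_bker_centralizer) auto

section \<open>Partial trace over the last of \<open>k\<close> tensor factors\<close>

definition ptr :: "nat \<Rightarrow> ((nat \<Rightarrow> 'N::finite) \<Rightarrow> (nat \<Rightarrow> 'N) \<Rightarrow> complex) \<Rightarrow>
    (nat \<Rightarrow> 'N) \<Rightarrow> (nat \<Rightarrow> 'N) \<Rightarrow> complex" where
  "ptr k K i j = (\<Sum>a\<in>UNIV. K (i(k := a)) (j(k := a)))"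

lemma sum_indices_Suc:
  fixes X :: "(nat \<Rightarrow> 'N::finite) \<Rightarrow> complex"
  shows "(\<Sum>h\<in>indices (Suc m). X h) = (\<Sum>h\<in>indices m. \<Sum>c\<in>UNIV. X (h(Suc m := c)))"
proof -
  have "(\<Sum>h\<in>indices (Suc m). X h) = (\<Sum>(h, c)\<in>indices m \<times> UNIV. X (h(Suc m := c)))"
  proof (rule sum.reindex_bij_witness[where i = "\<lambda>(h, c). h(Suc m := c)"
        and j = "\<lambda>h. (h(Suc m := undefined), h (Suc m))"])
    fix h :: "nat \<Rightarrow> 'N" assume h: "h \<in> indices (Suc m)"
    show "(h(Suc m := undefined), h (Suc m)) \<in> indices m \<times> UNIV"
      using h by (auto simp: indices_def PiE_iff extensional_def)
  next
    fix p :: "(nat \<Rightarrow> 'N) \<times> 'N" assume p: "p \<in> indices m \<times> UNIV"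
    have u: "fst p (Suc m) = undefined" using p by (auto simp: indices_def PiE_iff extensional_def)
    show "(case p of (h, c) \<Rightarrow> h(Suc m := c)) \<in> indices (Suc m)"
      using p by (auto simp: indices_def PiE_iff extensional_def)
    show "((case p of (h, c) \<Rightarrow> h(Suc m := c))(Suc m := undefined),
        (case p of (h, c) \<Rightarrow> h(Suc m := c)) (Suc m)) = p"
      using u by (cases p) (simp add: fun_upd_idem)
  qed simp_all
  then show ?thesis by (simp add: sum.cartesian_product)
qed

lemma gker_Suc:
  "gker {1..Suc m} g (i(Suc m := a)) (j(Suc m := b)) = gker {1..m} g i j * g $ a $ b"
  unfolding gker_def by (simp add: prod.nat_ivl_Suc' mult.commute)

lemma indices_Suc_upd: "i \<in> indices m \<Longrightarrow> i(Suc m := a) \<in> indices (Suc m)"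
  by (auto simp: indices_def PiE_iff extensional_def)

text \<open>The trace identifies the two indices of the last slot. Writing this identification as an
  inner product of rows of \<open>g\<close> supplies the missing factor for that slot, so that
  commutation on \<open>Suc m\<close> factors applies; orthonormality of the columns removes the
  extra factor on the other side.\<close>

lemma gcommutes_ptr:
  fixes K :: "(nat \<Rightarrow> 'N::finite) \<Rightarrow> (nat \<Rightarrow> 'N) \<Rightarrow> complex"
  assumes K: "gcommutes (Suc m) K"
  shows "gcommutes m (ptr (Suc m) K)"
  unfolding gcommutes_def
proof (intro ballI)
  fix g :: "complex ^ 'N ^ 'N" and i j :: "nat \<Rightarrow> 'N"
  assume g: "g \<in> orthogonal_group" and ij: "i \<in> indices m" "j \<in> indices m"
  let ?G = "gker {1..m} g" and ?k = "Suc m"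
  have orth: "(\<Sum>c\<in>UNIV. g $ c $ a * g $ c $ b) = (if a = b then 1 else 0)"
    "(\<Sum>c\<in>UNIV. g $ a $ c * g $ b $ c) = (if a = b then 1 else 0)" for a b
    using g by (auto simp: orthogonal_group_def orthogonal_matrix_iff)
  have eq: "(\<Sum>h\<in>indices m. \<Sum>c\<in>UNIV. K (i(?k := a)) (h(?k := c)) * (?G h j * g $ c $ b))
      = (\<Sum>h\<in>indices m. \<Sum>c\<in>UNIV. ?G i h * g $ a $ c * K (h(?k := c)) (j(?k := b)))" for a b
  proof -
    have "kmul ?k K (gker {1..?k} g) (i(?k := a)) (j(?k := b))
        = kmul ?k (gker {1..?k} g) K (i(?k := a)) (j(?k := b))"
      by (rule K[unfolded gcommutes_def, rule_format, OF g indices_Suc_upd[OF ij(1)]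
          indices_Suc_upd[OF ij(2)]])
    then show ?thesis unfolding kmul_def sum_indices_Suc gker_Suc .
  qed
  have "kmul m (ptr ?k K) ?G i j
      = (\<Sum>a\<in>UNIV. \<Sum>h\<in>indices m. \<Sum>c\<in>UNIV. K (i(?k := a)) (h(?k := c)) * ?G h j * (\<Sum>b\<in>UNIV. g $ c $
          b * g $ a $ b))"
    unfolding orth kmul_def ptr_def
    by (subst sum.swap) (simp add: sum_distrib_right if_distrib[of "\<lambda>z. _ * z"] cong: if_cong)
  also have "\<dots> = (\<Sum>a\<in>UNIV. \<Sum>b\<in>UNIV. g $ a $ b *
      (\<Sum>h\<in>indices m. \<Sum>c\<in>UNIV. K (i(?k := a)) (h(?k := c)) * (?G h j * g $ c $ b)))"
  proof (rule sum.cong[OF refl])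
    fix a
    have "(\<Sum>h\<in>indices m. \<Sum>c\<in>UNIV. K (i(?k := a)) (h(?k := c)) * ?G h j
        * (\<Sum>b\<in>UNIV. g $ c $ b * g $ a $ b))
        = (\<Sum>h\<in>indices m. \<Sum>c\<in>UNIV. \<Sum>b\<in>UNIV. g $ a $ b * (K (i(?k := a)) (h(?k := c)) * (?G h j * g
            $ c $ b)))"
      unfolding sum_distrib_left by (intro sum.cong refl) (simp only: mult_ac)
    also have "\<dots>
        = (\<Sum>h\<in>indices m. \<Sum>b\<in>UNIV. \<Sum>c\<in>UNIV. g $ a $ b * (K (i(?k := a)) (h(?k := c)) * (?G h j * g
            $ c $ b)))"
      by (rule sum.cong[OF refl]) (rule sum.swap)
    also have "\<dots>
        = (\<Sum>b\<in>UNIV. \<Sum>h\<in>indices m. \<Sum>c\<in>UNIV. g $ a $ b * (K (i(?k := a)) (h(?k := c)) * (?G h j * g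
            $ c $ b)))"
      by (rule sum.swap)
    finally show "(\<Sum>h\<in>indices m. \<Sum>c\<in>UNIV. K (i(?k := a)) (h(?k := c)) * ?G h j
        * (\<Sum>b\<in>UNIV. g $ c $ b * g $ a $ b))
        = (\<Sum>b\<in>UNIV. g $ a $ b * (\<Sum>h\<in>indices m. \<Sum>c\<in>UNIV. K (i(?k := a)) (h(?k := c)) * (?G h j * g
            $ c $ b)))"
      by (simp only: sum_distrib_left)
  qed
  also have "\<dots> = (\<Sum>b\<in>UNIV. \<Sum>a\<in>UNIV. g $ a $ b *
      (\<Sum>h\<in>indices m. \<Sum>c\<in>UNIV. ?G i h * g $ a $ c * K (h(?k := c)) (j(?k := b))))"
    unfolding eq by (rule sum.swap)
  also have "\<dots> = (\<Sum>b\<in>UNIV. \<Sum>h\<in>indices m. \<Sum>c\<in>UNIV.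
      ?G i h * K (h(?k := c)) (j(?k := b)) * (\<Sum>a\<in>UNIV. g $ a $ c * g $ a $ b))"
  proof (rule sum.cong[OF refl])
    fix b
    have "(\<Sum>a\<in>UNIV. g $ a $ b
        * (\<Sum>h\<in>indices m. \<Sum>c\<in>UNIV. ?G i h * g $ a $ c * K (h(?k := c)) (j(?k := b))))
        = (\<Sum>a\<in>UNIV. \<Sum>h\<in>indices m. \<Sum>c\<in>UNIV. ?G i h * K (h(?k := c)) (j(?k := b)) * (g $ a $ c * g $
            a $ b))"
      unfolding sum_distrib_left by (intro sum.cong refl) (simp only: mult_ac)
    also have "\<dots>
        = (\<Sum>h\<in>indices m. \<Sum>a\<in>UNIV. \<Sum>c\<in>UNIV. ?G i h * K (h(?k := c)) (j(?k := b)) * (g $ a $ c * g $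
            a $ b))"
      by (rule sum.swap)
    also have "\<dots>
        = (\<Sum>h\<in>indices m. \<Sum>c\<in>UNIV. \<Sum>a\<in>UNIV. ?G i h * K (h(?k := c)) (j(?k := b)) * (g $ a $ c * g $
            a $ b))"
      by (rule sum.cong[OF refl]) (rule sum.swap)
    finally show "(\<Sum>a\<in>UNIV. g $ a $ b
        * (\<Sum>h\<in>indices m. \<Sum>c\<in>UNIV. ?G i h * g $ a $ c * K (h(?k := c)) (j(?k := b))))
        = (\<Sum>h\<in>indices m. \<Sum>c\<in>UNIV. ?G i h * K (h(?k := c)) (j(?k := b)) * (\<Sum>a\<in>UNIV. g $ a $ c * g $
            a $ b))"
      by (simp only: sum_distrib_left)
  qed
  also have "\<dots> = kmul m ?G (ptr ?k K) i j"
    unfolding orth kmul_def ptr_def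
    by (subst sum.swap) (simp add: sum_distrib_left if_distrib[of "\<lambda>z. _ * z"] cong: if_cong)
  finally show "kmul m (ptr ?k K) ?G i j = kmul m ?G (ptr ?k K) i j" .
qed

lemma kop_eq_iff:
  "kop n K = kop n L \<longleftrightarrow> (\<forall>i\<in>indices n. \<forall>j\<in>indices n. K i j = L i j)"
  using kop_delta[of _ n _ K] kop_delta[of _ n _ L] kop_cong[of n K L] by metis

lemma kmul_bker_left:
  fixes i :: "nat \<Rightarrow> 'N::finite"
  assumes "k \<in> {1..n}" "l \<in> {1..n}" "k \<noteq> l" "i \<in> indices n"
  shows "kmul n (bker n k l) X i j = (if i k = i l then \<Sum>a\<in>UNIV. X (i(k := a, l := a)) j else 0)"
  unfolding kmul_def by (rule bker_sum[OF assms])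

lemma kmul_bker_right:
  fixes i :: "nat \<Rightarrow> 'N::finite"
  assumes "k \<in> {1..n}" "l \<in> {1..n}" "k \<noteq> l" "j \<in> indices n"
  shows "kmul n X (bker n k l) i j = (if j k = j l then \<Sum>a\<in>UNIV. X i (j(k := a, l := a)) else 0)"
  unfolding kmul_def mult.commute[of "X i _"] bker_sym[of n k l _ j] by (rule bker_sum[OF assms])

text \<open>The outer factors produce sums over a common value \<open>a\<close> at slots
  \<open>k\<close>, \<open>k + 1\<close> on the left and \<open>b\<close> on the right. The identity
  acting in slot \<open>k + 1\<close> forces \<open>a = b\<close>, and the double sum collapses to
  the partial trace over slot \<open>k\<close>. Off these two slots everything is as for a single
  factor \<open>bker\<close>.\<close>

lemma bker_sandwich:
  fixes K :: "(nat \<Rightarrow> 'N::finite) \<Rightarrow> (nat \<Rightarrow> 'N) \<Rightarrow> complex"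
    and m :: nat
  defines "k \<equiv> Suc m"
  assumes k: "Suc k \<le> n" and i: "i \<in> indices n" and j: "j \<in> indices n"
  shows "kmul n (bker n k (k + 1)) (kmul n (kprod k n K kid) (bker n k (k + 1))) i j
    = kmul n (kprod m n (ptr k K) kid) (bker n k (k + 1)) i j"
proof -
  have kn: "k \<in> {1..n}" "k + 1 \<in> {1..n}" "k \<noteq> k + 1" using k by (auto simp: k_def)
  let ?u = "\<lambda>i a. i(k := a, k + 1 := a) :: nat \<Rightarrow> 'N"
  define R where "R \<longleftrightarrow> (\<forall>l\<in>{k+2..n}. i l = j l)"
  have res: "restrict (?u i a) {1..k} = (restrict i {1..m})(k := a)" for i a
    by (auto simp: k_def restrict_def fun_eq_iff)
  have res': "restrict (?u i a) {1..m} = restrict i {1..m}" for i a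
    by (auto simp: k_def restrict_def fun_eq_iff)
  have tail: "restrict x {l..n} = restrict y {l..n} \<longleftrightarrow> (\<forall>q\<in>{l..n}. x q = y q)"
      for x y :: "nat \<Rightarrow> 'N" and l
    by (auto simp: restrict_def fun_eq_iff)
  have up: "{k+1..n} = insert (k+1) {k+2..n}" "{m+1..n} = insert k (insert (k+1) {k+2..n})"
    using k by (auto simp: k_def)
  have t1: "restrict (?u i a) {k+1..n} = restrict (?u j b) {k+1..n} \<longleftrightarrow> a = b \<and> R" for a b
  proof -
    have "(\<forall>q\<in>{k+2..n}. ?u i a q = ?u j b q) \<longleftrightarrow> R" unfolding R_def by (intro ball_cong refl) auto
    then show ?thesis unfolding tail unfolding up(1) by (simp only: ball_simps fun_upd_same)
  qed
  have t2: "restrict i {m+1..n} = restrict (?u j b) {m+1..n} \<longleftrightarrow> i k = b \<and> i (k+1) = b \<and> R" for b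
  proof -
    have "(\<forall>q\<in>{k+2..n}. i q = ?u j b q) \<longleftrightarrow> R" unfolding R_def by (intro ball_cong refl) auto
    then show ?thesis unfolding tail unfolding up(2) by (simp only: ball_simps) simp
  qed
  have "kmul n (bker n k (k + 1)) (kmul n (kprod k n K kid) (bker n k (k + 1))) i j
      = (if i k = i (k+1) then \<Sum>a\<in>UNIV. if j k = j (k+1) then
          \<Sum>b\<in>UNIV. kprod k n K kid (?u i a) (?u j b) else 0 else 0)"
    unfolding kmul_bker_left[OF kn i] kmul_bker_right[OF kn j] ..
  also have "\<dots> = (if i k = i (k+1) \<and> j k = j (k+1) \<and> R
      then ptr k K (restrict i {1..m}) (restrict j {1..m}) else 0)"
    unfolding kprod_def kid_def t1 res ptr_def
    by (auto simp: if_distrib[of "\<lambda>z. _ * z"] cong: if_cong)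
  also have "\<dots> = (if j k = j (k+1) then
      \<Sum>b\<in>UNIV. kprod m n (ptr k K) kid i (?u j b) else 0)"
  proof -
    have "(\<Sum>b\<in>UNIV. x * (if i k = b \<and> i (k+1) = b \<and> R then 1 else 0))
        = (if i k = i (k+1) \<and> R then x else 0)" for x :: complex
    proof -
      have "(\<Sum>b\<in>UNIV. x * (if i k = b \<and> i (k+1) = b \<and> R then 1 else 0))
          = (\<Sum>b\<in>UNIV. if b = i k then if i k = i (k+1) \<and> R then x else 0 else 0)"
        by (intro sum.cong refl) auto
      then show ?thesis by simp
    qed
    then show ?thesis unfolding kprod_def kid_def t2 res' by auto
  qed
  also have "\<dots> = kmul n (kprod m n (ptr k K) kid) (bker n k (k + 1)) i j"
    unfolding kmul_bker_right[OF kn j] ..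
  finally show ?thesis .
qed

text \<open>An operator acting as the identity in the last slot can be pulled through the trace over
  that slot; so the partial trace of a central element is central.\<close>

lemma ptr_commute:
  fixes K L :: "(nat \<Rightarrow> 'N::finite) \<Rightarrow> (nat \<Rightarrow> 'N) \<Rightarrow> complex"
    and m :: nat
  defines "k \<equiv> Suc m"
  assumes eq: "\<And>i j. i \<in> indices k \<Longrightarrow> j \<in> indices k \<Longrightarrow>
      kmul k K (kprod m k L kid) i j = kmul k (kprod m k L kid) K i j"
    and i: "i \<in> indices m" and j: "j \<in> indices m"
  shows "kmul m (ptr k K) L i j = kmul m L (ptr k K) i j"
proof -
  have res: "restrict (h(k := c)) {1..m} = h" if "h \<in> indices m" for h :: "nat \<Rightarrow> 'N" and c
    using that by (auto simp: k_def fun_eq_iff indices_def PiE_iff extensional_def)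
  have sing: "{m+1..k} = {k}" by (auto simp: k_def)
  have kp: "kprod m k L kid (h(k := c)) (h'(k := c')) = (if c = c' then L h h' else 0)"
    if "h \<in> indices m" "h' \<in> indices m" for h h' c c'
  proof -
    have "restrict (h(k := c)) {k} = restrict (h'(k := c')) {k} \<longleftrightarrow> c = c'"
      by (auto simp: fun_eq_iff)
    then show ?thesis unfolding kprod_def kid_def sing res[OF that(1)] res[OF that(2)] by simp
  qed
  have "kmul m (ptr k K) L i j = (\<Sum>a\<in>UNIV. \<Sum>h\<in>indices m. K (i(k := a)) (h(k := a)) * L h j)"
    unfolding kmul_def ptr_def sum_distrib_right by (rule sum.swap)
  also have "\<dots> = (\<Sum>a\<in>UNIV. kmul k K (kprod m k L kid) (i(k := a)) (j(k := a)))"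
  proof (rule sum.cong[OF refl])
    fix a
    have "kmul k K (kprod m k L kid) (i(k := a)) (j(k := a))
        = (\<Sum>h\<in>indices m. \<Sum>c\<in>UNIV. K (i(k := a)) (h(k := c)) * (if c = a then L h j else 0))"
      unfolding kmul_def k_def sum_indices_Suc
      by (intro sum.cong refl) (simp add: kp[unfolded k_def] j)
    also have "\<dots> = (\<Sum>h\<in>indices m. K (i(k := a)) (h(k := a)) * L h j)"
      by (simp add: if_distrib[of "\<lambda>z. _ * z"] cong: if_cong)
    finally show "(\<Sum>h\<in>indices m. K (i(k := a)) (h(k := a)) * L h j)
        = kmul k K (kprod m k L kid) (i(k := a)) (j(k := a))" by simp
  qed
  also have "\<dots> = (\<Sum>a\<in>UNIV. kmul k (kprod m k L kid) K (i(k := a)) (j(k := a)))"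
    using i j by (intro sum.cong refl eq) (simp_all add: k_def indices_Suc_upd)
  also have "\<dots> = (\<Sum>a\<in>UNIV. \<Sum>h\<in>indices m. L i h * K (h(k := a)) (j(k := a)))"
  proof (rule sum.cong[OF refl])
    fix a
    have "kmul k (kprod m k L kid) K (i(k := a)) (j(k := a))
        = (\<Sum>h\<in>indices m. \<Sum>c\<in>UNIV. (if a = c then L i h else 0) * K (h(k := c)) (j(k := a)))"
      unfolding kmul_def k_def sum_indices_Suc
      by (intro sum.cong refl) (simp add: kp[unfolded k_def] i)
    also have "\<dots> = (\<Sum>h\<in>indices m. L i h * K (h(k := a)) (j(k := a)))"
      by (simp add: if_distrib[of "\<lambda>z. z * _"] cong: if_cong)
    finally show "kmul k (kprod m k L kid) K (i(k := a)) (j(k := a))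
        = (\<Sum>h\<in>indices m. L i h * K (h(k := a)) (j(k := a)))" .
  qed
  also have "\<dots> = kmul m L (ptr k K) i j"
    unfolding kmul_def ptr_def sum_distrib_left by (rule sum.swap)
  finally show ?thesis .
qed

text \<open>The partial trace inherits both properties of \<open>F\<close>, commuting with the group
  and centrality, one tensor factor lower. For \<open>k = 1\<close> it lies in the centralizer on no
  factors.\<close>

theorem sbar_sandwich:
  fixes F :: "'N::finite tensor_op"
  assumes k: "k \<in> {1..n - 1}" and F: "F \<in> centralizer k"
    and central: "\<And>H. H \<in> centralizer k \<Longrightarrow> F \<circ> H = H \<circ> F"
  obtains Z where "Z \<in> centralizer (k - 1)" "\<And>H. H \<in> centralizer (k - 1) \<Longrightarrow> Z \<circ> H = H \<circ> Z"
    "brauer_op n (sbar n k) \<circ> embed_op k n F \<circ> brauer_op n (sbar n k)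
      = embed_op (k - 1) n Z \<circ> brauer_op n (sbar n k)"
proof -
  obtain m where m: "k = Suc m" using k by (cases k) auto
  have kn: "k \<le> n" "m \<le> n" "Suc (Suc m) \<le> n" "m \<le> Suc m" using k m by auto
  obtain K where K: "F = kop (Suc m) K" "gcommutes (Suc m) K"
      by (rule centralizer_kernel[OF F[unfolded m]])
  let ?Z = "kop m (ptr (Suc m) K)"
  have Z: "?Z \<in> centralizer m" unfolding kop_centralizer_iff by (rule gcommutes_ptr[OF K(2)])
  have Zc: "?Z \<circ> H = H \<circ> ?Z" if H: "H \<in> centralizer m" for H
  proof -
    obtain L where L: "H = kop m L" by (rule centralizer_kernel[OF H])
    have "F \<circ> embed_op m (Suc m) H = embed_op m (Suc m) H \<circ> F"
      using embed_op_centralizer[OF kn(4) H] by (intro central) (simp add: m)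
    then have "kmul (Suc m) K (kprod m (Suc m) L kid) i j
        = kmul (Suc m) (kprod m (Suc m) L kid) K i j"
      if "i \<in> indices (Suc m)" "j \<in> indices (Suc m)" for i j
      using that unfolding K L embed_op_kop[OF kn(4)] kop_comp kop_eq_iff by blast
    from ptr_commute[OF this] show ?thesis unfolding L kop_comp by (intro kop_cong)
  qed
  have "brauer_op n (sbar n k) \<circ> embed_op k n F \<circ> brauer_op n (sbar n k)
      = embed_op m n ?Z \<circ> brauer_op n (sbar n k)"
    unfolding brauer_op_sbar[OF k] K(1) comp_assoc
    unfolding m embed_op_kop[OF kn(1)[unfolded m]] embed_op_kop[OF kn(2)] kop_comp
    by (rule kop_cong, rule bker_sandwich[OF kn(3)])
  then show ?thesis using that[of ?Z] Z Zc m by simp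
qed

section \<open>Scalar action of central elements and the canonical basis\<close>

lemma linear_dependence_powers:
  fixes x :: "nat \<Rightarrow> 'v::complex_vector"
  assumes S: "finite S" and x: "\<And>i. x i \<in> cvec.span S"
  shows "\<exists>a. (\<exists>i\<le>card S. a i \<noteq> 0) \<and> (\<Sum>i\<le>card S. a i *\<^sub>C x i) = 0"
proof (cases "inj_on x {..card S}")
  case True
  let ?X = "x ` {..card S}"
  have "cvec.dependent ?X"
  proof (rule ccontr)
    assume "\<not> cvec.dependent ?X"
    then have "card ?X \<le> card S" using cvec.independent_span_bound[OF S] x by blast
    then show False using card_image[OF True] by simp
  qed
  then obtain u where u: "\<exists>v\<in>?X. u v \<noteq> 0" "(\<Sum>v\<in>?X. u v *\<^sub>C v) = 0"
    using cvec.dependent_finite[of ?X] by auto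
  then show ?thesis
    by (intro exI[of _ "\<lambda>i. u (x i)"]) (auto simp: sum.reindex[OF True])
next
  case False
  \<comment> \<open>Linear dependence is a notion for sets, so a repeated vector in the family has
    to be treated apart: the difference of the two equal members is the relation.\<close>
  then obtain i j where ij: "i \<le> card S" "j \<le> card S" "i \<noteq> j" "x i = x j" by (auto simp: inj_on_def)
  let ?a = "\<lambda>l. if l = i then 1 else if l = j then - 1 else 0 :: complex"
  have "(\<Sum>l\<le>card S. ?a l *\<^sub>C x l) = (\<Sum>l\<in>{i, j}. ?a l *\<^sub>C x l)"
    by (rule sum.mono_neutral_right) (use ij in auto)
  also have "\<dots> = 0" using ij by (simp add: cvec.scale_minus_left)
  finally show ?thesis using ij(1) by (intro exI[of _ ?a]) auto
qed

text \<open>Split off a root \<open>c\<close> of \<open>p\<close> with cofactor \<open>q\<close>. If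
  \<open>q\<close> applied to \<open>f\<close> kills \<open>w\<close>, the degree has dropped;
  otherwise the resulting vector is an eigenvector for \<open>c\<close>.\<close>

lemma poly_kernel_eigenvector:
  fixes f :: "'v::complex_vector \<Rightarrow> 'v" and p :: "complex poly"
  assumes W: "cvec.subspace W" and f: "linear_on W W f"
    and "p \<noteq> 0" "w \<in> W" "w \<noteq> 0" "(\<Sum>i\<le>degree p. coeff p i *\<^sub>C (f ^^ i) w) = 0"
  shows "\<exists>c. \<exists>u\<in>W. u \<noteq> 0 \<and> f u = c *\<^sub>C u"
  using assms(3-)
proof (induction "degree p" arbitrary: p)
  case 0
  then have "coeff p 0 \<noteq> 0" by (metis leading_coeff_neq_0)
  then show ?case using 0 by (simp add: cvec.scale_eq_0_iff)
next
  case (Suc d)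
  have "\<not> constant (poly p)" using Suc.hyps(2) constant_degree[of p] by simp
  then obtain c where "poly p c = 0" using fundamental_theorem_of_algebra by blast
  then obtain q where p: "p = [:- c, 1:] * q" by (auto simp: poly_eq_0_iff_dvd)
  have q: "q \<noteq> 0" using Suc.prems(1) p by auto
  have deg: "degree p = Suc (degree q)" unfolding p by (subst degree_mult_eq) (use q in auto)
  define u where "u = (\<Sum>i\<le>degree q. coeff q i *\<^sub>C (f ^^ i) w)"
  have pow: "(f ^^ i) w \<in> W" for i
    using f Suc.prems(2) by (induction i) (auto simp: linear_on_def)
  have u: "u \<in> W" unfolding u_def by (intro cvec.subspace_sum[OF W] cvec.subspace_scale[OF W] pow)
  have fu: "f u = (\<Sum>i\<le>degree q. coeff q i *\<^sub>C (f ^^ Suc i) w)"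
    unfolding u_def by (subst linear_on_sum[OF f W pow]) simp
  have "(\<Sum>i\<le>Suc (degree q). coeff p i *\<^sub>C (f ^^ i) w)
      = (\<Sum>i\<le>Suc (degree q). (case i of 0 \<Rightarrow> 0 | Suc l \<Rightarrow> coeff q l) *\<^sub>C (f ^^ i) w)
        - (\<Sum>i\<le>Suc (degree q). c *\<^sub>C coeff q i *\<^sub>C (f ^^ i) w)"
    unfolding sum_subtractf[symmetric]
    by (intro sum.cong refl)
      (auto simp: p coeff_pCons cvec.scale_left_diff_distrib[symmetric] split: nat.splits)
  also have "(\<Sum>i\<le>Suc (degree q). (case i of 0 \<Rightarrow> 0 | Suc l \<Rightarrow> coeff q l) *\<^sub>C (f ^^ i) w) = f u"
    unfolding fu by (subst sum.atMost_Suc_shift) simp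
  also have "(\<Sum>i\<le>Suc (degree q). c *\<^sub>C coeff q i *\<^sub>C (f ^^ i) w) = c *\<^sub>C u"
    unfolding u_def by (simp add: cvec.scale_sum_right coeff_eq_0)
  finally have eig: "f u - c *\<^sub>C u = 0" using Suc.prems(4) unfolding deg by simp
  show ?case
  proof (cases "u = 0")
    case True
    then show ?thesis
      using Suc.hyps(1)[of q] Suc.hyps(2) deg q Suc.prems(2,3) unfolding u_def by auto
  next
    case False
    then show ?thesis using eig u by auto
  qed
qed

lemma exists_eigenvector:
  fixes f :: "'v::complex_vector \<Rightarrow> 'v"
  assumes W: "cvec.subspace W" and f: "linear_on W W f" and S: "finite S" "W \<subseteq> cvec.span S"
    and w: "w \<in> W" "w \<noteq> 0"
  shows "\<exists>c. \<exists>u\<in>W. u \<noteq> 0 \<and> f u = c *\<^sub>C u"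
proof -
  have pow: "(f ^^ i) w \<in> W" for i
    using f w(1) by (induction i) (auto simp: linear_on_def)
  then obtain a where a: "\<exists>i\<le>card S. a i \<noteq> 0" "(\<Sum>i\<le>card S. a i *\<^sub>C (f ^^ i) w) = 0"
    using linear_dependence_powers[OF S(1), of "\<lambda>i. (f ^^ i) w"] S(2) by blast
  define p where "p = (\<Sum>i\<le>card S. monom (a i) i)"
  have c: "coeff p i = (if i \<le> card S then a i else 0)" for i
    by (simp add: p_def coeff_sum)
  have "p \<noteq> 0" using a(1) c by (metis coeff_0)
  have deg: "degree p \<le> card S" by (rule degree_le) (simp add: c)
  have "(\<Sum>i\<le>degree p. coeff p i *\<^sub>C (f ^^ i) w) = (\<Sum>i\<le>card S. coeff p i *\<^sub>C (f ^^ i) w)"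
    by (rule sum.mono_neutral_left) (use deg in \<open>auto simp: coeff_eq_0\<close>)
  also have "\<dots> = 0" using a(2) by (simp add: c)
  finally show ?thesis by (rule poly_kernel_eigenvector[OF W f \<open>p \<noteq> 0\<close> w])
qed

section \<open>Finiteness of the set of paths\<close>

lemma young_diagram_subset:
  assumes \<mu>: "young_diagram \<mu>" and n: "card \<mu> \<le> n"
  shows "\<mu> \<subseteq> {..<n} \<times> {..<n}"
proof (rule subrelI)
  fix r c assume rc: "(r, c) \<in> \<mu>"
  have fin: "finite \<mu>" using \<mu> by (simp add: young_diagram_def)
  \<comment> \<open>A box forces the whole rectangle above and to the left of it, so neither of its
    coordinates can reach \<open>n\<close>.\<close>
  have "{..r} \<times> {..c} \<subseteq> \<mu>" using young_down[OF \<mu> rc] by auto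
  then have "card ({..r} \<times> {..c}) \<le> n" using card_mono[OF fin] n by (meson le_trans)
  then have "Suc r * Suc c \<le> n" by simp
  then show "(r, c) \<in> {..<n} \<times> {..<n}"
    using mult_le_mono[of 1 "Suc c" "Suc r" "Suc r"] mult_le_mono[of 1 "Suc r" "Suc c" "Suc c"]
    by (simp add: mult.commute)
qed

lemma paths_young:
  assumes "\<Lambda> \<in> paths N \<mu> n" "l \<le> n"
  shows "young_diagram (\<Lambda> ! l)" "card (\<Lambda> ! l) \<le> n"
proof -
  have "young_diagram (\<Lambda> ! l) \<and> card (\<Lambda> ! l) \<le> n"
  proof (cases "l = 0")
    case True
    then show ?thesis using assms by (simp add: paths_def young_diagram_def)
  next
    case False
    then have "\<Lambda> ! l \<in> young_set l N" using assms by (auto simp: paths_def)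
    then show ?thesis using assms(2) by (auto simp: young_set_def)
  qed
  then show "young_diagram (\<Lambda> ! l)" "card (\<Lambda> ! l) \<le> n" by simp_all
qed

lemma finite_paths: "finite (paths N \<mu> n)"
proof (rule finite_subset)
  show "paths N \<mu> n \<subseteq> {xs. set xs \<subseteq> Pow ({..<n} \<times> {..<n}) \<and> length xs = n + 1}"
  proof
    fix \<Lambda> assume L: "\<Lambda> \<in> paths N \<mu> n"
    then have len: "length \<Lambda> = n + 1" by (simp add: paths_def)
    have "x \<subseteq> {..<n} \<times> {..<n}" if "x \<in> set \<Lambda>" for x
    proof -
      from that obtain l where "l < length \<Lambda>" "x = \<Lambda> ! l" by (auto simp: in_set_conv_nth)
      then show ?thesis using young_diagram_subset[OF paths_young[OF L, of l]] len by simp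
    qed
    then show "\<Lambda> \<in> {xs. set xs \<subseteq> Pow ({..<n} \<times> {..<n}) \<and> length xs = n + 1}" using len by auto
  qed
  show "finite {xs. set xs \<subseteq> Pow ({..<n} \<times> {..<n}) \<and> length xs = n + 1}"
    by (rule finite_lists_length_eq) simp
qed

text \<open>Since \<open>component\<close> is the span of many submodules, a scalar found on each of
  them has to be carried to their sum.\<close>

lemma linear_on_span:
  assumes V: "cvec.subspace V" and X: "linear_on V V X"
    and S: "\<And>w. w \<in> S \<Longrightarrow> w \<in> V \<and> X w = c *\<^sub>C w" and v: "v \<in> cvec.span S"
  shows "X v = c *\<^sub>C v"
proof -
  have X0: "X 0 = 0" using linear_on_sum[OF X V, of "{}" "\<lambda>_. 0"] by simp
  have "cvec.subspace {v \<in> V. X v = c *\<^sub>C v}"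
  proof (rule cvec.subspaceI)
    show "0 \<in> {v \<in> V. X v = c *\<^sub>C v}" using cvec.subspace_0[OF V] X0 by simp
    show "x + y \<in> {v \<in> V. X v = c *\<^sub>C v}"
      if "x \<in> {v \<in> V. X v = c *\<^sub>C v}" "y \<in> {v \<in> V. X v = c *\<^sub>C v}" for x y
      using that X cvec.subspace_add[OF V] by (simp add: linear_on_def cvec.scale_right_distrib)
    show "b *\<^sub>C x \<in> {v \<in> V. X v = c *\<^sub>C v}" if "x \<in> {v \<in> V. X v = c *\<^sub>C v}" for b x
      using that X cvec.subspace_scale[OF V] by (simp add: linear_on_def mult.commute)
  qed
  then have "cvec.span S \<subseteq> {v \<in> V. X v = c *\<^sub>C v}" using S by (intro cvec.span_minimal) auto
  then show ?thesis using v by blast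
qed

lemma brauer_simpleD:
  assumes "brauer_simple l \<mu> W act"
  shows "cvec.subspace W" "\<And>F. F \<in> centralizer l \<Longrightarrow>
      linear_on W W (act F)" "irreducible_module (centralizer l) W act"
    and "\<exists>f. linear_on W (tensor_mult_space l \<mu>) f \<and> bij_betw f W (tensor_mult_space l \<mu>) \<and>
      (\<forall>F\<in>centralizer l. \<forall>w\<in>W. f (act F w) = F \<circ> f w)"
  using assms
      by (auto simp: brauer_simple_def centralizer_module_def isomorphic_modules_def hom_space_def)

text \<open>The isomorphism with the multiplicity space turns the module action into composition,
  where \<open>iproj_self\<close> and \<open>iproj_other\<close> apply.\<close>

lemma brauer_simple_iproj:
  assumes s: "brauer_simple l \<nu> W act" and w: "w \<in> W" and \<mu>: "young_diagram \<mu>"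
      and \<nu>: "young_diagram \<nu>"
  shows "act (iproj l \<mu>) w = (if \<mu> = \<nu> then w else 0)"
proof -
  obtain f where lin: "linear_on W (tensor_mult_space l \<nu>) f"
      and bij: "bij_betw f W (tensor_mult_space l \<nu>)"
    and eq: "\<And>F w. F \<in> centralizer l \<Longrightarrow> w \<in> W \<Longrightarrow> f (act F w) = F \<circ> f w"
    using brauer_simpleD(4)[OF s] by blast
  have W: "cvec.subspace W" by (rule brauer_simpleD(1)[OF s])
  have actW: "act (iproj l \<mu>) w \<in> W"
    using brauer_simpleD(2)[OF s iproj_centralizer, of \<mu>] w by (auto simp: linear_on_def)
  have fw: "f w \<in> tensor_mult_space l \<nu>" using bij w by (auto simp: bij_betw_def)
  have inj: "inj_on f W" using bij by (simp add: bij_betw_def)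
  have f0: "f 0 = 0"
  proof -
    have "f (0 *\<^sub>C 0) = 0 *\<^sub>C f 0" using lin cvec.subspace_0[OF W] unfolding linear_on_def by blast
    then show ?thesis by simp
  qed
  show ?thesis
  proof (cases "\<mu> = \<nu>")
    case True
    then have "f (act (iproj l \<mu>) w) = f w"
      using eq[OF iproj_centralizer w, of \<mu>] iproj_self[OF fw] by simp
    then show ?thesis using True inj_onD[OF inj _ actW w] by simp
  next
    case False
    then have "f (act (iproj l \<mu>) w) = f 0"
      using eq[OF iproj_centralizer w, of \<mu>] iproj_other[OF \<mu> \<nu> False fw] f0 by simp
    then show ?thesis using False inj_onD[OF inj _ actW cvec.subspace_0[OF W]] by simp
  qed
qed

text \<open>Schur's lemma: the eigenspace of a central element is a nonzero submodule, hence
  everything. The scalar is recorded on the multiplicity space rather than on \<open>W\<close>, so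
  that one and the same \<open>c\<close> serves every copy of the module.\<close>

lemma central_scalar:
  fixes act :: "'N::finite tensor_op \<Rightarrow> 'v::complex_vector \<Rightarrow> 'v" and Z :: "'N tensor_op"
  assumes s: "brauer_simple l \<nu> W act" and fin: "finite S" "W \<subseteq> cvec.span S"
    and mod: "\<And>F H w. F \<in> centralizer l \<Longrightarrow> H \<in> centralizer l \<Longrightarrow> w \<in> W \<Longrightarrow>
        act (F \<circ> H) w = act F (act H w)"
    and Z: "Z \<in> centralizer l" and central: "\<And>H. H \<in> centralizer l \<Longrightarrow> Z \<circ> H = H \<circ> Z"
  shows "\<exists>c. \<forall>\<phi>\<in>tensor_mult_space l \<nu>. Z \<circ> \<phi> = c *\<^sub>C \<phi>"
proof -
  obtain f where lin: "linear_on W (tensor_mult_space l \<nu>) f"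
      and bij: "bij_betw f W (tensor_mult_space l \<nu>)"
    and eq: "\<And>F w. F \<in> centralizer l \<Longrightarrow> w \<in> W \<Longrightarrow> f (act F w) = F \<circ> f w"
    using brauer_simpleD(4)[OF s] by blast
  have W: "cvec.subspace W" and irr: "irreducible_module (centralizer l) W act"
    and linW: "\<And>F. F \<in> centralizer l \<Longrightarrow> linear_on W W (act F)"
    using brauer_simpleD[OF s] by blast+
  have "W \<noteq> {0}" using irr by (simp add: irreducible_module_def)
  then obtain w where "w \<in> W" "w \<noteq> 0" using cvec.subspace_0[OF W] by blast
  from exists_eigenvector[OF W linW[OF Z] fin this]
  obtain c u where u: "u \<in> W" "u \<noteq> 0" "act Z u = c *\<^sub>C u" by blast
  let ?E = "{w \<in> W. act Z w = c *\<^sub>C w}"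
  have "cvec.subspace ?E"
  proof (rule cvec.subspaceI)
    have "act Z (0 *\<^sub>C 0) = 0 *\<^sub>C act Z 0"
      using linW[OF Z] cvec.subspace_0[OF W] unfolding linear_on_def by blast
    then show "0 \<in> ?E" using cvec.subspace_0[OF W] by simp
    show "x + y \<in> ?E" if "x \<in> ?E" "y \<in> ?E" for x y
      using that linW[OF Z] cvec.subspace_add[OF W]
          by (simp add: linear_on_def cvec.scale_right_distrib)
    show "b *\<^sub>C x \<in> ?E" if "x \<in> ?E" for b x
      using that linW[OF Z] cvec.subspace_scale[OF W] by (simp add: linear_on_def mult.commute)
  qed
  moreover have "act H ` ?E \<subseteq> ?E" if H: "H \<in> centralizer l" for H
  proof clarify
    fix x assume x: "x \<in> W" "act Z x = c *\<^sub>C x"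
    have hx: "act H x \<in> W" using linW[OF H] x(1) by (auto simp: linear_on_def)
    have "act Z (act H x) = act H (act Z x)"
      using mod[OF Z H x(1)] mod[OF H Z x(1)] central[OF H] by simp
    also have "\<dots> = c *\<^sub>C act H x" using linW[OF H] x by (simp add: linear_on_def)
    finally show "act H x \<in> W \<and> act Z (act H x) = c *\<^sub>C act H x" using hx by simp
  qed
  ultimately have "?E = {0} \<or> ?E = W"
    using irr unfolding irreducible_module_def by blast
  then have E: "?E = W" using u by blast
  have "Z \<circ> \<phi> = c *\<^sub>C \<phi>" if \<phi>: "\<phi> \<in> tensor_mult_space l \<nu>" for \<phi>
  proof -
    obtain w where w: "w \<in> W" "\<phi> = f w" using bij \<phi> by (auto simp: bij_betw_def)
    have "w \<in> ?E" using w(1) by (simp only: E)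
    then have "act Z w = c *\<^sub>C w" by simp
    moreover have "Z \<circ> f w = f (act Z w)" using eq[OF Z w(1)] by simp
    ultimately have "Z \<circ> f w = f (c *\<^sub>C w)" by simp
    also have "\<dots> = c *\<^sub>C f w" using lin w(1) by (simp add: linear_on_def)
    finally show ?thesis using w(2) by simp
  qed
  then show ?thesis by blast
qed

lemma brauer_simple_scalar:
  assumes s: "brauer_simple l \<nu> W act" and w: "w \<in> W" and Z: "Z \<in> centralizer l"
    and c: "\<forall>\<phi>\<in>tensor_mult_space l \<nu>. Z \<circ> \<phi> = c *\<^sub>C \<phi>"
  shows "act Z w = c *\<^sub>C w"
proof -
  obtain f where lin: "linear_on W (tensor_mult_space l \<nu>) f"
      and bij: "bij_betw f W (tensor_mult_space l \<nu>)"
    and eq: "\<And>F w. F \<in> centralizer l \<Longrightarrow> w \<in> W \<Longrightarrow> f (act F w) = F \<circ> f w"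
    using brauer_simpleD(4)[OF s] by blast
  have W: "cvec.subspace W" by (rule brauer_simpleD(1)[OF s])
  have fw: "f w \<in> tensor_mult_space l \<nu>" using bij w by (auto simp: bij_betw_def)
  have "f (act Z w) = c *\<^sub>C f w" using eq[OF Z w] c fw by simp
  also have "\<dots> = f (c *\<^sub>C w)" using lin w by (simp add: linear_on_def)
  finally have "f (act Z w) = f (c *\<^sub>C w)" .
  moreover have "act Z w \<in> W" using brauer_simpleD(2)[OF s Z] w by (auto simp: linear_on_def)
  moreover have "c *\<^sub>C w \<in> W" by (rule cvec.subspace_scale[OF W w])
  ultimately show ?thesis using bij by (auto simp: bij_betw_def dest: inj_onD)
qed

lemma centralizer_comp:
  assumes F: "F \<in> centralizer n" and H: "H \<in> centralizer n"
  shows "F \<circ> H \<in> centralizer n"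
proof -
  have "linear_on (tensors n) (tensors n) F" using F by (auto simp: centralizer_def hom_space_def)
  from linear_on_sum[OF this subspace_tensors, of "{}" "\<lambda>_. 0"] have "F 0 = 0" by simp
  then show ?thesis
    using F H unfolding centralizer_def hom_space_def linear_on_def by (auto simp: image_subset_iff)
qed

lemma centralizer_one_kop: "centralizer_one n = kop n kid"
proof
  fix t :: "'a tensor"
  show "centralizer_one n t = kop n kid t"
  proof (cases "t \<in> tensors n")
    case True
    then show ?thesis
      by (intro tensor_eqI[of _ n]) (simp_all add: centralizer_one_def kop_tensors kop_apply
          sum_kid_left)
  qed (simp add: centralizer_one_def kop_outside)
qed

lemma centralizer_one_centralizer: "centralizer_one n \<in> centralizer n"
  unfolding centralizer_one_kop kop_centralizer_iff gcommutes_def by (simp add: kmul_kid)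

text \<open>\<open>indices 0\<close> contains only the constantly undefined function, so operators
  on no tensor factors are 1 x 1 matrices.\<close>

lemma embed_op_0:
  assumes "Z \<in> centralizer 0"
  shows "\<exists>c. embed_op 0 n Z = c *\<^sub>C centralizer_one n"
proof -
  obtain K where K: "Z = kop 0 K" by (rule centralizer_kernel[OF assms])
  let ?u = "\<lambda>_. undefined"
  have ext: "restrict i {1..n} = i" if "i \<in> indices n" for i :: "nat \<Rightarrow> 'a"
    using that by (auto simp: indices_def intro: extensional_restrict)
  have "embed_op 0 n Z = kop n (kprod 0 n K kid)" unfolding K by (rule embed_op_kop) simp
  also have "\<dots> = kop n (\<lambda>i j. K ?u ?u * kid i j)"
    by (rule kop_cong) (use ext in \<open>simp add: kprod_def restrict_def kid_def\<close>)
  also have "\<dots> = K ?u ?u *\<^sub>C centralizer_one n"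
    unfolding centralizer_one_kop
    by (auto simp: kop_def fun_eq_iff scaleC_fun_def scaleC_complex_def sum_distrib_left mult.assoc)
  finally show ?thesis by blast
qed

theorem corollary3p7:
  fixes n k :: nat
    and lam :: young
    and V :: "'v::complex_vector set"
    and act :: "'N::finite tensor_op \<Rightarrow> 'v \<Rightarrow> 'v"
    and v :: "young list \<Rightarrow> 'v"
    and \<Lambda> \<Lambda>' :: "young list"
  assumes "n \<ge> 1"
    and "lam \<in> young_set n CARD('N)"
    and "brauer_simple n lam V act"
    and "canonical_basis n lam V act v"
    and "\<Lambda> \<in> paths CARD('N) lam n"
    and "\<Lambda>' \<in> paths CARD('N) lam n"
    and "k \<in> {1..n - 1}"
    and "\<Lambda> ! (k - 1) = \<Lambda> ! (k + 1)"
    and "v \<Lambda>' \<in> path_subspace CARD('N) n lam v \<Lambda> k"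
  shows "matrix_element n lam act v (sbar n k) \<Lambda> \<Lambda>' * matrix_element n lam act v (sbar n k) \<Lambda>' \<Lambda>
       = matrix_element n lam act v (sbar n k) \<Lambda> \<Lambda> * matrix_element n lam act v (sbar n k) \<Lambda>' \<Lambda>'"
proof -
  note k = assms(7)
  define P where "P = paths CARD('N) lam n"
  have L: "\<Lambda> \<in> P" "\<Lambda>' \<in> P" using assms(5,6) by (simp_all add: P_def)
  have finP: "finite P" unfolding P_def by (rule finite_paths)
  have cm: "centralizer_module n V act" using assms(3) by (simp add: brauer_simple_def)
  have V: "cvec.subspace V" and lin: "\<And>F. F \<in> centralizer n \<Longrightarrow> linear_on V V (act F)"
    and comp: "\<And>F H x. F \<in> centralizer n \<Longrightarrow> H \<in> centralizer n \<Longrightarrow> x \<in> V \<Longrightarrow>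
        act (F \<circ> H) x = act F (act H x)"
    and actscale: "\<And>F c x. F \<in> centralizer n \<Longrightarrow> x \<in> V \<Longrightarrow> act (c *\<^sub>C F) x = c *\<^sub>C act F x"
    and one: "\<And>x. x \<in> V \<Longrightarrow> act (centralizer_one n) x = x"
    using cm by (auto simp: centralizer_module_def)
  have inj: "inj_on v P" and indep: "\<not> cvec.dependent (v ` P)" and span: "cvec.span (v ` P) = V"
    and comps: "\<And>\<Lambda> l. \<Lambda> \<in> P \<Longrightarrow> l \<in> {1..n - 1} \<Longrightarrow> v \<Lambda> \<in> component n l (\<Lambda> ! l) V act"
    using assms(4) by (auto simp: canonical_basis_def P_def)
  have vV: "v \<Lambda> \<in> V" if "\<Lambda> \<in> P" for \<Lambda>
    unfolding span[symmetric] by (intro cvec.span_base imageI that)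
  define rep where "rep = cvec.representation (v ` P)"
  have expand: "x = (\<Sum>\<Lambda>\<in>P. rep x (v \<Lambda>) *\<^sub>C v \<Lambda>)" if "x \<in> V" for x
  proof -
    have "(\<Sum>b\<in>v ` P. rep x b *\<^sub>C b) = x"
      unfolding rep_def by (rule cvec.sum_representation_eq[OF indep]) (use that span finP in auto)
    then show ?thesis by (simp add: sum.reindex[OF inj])
  qed
  have coef: "rep (\<Sum>\<Lambda>\<in>P. a \<Lambda> *\<^sub>C v \<Lambda>) (v \<Lambda>') = a \<Lambda>'" if "\<Lambda>' \<in> P" for a \<Lambda>'
  proof -
    have sp: "v \<Lambda> \<in> cvec.span (v ` P)" if "\<Lambda> \<in> P" for \<Lambda> using vV[OF that] span by simp
    have "rep (\<Sum>\<Lambda>\<in>P. a \<Lambda> *\<^sub>C v \<Lambda>) (v \<Lambda>') = (\<Sum>\<Lambda>\<in>P. rep (a \<Lambda> *\<^sub>C v \<Lambda>) (v \<Lambda>'))"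
      unfolding rep_def
          by (subst cvec.representation_sum[OF indep]) (auto intro: cvec.span_scale sp)
    also have "\<dots> = (\<Sum>\<Lambda>\<in>P. if \<Lambda> = \<Lambda>' then a \<Lambda>' else 0)"
    proof (rule sum.cong[OF refl])
      fix \<Lambda> assume "\<Lambda> \<in> P"
      then show "rep (a \<Lambda> *\<^sub>C v \<Lambda>) (v \<Lambda>') = (if \<Lambda> = \<Lambda>' then a \<Lambda>' else 0)"
        using inj_onD[OF inj, of \<Lambda>' \<Lambda>] that unfolding rep_def
        by (auto simp: cvec.representation_scale[OF indep sp] cvec.representation_basis[OF indep])
    qed
    also have "\<dots> = a \<Lambda>'" using that finP by simp
    finally show ?thesis .
  qed
  have rep_scale: "rep (c *\<^sub>C x) b = c * rep x b" if "x \<in> V" for c x b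
    unfolding rep_def by (subst cvec.representation_scale[OF indep]) (use that span in auto)
  have young: "young_diagram (\<Lambda> ! l)" if "\<Lambda> \<in> P" "l \<le> n" for \<Lambda> l
    using paths_young(1) that unfolding P_def by blast
  \<comment> \<open>On the canonical basis \<open>z l \<mu>\<close> is the indicator of the paths
    with value \<mu> at \<open>l\<close>, as \<open>zv\<close> shows.\<close>
  define z where "z l \<mu> = act (embed_op l n (iproj l \<mu>))" for l \<mu>
  have emb: "embed_op l n F \<in> centralizer n" if "l \<le> n" "F \<in> centralizer l" for l
      and F :: "'N tensor_op"
    by (rule embed_op_centralizer[OF that])
  have scalar: "act (embed_op l n Z) (v \<Lambda>) = c *\<^sub>C v \<Lambda>"
    if l: "l \<in> {1..n - 1}" and Z: "Z \<in> centralizer l" and \<Lambda>: "\<Lambda> \<in> P"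
      and W: "\<And>W w. W \<subseteq> V \<Longrightarrow> brauer_simple l (\<Lambda> ! l) W (\<lambda>F. act (embed_op l n F)) \<Longrightarrow> w \<in> W \<Longrightarrow>
        act (embed_op l n Z) w = c *\<^sub>C w"
    for l Z \<Lambda> c
  proof (rule linear_on_span[OF V])
    show "linear_on V V (act (embed_op l n Z))" by (rule lin[OF emb]) (use l Z in auto)
    show "v \<Lambda> \<in> cvec.span (\<Union>{W. W \<subseteq> V \<and> brauer_simple l (\<Lambda> ! l) W (\<lambda>F. act (embed_op l n F))})"
      using comps[OF \<Lambda> l] unfolding component_def .
    fix w assume "w \<in> \<Union>{W. W \<subseteq> V \<and> brauer_simple l (\<Lambda> ! l) W (\<lambda>F. act (embed_op l n F))}"
    then obtain W' where "W' \<subseteq> V" "brauer_simple l (\<Lambda> ! l) W' (\<lambda>F. act (embed_op l n F))" "w \<in> W'"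
        by blast
    then show "w \<in> V \<and> act (embed_op l n Z) w = c *\<^sub>C w" using W by blast
  qed
  have zv: "z l \<mu> (v \<Lambda>) = (if \<mu> = \<Lambda> ! l then v \<Lambda> else 0)"
    if l: "l \<in> {1..n - 1}" and \<Lambda>: "\<Lambda> \<in> P" and \<mu>: "young_diagram \<mu>" for l \<mu> \<Lambda>
  proof -
    have y: "young_diagram (\<Lambda> ! l)" by (rule young[OF \<Lambda>]) (use l in auto)
    have "z l \<mu> (v \<Lambda>) = (if \<mu> = \<Lambda> ! l then 1 else 0) *\<^sub>C v \<Lambda>"
      unfolding z_def
    proof (rule scalar[OF l iproj_centralizer \<Lambda>])
      fix W w assume s: "brauer_simple l (\<Lambda> ! l) W (\<lambda>F. act (embed_op l n F))" and w: "w \<in> W"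
      show "act (embed_op l n (iproj l \<mu>)) w = (if \<mu> = \<Lambda> ! l then 1 else 0) *\<^sub>C w"
        using brauer_simple_iproj[OF s w \<mu> y] by (simp add: cvec.scale_one)
    qed
    then show ?thesis by (simp add: cvec.scale_one)
  qed
  have zlin: "linear_on V V (z l \<mu>)" if "l \<in> {1..n - 1}" for l \<mu>
    unfolding z_def by (rule lin[OF emb[OF _ iproj_centralizer]]) (use that in auto)
  have zexp: "z l \<mu> x = (\<Sum>\<Lambda>\<in>P. (if \<mu> = \<Lambda> ! l then rep x (v \<Lambda>) else 0) *\<^sub>C v \<Lambda>)"
    if l: "l \<in> {1..n - 1}" and x: "x \<in> V" and \<mu>: "young_diagram \<mu>" for l x \<mu>
  proof -
    have "z l \<mu> x = z l \<mu> (\<Sum>\<Lambda>\<in>P. rep x (v \<Lambda>) *\<^sub>C v \<Lambda>)" using expand[OF x] by simp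
    also have "\<dots> = (\<Sum>\<Lambda>\<in>P. rep x (v \<Lambda>) *\<^sub>C z l \<mu> (v \<Lambda>))"
      by (rule linear_on_sum[OF zlin[OF l] V vV])
    also have "\<dots> = (\<Sum>\<Lambda>\<in>P. (if \<mu> = \<Lambda> ! l then rep x (v \<Lambda>) else 0) *\<^sub>C v \<Lambda>)"
      by (rule sum.cong[OF refl]) (simp add: zv[OF l _ \<mu>])
    finally show ?thesis .
  qed
  define E where "E = (brauer_op n (sbar n k) :: 'N tensor_op)"
  have E: "E \<in> centralizer n" unfolding E_def by (rule brauer_op_sbar_centralizer[OF k])
  define e where "e = act E"
  have eV: "e x \<in> V" if "x \<in> V" for x
    using lin[OF E] that unfolding e_def linear_on_def by blast
  define M where "M \<Lambda> \<Lambda>' = rep (e (v \<Lambda>)) (v \<Lambda>')" for \<Lambda> \<Lambda>'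
  have ME: "matrix_element n lam act v (sbar n k) \<Lambda> \<Lambda>' = M \<Lambda> \<Lambda>'" for \<Lambda> \<Lambda>'
    by (simp add: matrix_element_def M_def rep_def P_def e_def E_def)
  have commute: "act (embed_op l n Z) (e x) = e (act (embed_op l n Z) x)"
    if eq: "embed_op l n Z \<circ> E = E \<circ> embed_op l n Z" and l: "l \<le> n" and Z: "Z \<in> centralizer l"
        and x: "x \<in> V"
    for l Z x
    using comp[OF emb[OF l Z] E x] comp[OF E emb[OF l Z] x] eq unfolding e_def by simp
  have zcommute: "z l \<mu> (e x) = e (z l \<mu> x)" if l: "l \<in> {1..n - 1}" "l \<noteq> k" and x: "x \<in> V" for l \<mu> x
    unfolding z_def
  proof (rule commute[OF _ _ iproj_centralizer x])
    show "l \<le> n" using l by auto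
    show "embed_op l n (iproj l \<mu>) \<circ> E = E \<circ> embed_op l n (iproj l \<mu>)"
    proof (cases "l < k")
      case True
      then show ?thesis unfolding E_def by (rule embed_op_bar_commute_low[OF k _ iproj_centralizer])
    next
      case False
      then show ?thesis
        unfolding E_def using l
        by (intro embed_op_bar_commute_high[OF k _ _ iproj_centralizer iproj_central]) auto
    qed
  qed
  \<comment> \<open>\<open>e\<close> commutes with the indicator of the value at \<open>l\<close>
    for each \<open>l \<noteq> k\<close>, so it cannot lead from one value to another.\<close>
  have off: "\<Lambda>2 ! l = \<Lambda>1 ! l"
    if P12: "\<Lambda>1 \<in> P" "\<Lambda>2 \<in> P" and nz: "M \<Lambda>1 \<Lambda>2 \<noteq> 0" and l: "l \<le> n" "l \<noteq> k" for \<Lambda>1 \<Lambda>2 l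
  proof (cases "l \<in> {1..n - 1}")
    case True
    have y: "young_diagram (\<Lambda>1 ! l)" by (rule young[OF P12(1) l(1)])
    have "e (v \<Lambda>1) = e (z l (\<Lambda>1 ! l) (v \<Lambda>1))" using zv[OF True P12(1) y] by simp
    also have "\<dots> = z l (\<Lambda>1 ! l) (e (v \<Lambda>1))" using zcommute[OF True l(2) vV[OF P12(1)]] by simp
    also have "\<dots> = (\<Sum>\<Lambda>\<in>P. (if \<Lambda>1 ! l = \<Lambda> ! l then rep (e (v \<Lambda>1)) (v \<Lambda>) else 0) *\<^sub>C v \<Lambda>)"
      by (rule zexp[OF True eV[OF vV[OF P12(1)]] y])
    finally have eq: "e (v \<Lambda>1)
        = (\<Sum>\<Lambda>\<in>P. (if \<Lambda>1 ! l = \<Lambda> ! l then rep (e (v \<Lambda>1)) (v \<Lambda>) else 0) *\<^sub>C v \<Lambda>)" .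
    have "M \<Lambda>1 \<Lambda>2 = (if \<Lambda>1 ! l = \<Lambda>2 ! l then M \<Lambda>1 \<Lambda>2 else 0)"
      unfolding M_def by (rule trans[OF arg_cong[OF eq, of "\<lambda>x. rep x (v \<Lambda>2)"] coef[OF P12(2)]])
    then show ?thesis using nz by (metis)
  next
    case False
    \<comment> \<open>No component condition is imposed at the two ends; there all paths in
      \<open>P\<close> agree by definition.\<close>
    then have "l = 0 \<or> l = n" using l(1) by auto
    then show ?thesis using P12 by (auto simp: P_def paths_def)
  qed
  \<comment> \<open>Membership of a basis vector in the span of a subset of the basis puts it, by
    independence, into that subset.\<close>
  have agree: "\<Lambda>' ! l = \<Lambda> ! l" if l: "l \<le> n" "l \<noteq> k" for l
  proof -
    let ?F = "{\<Lambda>'' \<in> P. \<forall>l\<le>n. l \<noteq> k \<longrightarrow> \<Lambda>'' ! l = \<Lambda> ! l}"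
    have sp: "v \<Lambda>' \<in> cvec.span (v ` ?F)" using assms(9) by (simp add: path_subspace_def P_def)
    have "\<Lambda>' \<in> ?F"
    proof (rule ccontr)
      assume nF: "\<Lambda>' \<notin> ?F"
      have "v ` ?F \<subseteq> v ` P - {v \<Lambda>'}"
      proof
        fix b assume "b \<in> v ` ?F"
        then obtain \<Lambda>'' where b: "\<Lambda>'' \<in> ?F" "b = v \<Lambda>''" by blast
        then have "v \<Lambda>'' \<noteq> v \<Lambda>'" using inj_onD[OF inj, of \<Lambda>'' \<Lambda>'] L(2) nF by auto
        then show "b \<in> v ` P - {v \<Lambda>'}" using b by auto
      qed
      then have "v \<Lambda>' \<in> cvec.span (v ` P - {v \<Lambda>'})" using sp cvec.span_mono by blast
      then show False using indep L(2) unfolding cvec.dependent_def by blast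
    qed
    then show ?thesis using l by blast
  qed
  have y': "young_diagram (\<Lambda>' ! k)" by (rule young[OF L(2)]) (use k in auto)
  have hit: "z k (\<Lambda>' ! k) (e (v \<Lambda>1)) = M \<Lambda>1 \<Lambda>' *\<^sub>C v \<Lambda>'" if L1: "\<Lambda>1 \<in> {\<Lambda>, \<Lambda>'}" for \<Lambda>1
  proof -
    have P1: "\<Lambda>1 \<in> P" using L L1 by auto
    have "z k (\<Lambda>' ! k) (e (v \<Lambda>1))
        = (\<Sum>\<Lambda>2\<in>P. (if \<Lambda>' ! k = \<Lambda>2 ! k then M \<Lambda>1 \<Lambda>2 else 0) *\<^sub>C v \<Lambda>2)"
      unfolding M_def by (rule zexp[OF k eV[OF vV[OF P1]] y'])
    also have "\<dots> = (\<Sum>\<Lambda>2\<in>P. if \<Lambda>2 = \<Lambda>' then M \<Lambda>1 \<Lambda>' *\<^sub>C v \<Lambda>' else 0)"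
    proof (rule sum.cong[OF refl])
      fix \<Lambda>2 assume P2: "\<Lambda>2 \<in> P"
      \<comment> \<open>Paths reached by \<open>e\<close> agree with \<open>\<Lambda>'\<close> off
        \<open>k\<close>, and the projection fixes the value at \<open>k\<close>; nothing but
        \<open>\<Lambda>'\<close> is left.\<close>
      have "\<Lambda>2 = \<Lambda>'" if "\<Lambda>' ! k = \<Lambda>2 ! k" "M \<Lambda>1 \<Lambda>2 \<noteq> 0"
      proof (rule nth_equalityI)
        show "length \<Lambda>2 = length \<Lambda>'" using P2 L(2) by (simp add: P_def paths_def)
        fix l assume "l < length \<Lambda>2"
        then have l: "l \<le> n" using P2 by (simp add: P_def paths_def)
        show "\<Lambda>2 ! l = \<Lambda>' ! l"
          using that(1) off[OF P1 P2 that(2) l] agree[OF l] L1 by (cases "l = k") auto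
      qed
      then show "(if \<Lambda>' ! k = \<Lambda>2 ! k then M \<Lambda>1 \<Lambda>2 else 0) *\<^sub>C v \<Lambda>2
          = (if \<Lambda>2 = \<Lambda>' then M \<Lambda>1 \<Lambda>' *\<^sub>C v \<Lambda>' else 0)"
        by auto
    qed
    also have "\<dots> = M \<Lambda>1 \<Lambda>' *\<^sub>C v \<Lambda>'" using finP L(2) by simp
    finally show ?thesis .
  qed
  have "\<exists>Z\<in>centralizer (k - 1). (\<forall>H\<in>centralizer (k - 1). Z \<circ> H = H \<circ> Z) \<and>
      E \<circ> embed_op k n (iproj k (\<Lambda>' ! k)) \<circ> E = embed_op (k - 1) n Z \<circ> E"
    unfolding E_def
    by (rule sbar_sandwich[OF k iproj_centralizer[where \<mu> = "\<Lambda>' ! k"] iproj_central]; blast)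
  then obtain Z where Z: "Z \<in> centralizer (k - 1)" "\<And>H. H \<in> centralizer (k - 1) \<Longrightarrow> Z \<circ> H = H \<circ> Z"
    and sandwich: "E \<circ> embed_op k n (iproj k (\<Lambda>' ! k)) \<circ> E = embed_op (k - 1) n Z \<circ> E"
    by blast
  have kn: "k \<le> n" "k - 1 \<le> n" "k - 1 < k" using k by auto
  \<comment> \<open>A single scalar for both vectors is essential. It exists because both paths have
    the same value at \<open>k - 1\<close>, so both vectors lie in the same component. For
    \<open>k = 1\<close> there is no component to refer to, but \<open>Z\<close> itself is a
    scalar.\<close>
  have "\<exists>c. \<forall>\<Lambda>1\<in>{\<Lambda>, \<Lambda>'}. act (embed_op (k - 1) n Z) (v \<Lambda>1) = c *\<^sub>C v \<Lambda>1"
  proof (cases "k = 1")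
    case True
    then obtain c where "embed_op (k - 1) n Z = c *\<^sub>C centralizer_one n"
      using embed_op_0 Z(1) by auto
    then have "act (embed_op (k - 1) n Z) x = c *\<^sub>C x" if "x \<in> V" for x
      using actscale[OF centralizer_one_centralizer that] one[OF that] by simp
    then show ?thesis using vV L by blast
  next
    case False
    then have l: "k - 1 \<in> {1..n - 1}" using k by auto
    let ?s = "\<lambda>W. brauer_simple (k - 1) (\<Lambda> ! (k - 1)) W (\<lambda>F. act (embed_op (k - 1) n F))"
    have "\<exists>c. \<forall>W w. W \<subseteq> V \<longrightarrow> ?s W \<longrightarrow> w \<in> W \<longrightarrow> act (embed_op (k - 1) n Z) w = c *\<^sub>C w"
    \<comment> \<open>One copy of the simple module is needed to find the eigenvalue; if there is
      none, any scalar will do.\<close>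
    proof (cases "\<exists>W\<subseteq>V. ?s W")
      case True
      then obtain W where W: "W \<subseteq> V" "?s W" by blast
      have "\<exists>c. \<forall>\<phi>\<in>tensor_mult_space (k - 1) (\<Lambda> ! (k - 1)). Z \<circ> \<phi> = c *\<^sub>C \<phi>"
      proof (rule central_scalar[OF W(2) finite_imageI[OF finP] _ _ Z])
        show "W \<subseteq> cvec.span (v ` P)" using W(1) span by simp
        show "act (embed_op (k - 1) n (F \<circ> H)) w
            = act (embed_op (k - 1) n F) (act (embed_op (k - 1) n H) w)"
          if "F \<in> centralizer (k - 1)" "H \<in> centralizer (k - 1)" "w \<in> W" for F H w
          unfolding embed_op_comp[OF kn(2) that(1,2)]
          by (rule comp[OF emb[OF kn(2) that(1)] emb[OF kn(2) that(2)] subsetD[OF W(1) that(3)]])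
      qed
      then obtain c where c: "\<forall>\<phi>\<in>tensor_mult_space (k - 1) (\<Lambda> ! (k - 1)). Z \<circ> \<phi> = c *\<^sub>C \<phi>" by blast
      have "act (embed_op (k - 1) n Z) w = c *\<^sub>C w" if "?s W" "w \<in> W" for W w
        by (rule brauer_simple_scalar[OF that Z(1) c])
      then show ?thesis by blast
    qed blast
    then obtain c where c: "\<And>W w. W \<subseteq> V \<Longrightarrow> ?s W \<Longrightarrow> w \<in> W \<Longrightarrow> act (embed_op (k - 1) n Z) w = c *\<^sub>C w"
      by blast
    have same: "\<Lambda>1 ! (k - 1) = \<Lambda> ! (k - 1)" if "\<Lambda>1 \<in> {\<Lambda>, \<Lambda>'}" for \<Lambda>1
      using that agree[OF kn(2)] kn(3) by auto
    have "act (embed_op (k - 1) n Z) (v \<Lambda>1) = c *\<^sub>C v \<Lambda>1" if L1: "\<Lambda>1 \<in> {\<Lambda>, \<Lambda>'}" for \<Lambda>1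
    proof (rule scalar[OF l Z(1)])
      show "\<Lambda>1 \<in> P" using L L1 by auto
    qed (use c same[OF L1] in auto)
    then show ?thesis by blast
  qed
  then obtain c where c: "\<And>\<Lambda>1. \<Lambda>1 \<in> {\<Lambda>, \<Lambda>'} \<Longrightarrow> act (embed_op (k - 1) n Z) (v \<Lambda>1) = c *\<^sub>C v \<Lambda>1"
    by blast
  \<comment> \<open>Evaluating the sandwich relation on a basis vector: by \<open>hit\<close> the
    left side is a multiple of \<open>e (v \<Lambda>')\<close>, and on the right \<open>Z\<close>
    commutes with \<open>e\<close> and acts as \<open>c\<close>.\<close>
  have rank: "M \<Lambda>1 \<Lambda>' *\<^sub>C e (v \<Lambda>') = c *\<^sub>C e (v \<Lambda>1)" if L1: "\<Lambda>1 \<in> {\<Lambda>, \<Lambda>'}" for \<Lambda>1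
  proof -
    have v1: "v \<Lambda>1 \<in> V" using vV L L1 by auto
    have elin: "e (b *\<^sub>C x) = b *\<^sub>C e x" if "x \<in> V" for b x
      using lin[OF E] that unfolding e_def linear_on_def by blast
    have F: "(embed_op k n (iproj k (\<Lambda>' ! k)) :: 'N tensor_op) \<in> centralizer n"
        by (rule emb[OF kn(1) iproj_centralizer])
    have Zn: "embed_op (k - 1) n Z \<in> centralizer n" by (rule emb[OF kn(2) Z(1)])
    have FE: "embed_op k n (iproj k (\<Lambda>' ! k)) \<circ> E \<in> centralizer n"
      by (rule centralizer_comp[OF F E])
    have "M \<Lambda>1 \<Lambda>' *\<^sub>C e (v \<Lambda>') = e (M \<Lambda>1 \<Lambda>' *\<^sub>C v \<Lambda>')" by (rule elin[OF vV[OF L(2)], symmetric])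
    also have "\<dots> = e (z k (\<Lambda>' ! k) (e (v \<Lambda>1)))" by (simp only: hit[OF L1])
    also have "\<dots> = act (E \<circ> (embed_op k n (iproj k (\<Lambda>' ! k)) \<circ> E)) (v \<Lambda>1)"
      unfolding comp[OF E FE v1] comp[OF F E v1] z_def e_def ..
    also have "\<dots> = act (embed_op (k - 1) n Z \<circ> E) (v \<Lambda>1)"
      using sandwich by (simp only: comp_assoc)
    also have "\<dots> = act (embed_op (k - 1) n Z) (e (v \<Lambda>1))" unfolding comp[OF Zn E v1] e_def ..
    also have "\<dots> = e (act (embed_op (k - 1) n Z) (v \<Lambda>1))"
      unfolding E_def
      by (rule commute[OF _ kn(2) Z(1) v1]) (unfold E_def, rule embed_op_bar_commute_low[OF k
          kn(3) Z(1)])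
    also have "\<dots> = c *\<^sub>C e (v \<Lambda>1)" unfolding c[OF L1] by (rule elin[OF v1])
    finally show ?thesis .
  qed
  show ?thesis
  \<comment> \<open>If this vector vanishes, the row of \<open>\<Lambda>'\<close> is zero and both
    products are 0; otherwise it can be cancelled in \<open>rank\<close> for
    \<open>\<Lambda>'\<close>.\<close>
  proof (cases "e (v \<Lambda>') = 0")
    case True
    then have "M \<Lambda>' b = 0" for b
      unfolding M_def rep_def using cvec.representation_zero[of "v ` P"] by simp
    then show ?thesis by (simp add: ME)
  next
    case False
    have "M \<Lambda>' \<Lambda>' = c" using rank[of \<Lambda>'] False by (simp add: cvec.scale_right_imp_eq)
    \<comment> \<open>The coefficient of \<open>v \<Lambda>\<close> in \<open>rank\<close> for
      \<Lambda>; the scalar \<open>c\<close> has just been identified with the diagonal entry at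
      \<open>\<Lambda>'\<close>.\<close>
    moreover have "M \<Lambda> \<Lambda>' * M \<Lambda>' \<Lambda> = c * M \<Lambda> \<Lambda>"
      using arg_cong[OF rank[of \<Lambda>], of "\<lambda>x. rep x (v \<Lambda>)"] rep_scale eV vV L by (simp add: M_def)
    ultimately show ?thesis by (simp add: ME mult.commute)
  qed
qed

end
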